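(* Let $R=K[[\mathbf x,y,z]]$ with $\mathbf x=(x_1,\dots,x_n)$, let $J\subseteq R$ be an ideal of order $c=\mathrm{ord}\,J$, and suppose $J_{-1}=\mathrm{coeff}^c_{(\mathbf x,y,z)}(J)$ has a factorization $J_{-1}=(\mathbf x^r)\cdot I_{-1}$ with $r\in\mathbb N^n$ and $I_{-1}\subseteq K[[\mathbf x,y]]$ an ideal of order $d$. Let $\mathcal G$ be the set of pairs $(g,h)$ with $g\in K[[\mathbf x,y]]$, $h\in K[[\mathbf x]]$, $\mathrm{ord}\,g\ge1$, $\mathrm{ord}\,h\ge1$ such that the coordinate change $z=z_g+g$, $y=y_h+h$ preserves the setting, and for $(g,h)\in\mathcal G$ let $s_{(g,h)}\in\mathbb N_\infty$ be the order of the second coefficient ideal $J_{-2}^{(g,h)}$. If there exists an element $f\in J$ which is $\mathrm{ord}$-clean with respect to $J_{-1}$, then there is a pair $(g_{\max},h_{\max})\in\mathcal G$ with $$s_{(g_{\max},h_{\max})}\ge s_{(g,h)}\quad\text{for all }(g,h)\in\mathcal G.$$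
   Context: $K$ is an algebraically closed field of arbitrary characteristic, $c$ is a positive integer, $\mathbb N_\infty=\mathbb N\cup\{\infty\}$. In a power series ring $\mathrm{ord}\,J=\sup\{n:J\subseteq\mathfrak m^n\}$, $\mathfrak m$ the maximal ideal. For $f\ne0$, $\mathrm{in}(f)$ is the lowest-degree homogeneous part of $f$ in the given parameters; $\mathrm{in}(0)=0$. Coefficient ideal: for an ideal $J$ of $K[[\mathbf u,w]]$, writing $f=\sum_{i\ge0}f_iw^i$ with $f_i\in K[[\mathbf u]]$, $\mathrm{coeff}^c_{(\mathbf u,w)}(J)=(f_i^{c!/(c-i)}:f\in J,\ 0\le i<c)\subseteq K[[\mathbf u]]$; $\mathrm{coeff}^0=0$. For a pair $(g,h)$ put $y_h=y-h$, $z_g=z-g$ and $J_{-1}^{(g,h)}=\mathrm{coeff}^c_{(\mathbf x,y_h,z_g)}(J)\subseteq K[[\mathbf x,y_h]]=K[[\mathbf x,y]]$. The coordinate change preserves the setting if $J_{-1}^{(g,h)}$ has a factorization $J_{-1}^{(g,h)}=(\mathbf x^r)\cdot I_{-1}^{(g,h)}$ with $\mathrm{ord}\,I_{-1}^{(g,h)}=d$. In that case $J_{-2}^{(g,h)}=\mathrm{coeff}^d_{(\mathbf x,y_h)}(I_{-1}^{(g,h)})\subseteq K[[\mathbf x]]$ and $s_{(g,h)}=\mathrm{ord}\,J_{-2}^{(g,h)}$. $f\in R$ is $z$-regular of order $c$ if $f(0,\dots,0,z)=z^cu(z)$ with $u\in K[[z]]^*$. Put $q=1$ if $\mathrm{char}K=0$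 and $q=p^{\mathrm{ord}_pc}$ (the largest power of $p$ dividing $c$) if $\mathrm{char}K=p>0$. With $f=\sum f_iz^i$, $f_i\in K[[\mathbf x,y]]$, and $m=\mathrm{ord}\,J_{-1}$, an element $f\in J$ that is $z$-regular of order $c$ is $\mathrm{ord}$-clean with respect to $J_{-1}$ if at least one of these holds: (1) there is $i$ with $c-q<i<c$ and $\mathrm{ord}\,f_i=\frac{c-i}{c!}m$; (2) $\mathrm{ord}\,f_{c-q}>\frac q{c!}m$; (3) there is no $G\in K[[\mathbf x,y]]$ with $\mathrm{in}(f_{c-q})=\mathrm{in}(f_c)G^q$. *)

theory Defs
  imports
    "HOL-Analysis.Finite_Cartesian_Product"
    "HOL-Computational_Algebra.Computational_Algebra"
    "HOL-Library.Extended_Nat"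
begin

section \<open>Power series in the variables indexed by a finite type\<close>

text \<open>
  The type \<open>('k, 'n) mps\<close> is $K[[\mathbf x]]$ with $\mathbf x = (x_i)_{i}$ indexed by \<open>'n\<close>;
  a series is its coefficient function on the exponents $\mathbb N^n$. The larger rings are
  iterated univariate power series: \<open>('k, 'n) mps fps\<close> is $K[[\mathbf x,y]] = K[[\mathbf x]][[y]]$ and
  \<open>('k, 'n) mps fps fps\<close> is $K[[\mathbf x,y,z]] = K[[\mathbf x,y]][[z]]$.
\<close>

typedef ('k, 'n) mps = "UNIV :: (nat ^ 'n \<Rightarrow> 'k) set"
  morphisms mps_coeff Abs_mps ..

setup_lifting type_definition_mps

lemma mps_eqI: "(\<And>e. mps_coeff f e = mps_coeff g e) \<Longrightarrow> f = g"
  by (simp add: mps_coeff_inject[symmetric] fun_eq_iff)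

lemma finite_exponent_splits: "finite {(a, b). a + b = (e :: nat ^ 'n::finite)}"
proof (rule finite_subset)
  let ?B = "(vec_lambda :: ('n \<Rightarrow> nat) \<Rightarrow> _) ` {f. \<forall>i. f i \<in> {..e $ i}}"
  show "finite (?B \<times> ?B)"
    by (intro finite_cartesian_product finite_imageI finite_Collect_bounded_ex)
       (use finite_PiE[of "UNIV :: 'n set" "\<lambda>i. {..e $ i}"] in
         \<open>simp_all add: PiE_def Pi_def extensional_def\<close>)
  show "{(a, b). a + b = e} \<subseteq> ?B \<times> ?B"
  proof clarify
    fix a b assume e: "e = a + b"
    have "a = vec_lambda (vec_nth a)" "b = vec_lambda (vec_nth b)" by simp_all
    then show "a \<in> (vec_lambda :: ('n \<Rightarrow> nat) \<Rightarrow> _) ` {f. \<forall>i. f i \<in> {..(a + b) $ i}} \<and>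
               b \<in> (vec_lambda :: ('n \<Rightarrow> nat) \<Rightarrow> _) ` {f. \<forall>i. f i \<in> {..(a + b) $ i}}"
      by (intro conjI image_eqI[where x = "vec_nth a"] image_eqI[where x = "vec_nth b"]) auto
  qed
qed

lift_definition mps_monom :: "nat ^ 'n \<Rightarrow> ('k::zero_neq_one, 'n) mps" is
  "\<lambda>r e. if e = r then 1 else 0" .

instantiation mps :: (comm_ring_1, finite) comm_ring_1
begin

lift_definition zero_mps :: "('a, 'b) mps" is "\<lambda>_. 0" .
lift_definition one_mps :: "('a, 'b) mps" is "\<lambda>e. if e = 0 then 1 else 0" .
lift_definition plus_mps :: "('a, 'b) mps \<Rightarrow> ('a, 'b) mps \<Rightarrow> ('a, 'b) mps" is
  "\<lambda>f g e. f e + g e" .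
lift_definition minus_mps :: "('a, 'b) mps \<Rightarrow> ('a, 'b) mps \<Rightarrow> ('a, 'b) mps" is
  "\<lambda>f g e. f e - g e" .
lift_definition uminus_mps :: "('a, 'b) mps \<Rightarrow> ('a, 'b) mps" is "\<lambda>f e. - f e" .
lift_definition times_mps :: "('a, 'b) mps \<Rightarrow> ('a, 'b) mps \<Rightarrow> ('a, 'b) mps" is
  "\<lambda>f g e. \<Sum>(a, b) | a + b = e. f a * g b" .

instance
proof
  fix f g h :: "('a, 'b) mps"
  show "f + g + h = f + (g + h)" "f + g = g + f" "0 + f = f" "- f + f = 0" "f - g = f + - g"
    by (transfer, simp add: algebra_simps)+
  show "f * g = g * f"
    by transfer
       (auto simp: fun_eq_iff algebra_simps
         intro!: sum.reindex_bij_witness[of _ "\<lambda>(a, b). (b, a)" "\<lambda>(a, b). (b, a)"])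
  show "(f + g) * h = f * h + g * h"
    by transfer (simp add: fun_eq_iff algebra_simps sum.distrib case_prod_unfold)
  show "1 * f = f"
  proof (rule mps_eqI)
    fix e
    have "mps_coeff (1 * f) e =
        (\<Sum>p | fst p + snd p = e. (if fst p = 0 then 1 else 0) * mps_coeff f (snd p))"
      by transfer (simp add: case_prod_unfold)
    also have "\<dots> = (\<Sum>p \<in> {(0 :: nat ^ 'b, e)}. (if fst p = 0 then 1 else 0) * mps_coeff f (snd p))"
    proof (rule sum.mono_neutral_right)
      show "finite {p. fst p + snd p = e}"
        using finite_exponent_splits[of e] by (simp add: case_prod_unfold)
    qed auto
    finally show "mps_coeff (1 * f) e = mps_coeff f e" by simp
  qed
  show "f * g * h = f * (g * h)"
  proof (rule mps_eqI)
    fix e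
    let ?f = "mps_coeff f" and ?g = "mps_coeff g" and ?h = "mps_coeff h"
    have "mps_coeff (f * g * h) e =
        (\<Sum>p\<in>{(a, b). a + b = e}. \<Sum>q\<in>{(a, b). a + b = fst p}. ?f (fst q) * ?g (snd q) * ?h (snd p))"
      by (simp add: times_mps.rep_eq sum_distrib_right case_prod_unfold)
    also have "\<dots> = (\<Sum>(p, q)\<in>(SIGMA p:{(a, b). a + b = e}. {(a, b). a + b = fst p}).
        ?f (fst q) * ?g (snd q) * ?h (snd p))"
      by (intro sum.Sigma ballI finite_exponent_splits)
    also have "\<dots> = (\<Sum>(p, q)\<in>(SIGMA p:{(a, b). a + b = e}. {(a, b). a + b = snd p}).
        ?f (fst p) * (?g (fst q) * ?h (snd q)))"
      by (rule sum.reindex_bij_witness[of _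
            "\<lambda>(p, q). ((fst p + fst q, snd q), (fst p, fst q))"
            "\<lambda>(p, q). ((fst q, snd q + snd p), (snd q, snd p))"])
         (auto simp: algebra_simps)
    also have "\<dots> = (\<Sum>p\<in>{(a, b). a + b = e}. \<Sum>q\<in>{(a, b). a + b = snd p}.
        ?f (fst p) * (?g (fst q) * ?h (snd q)))"
      by (intro sum.Sigma[symmetric] ballI finite_exponent_splits)
    also have "\<dots> = mps_coeff (f * (g * h)) e"
      by (simp add: times_mps.rep_eq sum_distrib_left case_prod_unfold)
    finally show "mps_coeff (f * g * h) e = mps_coeff (f * (g * h)) e" .
  qed
  show "(0 :: ('a, 'b) mps) \<noteq> 1"
    by transfer (auto simp: fun_eq_iff)
qed

end


section \<open>Ideals and orders\<close>

text \<open>Ideals of a commutative ring are its submodules.\<close>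

global_interpretation ideal: module "(*) :: 'a::comm_ring_1 \<Rightarrow> 'a \<Rightarrow> 'a"
  defines gen_ideal = ideal.span and is_ideal = ideal.subspace
  by unfold_locales (simp_all add: algebra_simps)

definition ideal_mult :: "'a::comm_ring_1 set \<Rightarrow> 'a set \<Rightarrow> 'a set" where
  "ideal_mult I J = gen_ideal {a * b |a b. a \<in> I \<and> b \<in> J}"

primrec ideal_power :: "'a::comm_ring_1 set \<Rightarrow> nat \<Rightarrow> 'a set" where
  "ideal_power I 0 = UNIV"
| "ideal_power I (Suc n) = ideal_mult I (ideal_power I n)"

text \<open>The power series rings used here are local, so the maximal ideal is the set of non-units.\<close>

definition max_ideal :: "'a::comm_ring_1 set" where
  "max_ideal = {a. \<not> a dvd 1}"

definition ideal_ord :: "'a::comm_ring_1 set \<Rightarrow> enat" where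
  "ideal_ord J = Sup {enat n |n. J \<subseteq> ideal_power max_ideal n}"

abbreviation elt_ord :: "'a::comm_ring_1 \<Rightarrow> enat" where
  "elt_ord f \<equiv> ideal_ord {f}"


section \<open>Coefficient ideals\<close>

text \<open>
  \<open>expands w f a\<close> says $f = \sum_{i \ge 0} a_i w^i$ with coefficients $a_i$ in the base ring
  $A = K[[\mathbf u]]$ of $A[[t]]$, where the parameter $w$ is $t$ itself or $t - g$ with
  $g \in A$, $\mathrm{ord}\, g \ge 1$. Convergence is $w$-adic, which for such $w$ is the same as
  convergence in the topology of the maximal ideal. The built-in topology of \<open>fps\<close>
  is the $t$-adic one, for which $\sum a_i (t - g)^i$ need not converge.
\<close>

definition expands :: "'a::comm_ring_1 fps \<Rightarrow> 'a fps \<Rightarrow> (nat \<Rightarrow> 'a) \<Rightarrow> bool" where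
  "expands w f a \<longleftrightarrow> (\<forall>N. w ^ N dvd f - (\<Sum>i<N. fps_const (a i) * w ^ i))"

definition coeff_ideal :: "nat \<Rightarrow> 'a::comm_ring_1 fps \<Rightarrow> 'a fps set \<Rightarrow> 'a set" where
  "coeff_ideal c w J =
     gen_ideal {a i ^ (fact c div (c - i)) |f a i. f \<in> J \<and> expands w f a \<and> i < c}"


section \<open>Changes of the parameters $y$ and $z$\<close>

text \<open>
  $J_{-1}^{(g,h)}$ is the coefficient ideal with respect to $z_g = z - g$. It is independent of $h$,
  since $K[[\mathbf x,y_h]] = K[[\mathbf x,y]]$ as rings.
\<close>

definition J1 ::
  "nat \<Rightarrow> ('k::comm_ring_1, 'n::finite) mps fps fps set \<Rightarrow> ('k, 'n) mps fps \<Rightarrow> ('k, 'n) mps fps set"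
where
  "J1 c J g = coeff_ideal c (fps_X - fps_const g) J"

definition factorization ::
  "nat ^ 'n \<Rightarrow> nat \<Rightarrow> ('k::comm_ring_1, 'n::finite) mps fps set \<Rightarrow> ('k, 'n) mps fps set \<Rightarrow> bool"
where
  "factorization r d A I \<longleftrightarrow>
     is_ideal I \<and> A = ideal_mult (gen_ideal {fps_const (mps_monom r)}) I \<and> ideal_ord I = enat d"

definition coord_changes ::
  "nat ^ 'n \<Rightarrow> nat \<Rightarrow> nat \<Rightarrow> ('k::comm_ring_1, 'n::finite) mps fps fps set \<Rightarrow>
     (('k, 'n) mps fps \<times> ('k, 'n) mps) set"
where
  "coord_changes r c d J =
     {(g, h). elt_ord g \<ge> 1 \<and> elt_ord h \<ge> 1 \<and> (\<exists>I. factorization r d (J1 c J g) I)}"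

text \<open>The factor $I_{-1}$ is unique because $\mathbf x^r$ is not a zero divisor.\<close>

definition I1 ::
  "nat ^ 'n \<Rightarrow> nat \<Rightarrow> nat \<Rightarrow> ('k::comm_ring_1, 'n::finite) mps fps fps set \<Rightarrow> ('k, 'n) mps fps \<Rightarrow>
     ('k, 'n) mps fps set"
where
  "I1 r c d J g = (THE I. factorization r d (J1 c J g) I)"

definition J2 ::
  "nat ^ 'n \<Rightarrow> nat \<Rightarrow> nat \<Rightarrow> ('k::comm_ring_1, 'n::finite) mps fps fps set \<Rightarrow> ('k, 'n) mps fps \<Rightarrow>
     ('k, 'n) mps \<Rightarrow> ('k, 'n) mps set"
where
  "J2 r c d J g h = coeff_ideal d (fps_X - fps_const h) (I1 r c d J g)"


section \<open>Clean elements\<close>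

definition hom_part :: "nat \<Rightarrow> ('k::comm_ring_1, 'n::finite) mps fps \<Rightarrow> ('k, 'n) mps fps" where
  "hom_part k f = Abs_fps (\<lambda>j. Abs_mps (\<lambda>e.
     if (\<Sum>i\<in>UNIV. e $ i) + j = k then mps_coeff (fps_nth f j) e else 0))"

definition initial_form :: "('k::comm_ring_1, 'n::finite) mps fps \<Rightarrow> ('k, 'n) mps fps" where
  "initial_form f = (if f = 0 then 0 else hom_part (LEAST k. hom_part k f \<noteq> 0) f)"

text \<open>The series $f(0, \dots, 0, z) \in K[[z]]$.\<close>

definition restrict_z :: "('k::comm_ring_1, 'n::finite) mps fps fps \<Rightarrow> 'k fps" where
  "restrict_z f = Abs_fps (\<lambda>i. mps_coeff (fps_nth (fps_nth f i) 0) 0)"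

definition z_regular :: "nat \<Rightarrow> ('k::comm_ring_1, 'n::finite) mps fps fps \<Rightarrow> bool" where
  "z_regular c f \<longleftrightarrow> (\<exists>u. u dvd 1 \<and> restrict_z f = fps_X ^ c * u)"

definition char_power :: "'k::comm_ring_1 itself \<Rightarrow> nat \<Rightarrow> nat" where
  "char_power _ c = (if CHAR('k) = 0 then 1 else CHAR('k) ^ multiplicity CHAR('k) c)"

text \<open>
  The comparisons of orders with $\frac{c-i}{c!} m$ and $\frac{q}{c!} m$ are multiplied by $c!$.
\<close>

definition ord_clean ::
  "nat \<Rightarrow> ('k::comm_ring_1, 'n::finite) mps fps fps set \<Rightarrow> ('k, 'n) mps fps fps \<Rightarrow> bool"
where
  "ord_clean c J f \<longleftrightarrow> f \<in> J \<and> z_regular c f \<and>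
     (let q = char_power TYPE('k) c; m = ideal_ord (coeff_ideal c fps_X J) in
        (\<exists>i. c - q < i \<and> i < c \<and> enat (fact c) * elt_ord (fps_nth f i) = enat (c - i) * m) \<or>
        enat (fact c) * elt_ord (fps_nth f (c - q)) > enat q * m \<or>
        (\<nexists>G. initial_form (fps_nth f (c - q)) = initial_form (fps_nth f c) * G ^ q))"

end

theory Submission imports Defs
begin

text \<open>
  The order of $J_{-2}$ has to be bounded, or the value $\infty$ has to be attained. Give $y - h$ the weight
  $\sigma$ and each $x_i$ the weight one. A pair $(g,h)$ is called good for $\sigma$ if the coefficients of all $f \in J$ with
  respect to $z - g$ have the weight and the divisibility by $x$ that correspond to
  $J_{-1}^{(g,h)} \subseteq x^r \cdot (\hbox{weight} \ge d \sigma)$. If $s_{(g,h)} \ge d!\, \sigma$ then $(g,h)$ is good for $\sigma$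
  (\<open>good_of_J2_ord\<close>), and a pair that is good for all $\sigma$ has $J_{-2} = 0$ (\<open>good_all_imp_J2_zero\<close>). So the
  theorem follows once the existence of good pairs for every $\sigma$ is known to imply the existence of one pair that is good
  for all $\sigma$ (\<open>good_limit_exists\<close>), because otherwise $s$ takes only finitely many values.

  The clean element $f$ is used to compare good pairs. The binomial coefficients $\binom c i$ with $c - q < i < c$ vanish in $K$
  and $\binom c q$ does not. By Taylor expansion two good $g$ for the same $h$ differ by a series of large weight
  (\<open>good_compare\<close>), and a change of $g$ by $G$ affects the coefficients of index $i > c - q$ not at all, and the
  coefficient of index $c - q$ by a $q$-th power $(\kappa G)^q$, as far as the lowest weights are concerned. These lowest
  weight parts are monomials $b\, x^e (y - h)^D$ with $c!\,(e, D)$ proportional to $(r, d)$ (\<open>adm_lead\<close>).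

  In most cases $h$ is rigid: the pair being good for $\sigma$ determines $h$ modulo order $\sigma$ (\<open>rigid_h\<close>). Indeed,
  if $h$ and $h'$ differed in lower order, the lowest weight part of a suitable coefficient would be a multiple of both
  $x^e (y - h)^D$ and $x^e (y - h')^D$. The coefficient is one of index $i > c - q$ in the first case of cleanness and any one that
  realizes the order of $J_{-1}$ in the second. In the third it is the one of index $c - q$, which is not a $q$-th power;
  the comparison modulo $q$-th powers still succeeds if $D \ge q$, that is, if $d \ge c!$. Then the $h$
  converge, and the $g$ converge monomial by monomial wherever it matters (\<open>good_limit\<close>).

  In the third case with $d < c!$ neither $g$ nor $h$ need converge. Here $g$ may be taken in $K[[x]]$, so there are series
  $G_k, H_k \in K[[x]]$ that satisfy the equations expressing goodness with growing precision. After the substitution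
  $x_i \mapsto x_i^{c!}$ and division by powers of $x^r$, a mixed Hasse derivative of $f$ is a series $Q(z, y)$ regular of order
  $N$ in $y$, where $N \mid D$ is a power of the characteristic exponent, and $Q$ and its Taylor coefficients of low order almost vanish at
  $(G_k, H_k)$. The implicit function theorem gives a series $\alpha(z)$ with $H_k^N \approx \alpha(G_k)$. If a subsequence of the $G_k$
  converges, so do the corresponding $H_k$. Otherwise infinitely many $G_k$ have pairwise distances bounded from below, and a series in $z$
  that almost vanishes at these points is zero by interpolation (\<open>identity_principle\<close>). This turns the
  approximate equations into identities: $Q$ is a unit times $y^N - \alpha(z)$, the Hasse derivatives of $\alpha$ of positive order less than
  $N$ vanish, $\alpha = \eta^N$, and the equations hold along the curve $y = \eta(z)$. At its point $z = 0$, after the substitution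
  is undone, one finds the pair $(0, \eta(0))$, which is good for all weights.
\<close>

(* Here the symbol $ always selects a component of an exponent vector. *)
no_notation fps_nth (infixl "$" 75)

(* As a rewrite rule this is associativity of multiplication read from right to left. *)
declare ideal.scale_scale [simp del]

section \<open>Complete filtered rings and the substitution $X \mapsto X + g$\<close>

text \<open>
  The common structure of $K[[x]]$ and $K[[x,y]]$: \<open>fl n\<close> plays the role of the $n$-th power of the
  maximal ideal, and the last two axioms say that the ring is separated and complete. All infinite sums below
  are limits for this filtration; the $X$-adic topology of \<open>fps\<close> would not do, because $g$ and $h$ are
  small only for the filtration.
\<close>

class filt_ring = comm_ring_1 +
  fixes fl :: "nat \<Rightarrow> 'a set"
  assumes fl_0 [simp]: "fl 0 = UNIV"
    and fl_zero [simp]: "0 \<in> fl n"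
    and fl_add: "a \<in> fl n \<Longrightarrow> b \<in> fl n \<Longrightarrow> a + b \<in> fl n"
    and fl_mult: "a \<in> fl m \<Longrightarrow> b \<in> fl n \<Longrightarrow> a * b \<in> fl (m + n)"
    and fl_Suc: "fl (Suc n) \<subseteq> fl n"
    and fl_separated: "(\<And>n. a \<in> fl n) \<Longrightarrow> a = 0"
    and fl_complete: "(\<And>n. f n \<in> fl n) \<Longrightarrow> \<exists>s. \<forall>N. s - (\<Sum>n<N. f n) \<in> fl N"

lemma fl_antimono: "m \<le> n \<Longrightarrow> a \<in> fl n \<Longrightarrow> a \<in> fl m"
  using lift_Suc_antimono_le[of fl m n] fl_Suc by blast

lemma fl_multl: "b \<in> fl n \<Longrightarrow> a * b \<in> fl n"
  using fl_mult[of a 0 b n] by simp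

lemma fl_multr: "a \<in> fl n \<Longrightarrow> a * b \<in> fl n"
  using fl_mult[of a n b 0] by simp

lemma fl_uminus: "a \<in> fl n \<Longrightarrow> - a \<in> fl n"
  using fl_multl[of a n "-1"] by simp

lemma fl_diff: "a \<in> fl n \<Longrightarrow> b \<in> fl n \<Longrightarrow> a - b \<in> fl n"
  using fl_add[of a n "- b"] fl_uminus[of b n] by simp

lemma fl_sum: "(\<And>x. x \<in> X \<Longrightarrow> f x \<in> fl n) \<Longrightarrow> sum f X \<in> fl n"
  by (induction X rule: infinite_finite_induct) (auto intro: fl_add)

lemma fl_power: "a \<in> fl m \<Longrightarrow> a ^ n \<in> fl (n * m)"
  by (induction n) (auto intro: fl_mult)

lemma fl_cong: "a - b \<in> fl n \<Longrightarrow> a \<in> fl n \<longleftrightarrow> b \<in> fl n"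
  using fl_add[of "a - b" n b] fl_diff[of a n "a - b"] by auto

lemma fl_commute: "a - b \<in> fl n \<longleftrightarrow> b - a \<in> fl n"
  using fl_uminus[of "a - b" n] fl_uminus[of "b - a" n] by auto

lemma fl_trans: "a - b \<in> fl n \<Longrightarrow> b - c \<in> fl n \<Longrightarrow> a - c \<in> fl n"
  using fl_add[of "a - b" n "b - c"] by simp

lemma fl_eqI: "(\<And>n. a - b \<in> fl n) \<Longrightarrow> a = b"
  using fl_separated[of "a - b"] by auto

definition fsum :: "(nat \<Rightarrow> 'a::filt_ring) \<Rightarrow> 'a" where
  "fsum f = (SOME s. \<forall>N. s - (\<Sum>n<N. f n) \<in> fl N)"

lemma fsum: "(\<And>n. f n \<in> fl n) \<Longrightarrow> fsum f - (\<Sum>n<N. f n) \<in> fl N"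
  unfolding fsum_def using someI_ex[OF fl_complete[of f]] by blast

lemma fsum_unique: "(\<And>n. f n \<in> fl n) \<Longrightarrow> (\<And>N. s - (\<Sum>n<N. f n) \<in> fl N) \<Longrightarrow> fsum f = s"
  by (rule fl_eqI, rule fl_trans[OF fsum]) (auto simp: fl_commute[of _ s])

lemma fsum_in_fl: "(\<And>n. f n \<in> fl n) \<Longrightarrow> (\<And>n. f n \<in> fl N) \<Longrightarrow> fsum f \<in> fl N"
  using fsum[of f N] fl_sum[of "{..<N}" f N] fl_cong by blast

lemma fsum_add:
  assumes "\<And>n. f n \<in> fl n" "\<And>n. h n \<in> fl n"
  shows "fsum (\<lambda>n. f n + h n) = fsum f + fsum h"
proof (rule fsum_unique)
  show "fsum f + fsum h - (\<Sum>n<N. f n + h n) \<in> fl N" for N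
    using fl_add[OF fsum[OF assms(1), of N] fsum[OF assms(2), of N]]
    by (simp add: sum.distrib algebra_simps)
qed (use assms in \<open>auto intro: fl_add\<close>)

lemma Cauchy_limit:
  assumes "\<And>n. f (Suc n) - f n \<in> fl n"
  shows "\<exists>s. \<forall>n. s - f n \<in> fl n"
proof -
  obtain s where s: "s - (\<Sum>n<N. f (Suc n) - f n) \<in> fl N" for N
    using fl_complete[of "\<lambda>n. f (Suc n) - f n"] assms by blast
  have tel: "(\<Sum>n<N. f (Suc n) - f n) = f N - f 0" for N by (induction N) auto
  have "s + f 0 - f N \<in> fl N" for N using s[of N] unfolding tel by (simp add: algebra_simps)
  then show ?thesis by blast
qed

text \<open>Geometric series.\<close>

lemma dvd_one_add_fl:
  assumes "u dvd 1" "a \<in> fl 1"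
  shows "(u + a) dvd 1"
proof -
  obtain v where v: "u * v = 1" using assms(1) by (metis dvdE)
  define b where "b = - (a * v)"
  have b: "b ^ n \<in> fl n" for n
    using fl_power[of b 1 n] assms(2) by (simp add: b_def fl_multr fl_uminus)
  obtain s where s: "s - (\<Sum>n<N. b ^ n) \<in> fl N" for N using fl_complete[of "\<lambda>n. b ^ n"] b by blast
  have "(1 - b) * s - 1 \<in> fl N" for N
  proof -
    have "(1 - b) * s - 1 = (1 - b) * (s - (\<Sum>n<N. b ^ n)) - b ^ N"
      using power_diff_1_eq[of b N] by (simp add: algebra_simps)
    then show ?thesis using fl_diff[OF fl_multl[OF s[of N]] b[of N]] by simp
  qed
  then have "(1 - b) * s = 1" by (rule fl_eqI)
  moreover have "(u + a) * v = 1 - b" using v by (simp add: b_def algebra_simps)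
  ultimately have "(u + a) * (v * s) = 1" by (simp add: mult.assoc[symmetric])
  then show ?thesis by (metis dvd_triv_left)
qed

instantiation fps :: (filt_ring) filt_ring
begin

definition fl_fps :: "nat \<Rightarrow> 'a fps set" where
  "fl_fps n = {F. \<forall>t. fps_nth F t \<in> fl (n - t)}"

instance
proof
  fix m n :: nat and a b :: "'a fps" and f :: "nat \<Rightarrow> 'a fps"
  show "(fl 0 :: 'a fps set) = UNIV" by (simp add: fl_fps_def)
  show "(0 :: 'a fps) \<in> fl n" by (simp add: fl_fps_def)
  show "a \<in> fl n \<Longrightarrow> b \<in> fl n \<Longrightarrow> a + b \<in> fl n" by (auto simp: fl_fps_def intro: fl_add)
  show "a \<in> fl m \<Longrightarrow> b \<in> fl n \<Longrightarrow> a * b \<in> fl (m + n)"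
  proof (unfold fl_fps_def, safe, unfold fps_mult_nth, rule fl_sum)
    fix t i :: nat assume h: "\<forall>t. fps_nth a t \<in> fl (m - t)" "\<forall>t. fps_nth b t \<in> fl (n - t)" "i \<in> {0..t}"
    have "fps_nth a i * fps_nth b (t - i) \<in> fl ((m - i) + (n - (t - i)))"
      using h(1,2) by (intro fl_mult) blast+
    then show "fps_nth a i * fps_nth b (t - i) \<in> fl (m + n - t)"
      by (rule fl_antimono[rotated]) (use h in auto)
  qed
  show "(fl (Suc n) :: 'a fps set) \<subseteq> fl n"
  proof
    fix x :: "'a fps" assume "x \<in> fl (Suc n)"
    then have "fps_nth x t \<in> fl (n - t)" for t
      using fl_antimono[of "n - t" "Suc n - t" "fps_nth x t"] by (simp add: fl_fps_def)
    then show "x \<in> fl n" by (simp add: fl_fps_def)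
  qed
  show "a = 0" if "\<And>n. a \<in> fl n"
  proof (rule fps_ext)
    fix t show "fps_nth a t = fps_nth 0 t"
      using that[of "_ + t"] by (auto simp: fl_fps_def intro!: fl_separated) (metis add_diff_cancel_right')
  qed
  show "\<exists>s. \<forall>N. s - (\<Sum>n<N. f n) \<in> fl N" if f: "\<And>n. f n \<in> fl n"
  proof -
    have *: "fps_nth (f (k + t)) t \<in> fl k" for k t using f[of "k + t"] by (auto simp: fl_fps_def) (metis add_diff_cancel_right')
    define s where "s = Abs_fps (\<lambda>t. (\<Sum>n<t. fps_nth (f n) t) + fsum (\<lambda>k. fps_nth (f (k + t)) t))"
    have "fps_nth (s - (\<Sum>n<N. f n)) t \<in> fl (N - t)" for N t
    proof (cases "N \<le> t")
      case False
      then obtain k where N: "N = t + k" by (metis nat_le_linear le_iff_add)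
      have "(\<Sum>n<N. fps_nth (f n) t) = (\<Sum>n<t. fps_nth (f n) t) + (\<Sum>j<k. fps_nth (f (j + t)) t)"
        unfolding N by (induction k) (auto simp: add_ac)
      then show ?thesis using fsum[of "\<lambda>k. fps_nth (f (k + t)) t" k] *
        by (simp add: s_def fps_sum_nth N)
    qed simp
    then show ?thesis unfolding fl_fps_def by blast
  qed
qed

end

lemma fl_fpsI: "(\<And>t. fps_nth F t \<in> fl (n - t)) \<Longrightarrow> F \<in> fl n" by (simp add: fl_fps_def)

lemma fl_fpsD: "F \<in> fl n \<Longrightarrow> fps_nth F t \<in> fl (n - t)" by (simp add: fl_fps_def)

lemma fl_fps_const_iff [simp]: "fps_const a \<in> fl n \<longleftrightarrow> a \<in> fl n"
  using fl_fpsD[of "fps_const a" n 0] by (auto intro!: fl_fpsI)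

lemma fps_X_in_fl [simp]: "fps_X \<in> fl (Suc 0)"
  by (rule fl_fpsI) (auto simp: fps_X_def split: nat.splits)

lemma fl_fps_1_iff: "F \<in> fl (Suc 0) \<longleftrightarrow> fps_nth F 0 \<in> fl (Suc 0)"
proof
  show "F \<in> fl (Suc 0) \<Longrightarrow> fps_nth F 0 \<in> fl (Suc 0)" using fl_fpsD[of F "Suc 0" 0] by simp
  assume *: "fps_nth F 0 \<in> fl (Suc 0)"
  have "fps_nth F t \<in> fl (Suc 0 - t)" for t using * by (cases t) auto
  then show "F \<in> fl (Suc 0)" by (rule fl_fpsI)
qed

lemma fps_truncate_in_fl: "F - (\<Sum>n<N. fps_const (fps_nth F n) * fps_X ^ n) \<in> fl N"
proof (rule fl_fpsI)
  fix t
  have "fps_nth (fps_const (fps_nth F n) * fps_X ^ n) t = (if t = n then fps_nth F n else 0)" for n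
    by (simp add: fps_X_power_iff)
  then have "fps_nth (\<Sum>n<N. fps_const (fps_nth F n) * fps_X ^ n) t = (if t < N then fps_nth F t else 0)"
    by (simp only: fps_sum_nth sum.delta' finite_lessThan lessThan_iff)
  then show "fps_nth (F - (\<Sum>n<N. fps_const (fps_nth F n) * fps_X ^ n)) t \<in> fl (N - t)"
    by (cases "t < N") (simp_all only: fps_sub_nth if_True if_False diff_self fl_zero, simp)
qed

lemma fps_unit_iff: "(F :: 'a::filt_ring fps) dvd 1 \<longleftrightarrow> fps_nth F 0 dvd 1"
proof
  assume "F dvd 1"
  then obtain G where "F * G = 1" by (metis dvdE)
  then have "fps_nth F 0 * fps_nth G 0 = 1" by (metis fps_mult_nth_0 fps_one_nth)
  then show "fps_nth F 0 dvd 1" by (metis dvd_triv_left)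
next
  assume "fps_nth F 0 dvd 1"
  then obtain v where v: "fps_nth F 0 * v = 1" by (metis dvdE)
  have "fps_const (fps_nth F 0) * fps_const v = 1" using v by simp
  then have "fps_const (fps_nth F 0) dvd 1" by (metis dvd_triv_left)
  moreover have "F - fps_const (fps_nth F 0) \<in> fl 1" by (simp add: fl_fps_1_iff)
  ultimately show "F dvd 1" using dvd_one_add_fl by fastforce
qed

subsection \<open>Filtered additive maps\<close>

definition filt_map :: "('a::filt_ring \<Rightarrow> 'b::filt_ring) \<Rightarrow> bool" where
  "filt_map T \<longleftrightarrow> (\<forall>a b. T (a + b) = T a + T b) \<and> (\<forall>n. \<forall>a \<in> fl n. T a \<in> fl n)"

definition filt_hom :: "('a::filt_ring \<Rightarrow> 'b::filt_ring) \<Rightarrow> bool" where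
  "filt_hom T \<longleftrightarrow> filt_map T \<and> (\<forall>a b. T (a * b) = T a * T b) \<and> T 1 = 1"

lemma filt_mapD:
  assumes "filt_map T"
  shows "T (a + b) = T a + T b" "a \<in> fl n \<Longrightarrow> T a \<in> fl n" "T 0 = 0" "T (a - b) = T a - T b"
    "T (- a) = - T a" "T (sum f X) = (\<Sum>x\<in>X. T (f x))"
proof -
  show *: "T (a + b) = T a + T b" for a b using assms by (simp add: filt_map_def)
  show "a \<in> fl n \<Longrightarrow> T a \<in> fl n" using assms by (auto simp: filt_map_def)
  show 0: "T 0 = 0" using *[of 0 0] by simp
  show "T (a - b) = T a - T b" using *[of "a - b" b] by (simp add: algebra_simps)
  show "T (- a) = - T a" using *[of a "- a"] 0 by (simp add: eq_neg_iff_add_eq_0 add.commute)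
  show "T (sum f X) = (\<Sum>x\<in>X. T (f x))"
    by (induction X rule: infinite_finite_induct) (auto simp: * 0)
qed

lemma filt_homD:
  assumes "filt_hom T"
  shows "filt_map T" "T (a + b) = T a + T b" "a \<in> fl n \<Longrightarrow> T a \<in> fl n" "T 0 = 0" "T (a - b) = T a - T b"
    "T (- a) = - T a" "T (sum f X) = (\<Sum>x\<in>X. T (f x))" "T (a * b) = T a * T b" "T 1 = 1"
    "T (a ^ k) = T a ^ k" "T (of_nat k) = of_nat k" "a dvd 1 \<Longrightarrow> T a dvd 1"
proof -
  show m: "filt_map T" using assms by (simp add: filt_hom_def)
  note filt_mapD[OF m]
  then show "T (a + b) = T a + T b" "a \<in> fl n \<Longrightarrow> T a \<in> fl n" "T 0 = 0" "T (a - b) = T a - T b"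
    "T (- a) = - T a" "T (sum f X) = (\<Sum>x\<in>X. T (f x))" by blast+
  show *: "T (a * b) = T a * T b" for a b using assms by (simp add: filt_hom_def)
  show 1: "T 1 = 1" using assms by (simp add: filt_hom_def)
  show "T (a ^ k) = T a ^ k" by (induction k) (auto simp: * 1)
  show "T (of_nat k) = of_nat k" by (induction k) (auto simp: 1 filt_mapD[OF m])
  show "T a dvd 1" if "a dvd 1"
  proof -
    from that obtain b where "1 = a * b" by (rule dvdE)
    then have "T a * T b = 1" using * 1 by metis
    then show ?thesis by (rule dvdI[OF sym])
  qed
qed

lemma filt_map_comp: "filt_map S \<Longrightarrow> filt_map T \<Longrightarrow> filt_map (\<lambda>x. S (T x))"
  unfolding filt_map_def by auto

lemma filt_hom_comp: "filt_hom S \<Longrightarrow> filt_hom T \<Longrightarrow> filt_hom (\<lambda>x. S (T x))"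
  unfolding filt_hom_def using filt_map_comp[of S T] by auto

lemma filt_map_mult: "filt_map T \<Longrightarrow> filt_map (\<lambda>x. T x * c)" "filt_map T \<Longrightarrow> filt_map (\<lambda>x. c * T x)"
  by (auto simp: filt_map_def algebra_simps intro: fl_multr fl_multl)

lemma filt_map_ident: "filt_map (\<lambda>x. x)"
  by (simp add: filt_map_def)

text \<open>Polynomials are dense, which is why identities between continuous maps need only be
  checked on monomials.\<close>

lemma filt_map_fps_eqI:
  assumes S: "filt_map S" and T: "filt_map T"
    and eq: "\<And>a n. S (fps_const a * fps_X ^ n) = T (fps_const a * fps_X ^ n)"
  shows "S F = T F"
proof (rule fl_eqI)
  fix N
  let ?P = "\<Sum>n<N. fps_const (fps_nth F n) * fps_X ^ n"
  have "S ?P = T ?P" by (simp add: filt_mapD(6)[OF S] filt_mapD(6)[OF T] eq)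
  then have "S F - T F = S (F - ?P) - T (F - ?P)"
    by (simp add: filt_mapD(4)[OF S] filt_mapD(4)[OF T])
  then show "S F - T F \<in> fl N"
    by (simp only: fl_diff fps_truncate_in_fl filt_mapD(2)[OF S] filt_mapD(2)[OF T])
qed

lemma filt_hom_fpsI:
  assumes T: "filt_map T"
    and eq: "\<And>a m b n. T (fps_const a * fps_X ^ m * (fps_const b * fps_X ^ n)) =
      T (fps_const a * fps_X ^ m) * T (fps_const b * fps_X ^ n)"
    and 1: "T 1 = 1"
  shows "filt_hom T"
proof -
  have *: "T (F * (fps_const b * fps_X ^ n)) = T F * T (fps_const b * fps_X ^ n)" for F b n
    by (rule filt_map_fps_eqI[OF filt_map_comp[OF T filt_map_mult(1)[OF filt_map_ident]]
          filt_map_mult(1)[OF T] eq])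
  have "T (F * G) = T F * T G" for F G
    by (rule filt_map_fps_eqI[OF filt_map_comp[OF T filt_map_mult(2)[OF filt_map_ident]]
          filt_map_mult(2)[OF T] *])
  then show ?thesis using T 1 by (simp add: filt_hom_def)
qed

subsection \<open>Coefficientwise maps\<close>

definition fmap :: "('a \<Rightarrow> 'b) \<Rightarrow> 'a fps \<Rightarrow> 'b fps" where
  "fmap T F = Abs_fps (\<lambda>n. T (fps_nth F n))"

lemma fmap_nth [simp]: "fps_nth (fmap T F) n = T (fps_nth F n)"
  by (simp add: fmap_def)

lemma filt_map_fmap: "filt_map T \<Longrightarrow> filt_map (fmap T)"
  unfolding filt_map_def fps_eq_iff by (simp add: fl_fps_def)

lemma filt_hom_fmap:
  assumes "filt_hom T"
  shows "filt_hom (fmap T)"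
  using filt_map_fmap[OF filt_homD(1)[OF assms]]
  unfolding filt_hom_def fps_eq_iff fmap_nth fps_mult_nth filt_homD(7)[OF assms] filt_homD(8)[OF assms]
  by (simp add: filt_homD(4)[OF assms] filt_homD(9)[OF assms])

lemma fmap_const: "filt_map T \<Longrightarrow> fmap T (fps_const a) = fps_const (T a)"
  using filt_mapD(3)[of T] by (auto simp: fps_eq_iff)

lemma fmap_X: "filt_hom T \<Longrightarrow> fmap T fps_X = fps_X"
  using filt_homD(4,9)[of T] by (auto simp: fps_eq_iff fps_X_def)

subsection \<open>The substitution $X \mapsto X + g$\<close>

definition shift :: "'a::filt_ring \<Rightarrow> 'a fps \<Rightarrow> 'a fps" where
  "shift g F = fsum (\<lambda>n. fps_const (fps_nth F n) * (fps_X + fps_const g) ^ n)"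

context
  fixes g :: "'a::filt_ring" assumes g: "g \<in> fl (Suc 0)"
begin

lemma shift_power_in_fl: "(fps_X + fps_const g) ^ n \<in> fl n"
  using fl_power[of "fps_X + fps_const g" 1 n] g by (simp add: fl_add)

lemma shift_term_in_fl: "fps_const a * (fps_X + fps_const g) ^ n \<in> fl n"
  by (intro fl_multl shift_power_in_fl)

lemma filt_map_shift: "filt_map (shift g)"
proof -
  have "shift g (F + G) = shift g F + shift g G" for F G
    unfolding shift_def
    by (subst fsum_add[symmetric])
       (auto intro: shift_term_in_fl simp: algebra_simps simp flip: fps_const_add)
  moreover have "shift g F \<in> fl n" if "F \<in> fl n" for F n
    unfolding shift_def
  proof (rule fsum_in_fl[OF shift_term_in_fl])
    fix k
    have "fps_const (fps_nth F k) * (fps_X + fps_const g) ^ k \<in> fl (n - k + k)"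
      using fl_fpsD[OF that, of k] by (intro fl_mult shift_power_in_fl) simp
    then show "fps_const (fps_nth F k) * (fps_X + fps_const g) ^ k \<in> fl n"
      by (rule fl_antimono[rotated]) simp
  qed
  ultimately show ?thesis by (simp add: filt_map_def)
qed

lemma shift_monom: "shift g (fps_const a * fps_X ^ n) = fps_const a * (fps_X + fps_const g) ^ n"
  unfolding shift_def
proof (rule fsum_unique)
  fix N
  have "fps_const (fps_nth (fps_const a * fps_X ^ n) k) * (fps_X + fps_const g) ^ k =
      (if n = k then fps_const a * (fps_X + fps_const g) ^ n else 0)" for k
    by (auto simp: fps_X_power_iff)
  then have "(\<Sum>k<N. fps_const (fps_nth (fps_const a * fps_X ^ n) k) * (fps_X + fps_const g) ^ k) =
      (\<Sum>k<N. if n = k then fps_const a * (fps_X + fps_const g) ^ n else 0)"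
    by (rule sum.cong[OF refl])
  also have "\<dots> = (if n < N then fps_const a * (fps_X + fps_const g) ^ n else 0)"
    by (simp only: sum.delta sum.delta' finite_lessThan lessThan_iff)
  finally have *: "(\<Sum>k<N. fps_const (fps_nth (fps_const a * fps_X ^ n) k) * (fps_X + fps_const g) ^ k) =
    (if n < N then fps_const a * (fps_X + fps_const g) ^ n else 0)" .
  show "fps_const a * (fps_X + fps_const g) ^ n -
       (\<Sum>k<N. fps_const (fps_nth (fps_const a * fps_X ^ n) k) * (fps_X + fps_const g) ^ k) \<in> fl N"
  proof (cases "n < N")
    case True then show ?thesis unfolding * by (simp only: if_True diff_self fl_zero)
  next
    case False then show ?thesis unfolding * if_not_P[OF False] diff_0_right
      by (intro fl_antimono[OF _ shift_term_in_fl]) simp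
  qed
qed (rule shift_term_in_fl)

lemma shift_const [simp]: "shift g (fps_const a) = fps_const a"
  using shift_monom[of a 0] by simp

lemma shift_X: "shift g fps_X = fps_X + fps_const g"
  using shift_monom[of 1 1] by simp

lemma filt_hom_shift: "filt_hom (shift g)"
proof (rule filt_hom_fpsI[OF filt_map_shift])
  fix a b :: 'a and m n
  have *: "fps_const a * P ^ m * (fps_const b * P ^ n) = fps_const (a * b) * P ^ (m + n)" for P :: "'a fps"
    by (simp only: power_add fps_const_mult[symmetric] mult_ac)
  show "shift g (fps_const a * fps_X ^ m * (fps_const b * fps_X ^ n)) =
       shift g (fps_const a * fps_X ^ m) * shift g (fps_const b * fps_X ^ n)"
    unfolding * shift_monom ..
qed (use shift_const[of 1] in simp)

end

lemma shift_shift: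
  assumes "a \<in> fl (Suc 0)" "b \<in> fl (Suc 0)"
  shows "shift a (shift b F) = shift (a + b) F"
proof -
  note h = filt_hom_shift[OF assms(1)] filt_hom_shift[OF assms(2)] filt_hom_shift[OF fl_add[OF assms]]
  have "shift a (shift b (fps_const c * fps_X ^ n)) = shift (a + b) (fps_const c * fps_X ^ n)" for c n
    unfolding shift_monom[OF assms(2)] shift_monom[OF fl_add[OF assms]] filt_homD(8,10,2)[OF h(1)]
      shift_X[OF assms(1)] shift_const[OF assms(1)] fps_const_add[symmetric] add.assoc ..
  then show ?thesis
    by (rule filt_map_fps_eqI[OF filt_map_comp[OF filt_homD(1)[OF h(1)] filt_homD(1)[OF h(2)]]
          filt_homD(1)[OF h(3)]])
qed

lemma shift_0 [simp]: "shift 0 F = F"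
  by (rule filt_map_fps_eqI[OF filt_map_shift filt_map_ident]) (auto simp: shift_monom)

lemma shift_inverse [simp]: "a \<in> fl (Suc 0) \<Longrightarrow> shift (- a) (shift a F) = F"
  "a \<in> fl (Suc 0) \<Longrightarrow> shift a (shift (- a) F) = F"
  by (simp_all add: shift_shift fl_uminus)

lemma fmap_shift:
  assumes T: "filt_hom T" and g: "g \<in> fl (Suc 0)"
  shows "fmap T (shift g F) = shift (T g) (fmap T F)"
proof -
  have Tg: "T g \<in> fl (Suc 0)" using filt_homD(3)[OF T g] .
  note h = filt_hom_fmap[OF T]
  have "fmap T (shift g (fps_const c * fps_X ^ n)) = shift (T g) (fmap T (fps_const c * fps_X ^ n))" for c n
    unfolding shift_monom[OF g] shift_monom[OF Tg] filt_homD(8,10,2)[OF h] fmap_X[OF T]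
      fmap_const[OF filt_homD(1)[OF T]] ..
  then show ?thesis
    by (rule filt_map_fps_eqI[OF filt_map_comp[OF filt_homD(1)[OF h] filt_map_shift[OF g]]
          filt_map_comp[OF filt_map_shift[OF Tg] filt_homD(1)[OF h]]])
qed

lemma fps_nth_linear_power:
  "fps_nth ((fps_X + fps_const g) ^ j) i = of_nat (j choose i) * (g :: 'a::comm_ring_1) ^ (j - i)"
proof -
  have *: "(fps_X + fps_const g) ^ j = (\<Sum>k\<le>j. fps_const (of_nat (j choose k) * g ^ (j - k)) * fps_X ^ k)"
    unfolding binomial_ring fps_const_mult[symmetric] fps_const_power[symmetric] fps_of_nat
    by (simp only: mult_ac)
  have "fps_nth (fps_const (of_nat (j choose k) * g ^ (j - k)) * fps_X ^ k) i =
      (if i = k then of_nat (j choose k) * g ^ (j - k) else 0)" for k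
    by (simp add: fps_X_power_iff)
  then show ?thesis
    unfolding * fps_sum_nth by (simp only: sum.delta' finite_atMost atMost_iff) (simp add: binomial_eq_0)
qed

text \<open>A finite Taylor expansion with remainder: modulo a power of $g$ only finitely many terms of
  $\sum_j \binom j i f_j g^{j-i}$ matter. It is used in place of the infinite sum.\<close>

lemma shift_Taylor:
  assumes g: "g \<in> fl (Suc 0)" and i: "i \<le> c"
  shows "\<exists>S. fps_nth (shift g F) i =
    (\<Sum>j\<le>c. of_nat (j choose i) * fps_nth F j * g ^ (j - i)) + g ^ (Suc c - i) * S"
proof -
  note h = filt_hom_shift[OF g]
  obtain H where H: "F = (\<Sum>j\<le>c. fps_const (fps_nth F j) * fps_X ^ j) + fps_X ^ Suc c * H"
  proof
    show "F = (\<Sum>j\<le>c. fps_const (fps_nth F j) * fps_X ^ j) + fps_X ^ Suc c * fps_shift (Suc c) F"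
    proof (rule fps_ext)
      fix n
      have "fps_nth (fps_const (fps_nth F j) * fps_X ^ j) n = (if n = j then fps_nth F j else 0)" for j
        by (simp add: fps_X_power_iff)
      then have "fps_nth (\<Sum>j\<le>c. fps_const (fps_nth F j) * fps_X ^ j) n = (if n \<le> c then fps_nth F n else 0)"
        by (simp only: fps_sum_nth sum.delta' finite_atMost atMost_iff)
      then show "fps_nth F n = fps_nth ((\<Sum>j\<le>c. fps_const (fps_nth F j) * fps_X ^ j) +
          fps_X ^ Suc c * fps_shift (Suc c) F) n"
        by (simp add: fps_X_power_mult_nth del: power_Suc)
    qed
  qed
  have "shift g F = (\<Sum>j\<le>c. fps_const (fps_nth F j) * (fps_X + fps_const g) ^ j) +
      (fps_X + fps_const g) ^ Suc c * shift g H"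
    by (subst H) (simp only: filt_homD(2,7,8,10)[OF h] shift_X[OF g] shift_const[OF g])
  then have eq: "fps_nth (shift g F) i = (\<Sum>j\<le>c. of_nat (j choose i) * fps_nth F j * g ^ (j - i)) +
      fps_nth ((fps_X + fps_const g) ^ Suc c * shift g H) i" for i
    by (simp only: fps_add_nth fps_sum_nth fps_mult_left_const_nth fps_nth_linear_power mult_ac)
  have "g ^ (Suc c - i) dvd fps_nth ((fps_X + fps_const g) ^ Suc c * shift g H) i"
    unfolding fps_mult_nth fps_nth_linear_power
    by (intro dvd_sum dvd_mult2 dvd_mult le_imp_power_dvd) auto
  then show ?thesis unfolding eq dvd_def by auto
qed

lemma shift_Taylor_mod:
  assumes g: "g \<in> fl (Suc 0)"
  shows "fps_nth (shift g F) i - (\<Sum>j<L. of_nat (j choose i) * fps_nth F j * g ^ (j - i)) \<in> fl (L - i)"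
proof (cases "i < L")
  case True
  then obtain c where L: "L = Suc c" and i: "i \<le> c" by (cases L) auto
  obtain S where "fps_nth (shift g F) i =
    (\<Sum>j\<le>c. of_nat (j choose i) * fps_nth F j * g ^ (j - i)) + g ^ (Suc c - i) * S"
    using shift_Taylor[OF g i] by blast
  then show ?thesis
    using fl_multr[OF fl_power[OF g, of "Suc c - i"], of S] by (simp add: L lessThan_Suc_atMost)
qed simp

text \<open>The Hasse derivative of order $i$. In positive characteristic it is not a multiple of the iterated
  derivative.\<close>

definition hasse :: "nat \<Rightarrow> 'a::filt_ring fps \<Rightarrow> 'a fps" where
  "hasse i F = Abs_fps (\<lambda>n. of_nat ((n + i) choose i) * fps_nth F (n + i))"

lemma hasse_nth [simp]: "fps_nth (hasse i F) n = of_nat ((n + i) choose i) * fps_nth F (n + i)"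
  by (simp add: hasse_def)

text \<open>Taylor coefficients of a Hasse derivative are multiples of Taylor coefficients of the series, by
  $\binom j v \binom{j+i} i = \binom{v+i} i \binom{j+i}{v+i}$.\<close>

lemma shift_hasse:
  assumes g: "g \<in> fl (Suc 0)"
  shows "fps_nth (shift g (hasse i F)) v = of_nat ((v + i) choose i) * fps_nth (shift g F) (v + i)"
proof (rule fl_eqI)
  fix N
  let ?A = "\<Sum>j<N + v. of_nat (j choose v) * fps_nth (hasse i F) j * g ^ (j - v)"
  let ?B = "\<Sum>j<N + (v + i). of_nat (j choose (v + i)) * fps_nth F j * g ^ (j - (v + i))"
  have bin: "(j choose v) * ((j + i) choose i) = ((v + i) choose i) * ((j + i) choose (v + i))" for j
  proof (cases "v \<le> j")
    case True
    have "((j + i) choose (v + i)) * ((v + i) choose i) = ((j + i) choose i) * ((j + i - i) choose (v + i - i))"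
      by (rule choose_mult) (use True in auto)
    then show ?thesis by (simp add: ac_simps)
  qed (simp add: binomial_eq_0)
  have "{..<N + (v + i)} = {..<i} \<union> (\<lambda>j. j + i) ` {..<N + v}"
  proof -
    have "x \<in> (\<lambda>j. j + i) ` {..<N + v}" if "x < N + (v + i)" "\<not> x < i" for x
      by (rule image_eqI[of _ _ "x - i"]) (use that in auto)
    then show ?thesis by auto
  qed
  then have "?B = (\<Sum>j\<in>{..<i} \<union> (\<lambda>j. j + i) ` {..<N + v}. of_nat (j choose (v + i)) * fps_nth F j * g ^ (j - (v + i)))"
    by simp
  also have "\<dots> = (\<Sum>j\<in>(\<lambda>j. j + i) ` {..<N + v}. of_nat (j choose (v + i)) * fps_nth F j * g ^ (j - (v + i)))"
    by (rule sum.mono_neutral_right) (auto simp: binomial_eq_0)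
  also have "\<dots> = (\<Sum>j<N + v. of_nat ((j + i) choose (v + i)) * fps_nth F (j + i) * g ^ (j - v))"
    by (subst sum.reindex) (auto simp: inj_on_def)
  finally have B: "?B = (\<Sum>j<N + v. of_nat ((j + i) choose (v + i)) * fps_nth F (j + i) * g ^ (j - v))" .
  have bin': "of_nat (j choose v) * of_nat ((j + i) choose i) =
      (of_nat ((v + i) choose i) * of_nat ((j + i) choose (v + i)) :: 'a)" for j
    unfolding of_nat_mult[symmetric] bin ..
  have AB: "?A = of_nat ((v + i) choose i) * ?B"
    unfolding B sum_distrib_left by (simp only: hasse_nth mult.assoc[symmetric] bin')
  have "fps_nth (shift g (hasse i F)) v - ?A \<in> fl N"
    using shift_Taylor_mod[OF g, of "hasse i F" v "N + v"] by simp
  moreover have "of_nat ((v + i) choose i) * fps_nth (shift g F) (v + i) - ?A \<in> fl N"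
    using fl_multl[OF shift_Taylor_mod[OF g, of F "v + i" "N + (v + i)"], of "of_nat ((v + i) choose i)"]
    unfolding AB by (simp add: right_diff_distrib)
  ultimately show "fps_nth (shift g (hasse i F)) v -
      of_nat ((v + i) choose i) * fps_nth (shift g F) (v + i) \<in> fl N"
    using fl_trans[OF _ iffD1[OF fl_commute]] by blast
qed

lemma filt_hom_eval: "g \<in> fl (Suc 0) \<Longrightarrow> filt_hom (\<lambda>F. fps_nth (shift g F) 0)"
  using filt_hom_shift[of g] fl_fpsD[of _ _ 0]
  unfolding filt_hom_def filt_map_def by fastforce

lemma eval_cong:
  assumes "a \<in> fl (Suc 0)" "b \<in> fl (Suc 0)" "a - b \<in> fl n"
  shows "fps_nth (shift a F) i - fps_nth (shift b F) i \<in> fl n"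
proof -
  have ab: "a - b \<in> fl (Suc 0)" using assms by (simp add: fl_diff)
  obtain S where "fps_nth (shift (a - b) (shift b F)) i = (\<Sum>j\<le>i. of_nat (j choose i) *
      fps_nth (shift b F) j * (a - b) ^ (j - i)) + (a - b) ^ (Suc i - i) * S"
    using shift_Taylor[OF ab order_refl[of i]] by blast
  moreover have "(\<Sum>j\<le>i. of_nat (j choose i) * fps_nth (shift b F) j * (a - b) ^ (j - i)) =
      (\<Sum>j\<in>{i}. of_nat (j choose i) * fps_nth (shift b F) j * (a - b) ^ (j - i))"
    by (rule sum.mono_neutral_right) (auto simp: binomial_eq_0)
  ultimately have "fps_nth (shift a F) i - fps_nth (shift b F) i = (a - b) * S"
    using shift_shift[OF ab assms(2)] by simp
  then show ?thesis using fl_multr[OF assms(3)] by simp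
qed

lemma fps_linear_division:
  assumes g: "g \<in> fl (Suc 0)"
  shows "\<exists>H. F = fps_const (fps_nth (shift g F) 0) + (fps_X - fps_const g) * H"
proof -
  note h = filt_hom_shift[OF fl_uminus[OF g]]
  let ?H = "fps_shift 1 (shift g F)"
  have "shift g F = fps_const (fps_nth (shift g F) 0) + fps_X * ?H"
    by (rule fps_ext) (auto simp: fps_X_mult_nth)
  then have "shift (- g) (shift g F) = shift (- g) (fps_const (fps_nth (shift g F) 0) + fps_X * ?H)" by simp
  then have "F = fps_const (fps_nth (shift g F) 0) + (fps_X + fps_const (- g)) * shift (- g) ?H"
    unfolding shift_inverse(1)[OF g] filt_homD(2,8)[OF h] shift_const[OF fl_uminus[OF g]] shift_X[OF fl_uminus[OF g]] .
  then show ?thesis by (auto simp flip: fps_const_neg)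
qed

text \<open>The difference quotient of a series that is regular of order one is a unit. This gives both the
  convergence of the Newton iteration and the stability of roots.\<close>

lemma eval_increment:
  fixes q :: "'a::filt_ring fps"
  assumes q: "fps_nth q 1 dvd 1" and a: "a \<in> fl (Suc 0)" "b \<in> fl (Suc 0)"
  shows "\<exists>u. u dvd 1 \<and> u - fps_nth q 1 \<in> fl (Suc 0) \<and>
    fps_nth (shift b q) 0 = fps_nth (shift a q) 0 + (b - a) * u"
proof -
  have ba: "b - a \<in> fl (Suc 0)" using a by (simp add: fl_diff)
  obtain S where S: "fps_nth (shift (b - a) (shift a q)) 0 =
     (\<Sum>j\<le>1. of_nat (j choose 0) * fps_nth (shift a q) j * (b - a) ^ (j - 0)) + (b - a) ^ (Suc 1 - 0) * S"
    using shift_Taylor[OF ba, of 0 1] by blast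
  have "fps_nth (shift a q) 1 - fps_nth (shift 0 q) 1 \<in> fl (Suc 0)"
    by (rule eval_cong) (use a in auto)
  then have s: "fps_nth (shift a q) 1 - fps_nth q 1 \<in> fl (Suc 0)" by simp
  define u where "u = fps_nth (shift a q) 1 + (b - a) * S"
  have u: "u - fps_nth q 1 \<in> fl (Suc 0)"
    using fl_add[OF s fl_multr[OF ba, of S]] by (simp add: u_def algebra_simps)
  then have "u dvd 1" using dvd_one_add_fl[OF q, of "u - fps_nth q 1"] by simp
  moreover have "fps_nth (shift b q) 0 = fps_nth (shift a q) 0 + (b - a) * u"
  proof -
    have sum: "(\<Sum>j\<le>1. f j) = f 0 + f 1" for f :: "nat \<Rightarrow> 'a" by simp
    have ba': "b - a + a = b" by simp
    have choose: "of_nat (0 choose 0) = (1 :: 'a)" "of_nat (1 choose 0) = (1 :: 'a)" by simp_all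
    show ?thesis using S
      unfolding shift_shift[OF ba a(1)] sum u_def ba' choose diff_zero power_Suc power_one_right
        power_0 mult_1_left mult_1_right distrib_left add.assoc
      by (simp only: mult_ac One_nat_def)
  qed
  ultimately show ?thesis using u by blast
qed

lemma approximate_root:
  assumes "fps_nth q 1 dvd 1" "a \<in> fl (Suc 0)" "b \<in> fl (Suc 0)"
    and "fps_nth (shift a q) 0 \<in> fl n" "fps_nth (shift b q) 0 \<in> fl n"
  shows "b - a \<in> fl n"
proof -
  obtain u where u: "u dvd 1" "fps_nth (shift b q) 0 = fps_nth (shift a q) 0 + (b - a) * u"
    using eval_increment[OF assms(1-3)] by auto
  obtain v where v: "1 = u * v" using u(1) by (rule dvdE)
  have "(b - a) * u * v = b - a" using v by (simp add: mult.assoc)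
  moreover have "(b - a) * u \<in> fl n" using u(2) fl_diff[OF assms(5,4)] by simp
  ultimately show ?thesis using fl_multr[of "(b - a) * u" n v] by simp
qed

text \<open>Newton iteration with a fixed slope.\<close>

lemma implicit_function:
  fixes q :: "'a::filt_ring fps"
  assumes q1: "fps_nth q 1 dvd 1" and q0: "fps_nth q 0 \<in> fl (Suc 0)"
  shows "\<exists>a \<in> fl (Suc 0). fps_nth (shift a q) 0 = 0"
proof -
  obtain v where v: "1 = fps_nth q 1 * v" using q1 by (rule dvdE)
  define a where "a = rec_nat 0 (\<lambda>_ x. x - fps_nth (shift x q) 0 * v)"
  have aS: "a (Suc n) = a n - fps_nth (shift (a n) q) 0 * v" for n by (simp add: a_def)
  have inv: "a n \<in> fl (Suc 0) \<and> fps_nth (shift (a n) q) 0 \<in> fl (Suc n)" for n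
  proof (induction n)
    case 0 then show ?case using q0 by (simp add: a_def)
  next
    case (Suc n)
    let ?x = "fps_nth (shift (a n) q) 0"
    have x: "?x \<in> fl (Suc n)" "a n \<in> fl (Suc 0)" using Suc by auto
    have x1: "?x \<in> fl (Suc 0)" using x(1) by (rule fl_antimono[rotated]) simp
    have *: "a (Suc n) \<in> fl (Suc 0)" unfolding aS by (intro fl_diff fl_multr x x1)
    obtain u where u: "u - fps_nth q 1 \<in> fl (Suc 0)"
      "fps_nth (shift (a (Suc n)) q) 0 = ?x + (a (Suc n) - a n) * u"
      using eval_increment[OF q1 x(2) *] by blast
    have alg: "y + (b - y * w - b) * u' = - (y * ((u' - c) * w))" if "1 = c * w" for y b w u' c :: 'a
    proof -
      have "- (y * ((u' - c) * w)) = y * (c * w) - y * u' * w"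
        by (simp only: left_diff_distrib right_diff_distrib minus_diff_eq mult.assoc)
      also have "\<dots> = y + (b - y * w - b) * u'"
        unfolding that[symmetric] by (simp add: left_diff_distrib mult_ac)
      finally show ?thesis ..
    qed
    have "fps_nth (shift (a (Suc n)) q) 0 = - (?x * ((u - fps_nth q 1) * v))"
      unfolding u(2) unfolding aS by (rule alg[OF v])
    also have "\<dots> \<in> fl (Suc n + Suc 0)" by (intro fl_uminus fl_mult x fl_multr u)
    finally show ?case using * by simp
  qed
  have "a (Suc n) - a n \<in> fl n" for n
  proof -
    have "fps_nth (shift (a n) q) 0 * v \<in> fl n"
      using inv[of n] by (intro fl_multr) (blast intro: fl_antimono[of n "Suc n"] le_SucI)
    then show ?thesis by (simp add: aS fl_uminus)
  qed
  then obtain s where s: "s - a n \<in> fl n" for n using Cauchy_limit by blast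
  have s1: "s \<in> fl (Suc 0)" using s[of 1] fl_cong inv[of 1] by auto
  have "fps_nth (shift s q) 0 \<in> fl n" for n
    using fl_cong[OF eval_cong[OF s1 _ s[of n], of q 0]] inv[of n]
      fl_antimono[of n "Suc n" "fps_nth (shift (a n) q) 0"] by simp
  then show ?thesis using s1 fl_separated by blast
qed

section \<open>Power series in several variables as a complete filtered ring\<close>

definition wdot :: "nat ^ 'n \<Rightarrow> nat ^ 'n \<Rightarrow> nat" where
  "wdot w e = (\<Sum>i\<in>UNIV. w $ i * e $ i)"

lemma wdot_add: "wdot w (a + b) = wdot w a + wdot w b"
  by (simp add: wdot_def algebra_simps sum.distrib)

lemma wdot_0 [simp]: "wdot w 0 = 0" "wdot 0 e = 0"
  by (simp_all add: wdot_def)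

lemma mps_coeff_zero [simp]: "mps_coeff 0 e = 0" by transfer simp
lemma mps_coeff_one: "mps_coeff 1 e = (if e = 0 then 1 else 0)" by transfer simp
lemma mps_coeff_add [simp]: "mps_coeff (f + g) e = mps_coeff f e + mps_coeff g e" by transfer simp
lemma mps_coeff_diff [simp]: "mps_coeff (f - g) e = mps_coeff f e - mps_coeff g e" by transfer simp
lemma mps_coeff_uminus [simp]: "mps_coeff (- f) e = - mps_coeff f e" by transfer simp

lemma mps_coeff_sum: "mps_coeff (sum f X) e = (\<Sum>x\<in>X. mps_coeff (f x) e)"
  by (induction X rule: infinite_finite_induct) auto

lemma mps_coeff_mult: "mps_coeff (f * g) e = (\<Sum>(a, b) | a + b = e. mps_coeff f a * mps_coeff g b)"
  by transfer simp

lemma mps_mult_support: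
  assumes "mps_coeff (f * g) e \<noteq> 0"
  shows "\<exists>a b. e = a + b \<and> mps_coeff f a \<noteq> 0 \<and> mps_coeff g b \<noteq> 0"
proof -
  from assms obtain p where "p \<in> {(a, b). a + b = e}" "(case p of (a, b) \<Rightarrow> mps_coeff f a * mps_coeff g b) \<noteq> 0"
    unfolding mps_coeff_mult by (blast elim: sum.not_neutral_contains_not_neutral)
  then have "e = fst p + snd p" "mps_coeff f (fst p) \<noteq> 0" "mps_coeff g (snd p) \<noteq> 0" by auto
  then show ?thesis by blast
qed

lemma finite_exponents: "finite {e :: nat ^ 'n::finite. wdot 1 e < N}"
proof (rule finite_subset)
  show "finite (fst ` {(a, b). a + b = ((\<chi> i. N) :: nat ^ 'n)})"
    by (intro finite_imageI finite_exponent_splits)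
  show "{e :: nat ^ 'n. wdot 1 e < N} \<subseteq> fst ` {(a, b). a + b = (\<chi> i. N)}"
  proof
    fix e :: "nat ^ 'n" assume "e \<in> {e. wdot 1 e < N}"
    then have "e $ i \<le> N" for i
      using member_le_sum[of i UNIV "\<lambda>i. e $ i"] by (simp add: wdot_def)
    then have "(e, \<chi> i. N - e $ i) \<in> {(a, b). a + b = (\<chi> i. N)}" by (simp add: vec_eq_iff)
    then show "e \<in> fst ` {(a, b). a + b = (\<chi> i. N)}" by (rule rev_image_eqI) simp
  qed
qed

instantiation mps :: (comm_ring_1, finite) filt_ring
begin

definition fl_mps :: "nat \<Rightarrow> ('a, 'b) mps set" where
  "fl_mps n = {f. \<forall>e. mps_coeff f e \<noteq> 0 \<longrightarrow> n \<le> wdot 1 e}"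

instance
proof
  fix m n :: nat and a b :: "('a, 'b) mps" and f :: "nat \<Rightarrow> ('a, 'b) mps"
  show "(fl 0 :: ('a, 'b) mps set) = UNIV" by (simp add: fl_mps_def)
  show "(0 :: ('a, 'b) mps) \<in> fl n" by (simp add: fl_mps_def)
  show "a \<in> fl n \<Longrightarrow> b \<in> fl n \<Longrightarrow> a + b \<in> fl n"
    by (auto simp: fl_mps_def) (metis add.right_neutral)
  show "a \<in> fl m \<Longrightarrow> b \<in> fl n \<Longrightarrow> a * b \<in> fl (m + n)"
    by (auto simp: fl_mps_def wdot_add intro!: add_mono dest!: mps_mult_support)
  show "(fl (Suc n) :: ('a, 'b) mps set) \<subseteq> fl n" by (auto simp: fl_mps_def)
  show "a = 0" if "\<And>n. a \<in> fl n"
  proof (rule mps_eqI)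
    fix e show "mps_coeff a e = mps_coeff 0 e"
      using that[of "Suc (wdot 1 e)"] by (auto simp: fl_mps_def)
  qed
  show "\<exists>s. \<forall>N. s - (\<Sum>n<N. f n) \<in> fl N" if f: "\<And>n. f n \<in> fl n"
  proof (intro exI allI)
    fix N
    let ?s = "Abs_mps (\<lambda>e. \<Sum>n<Suc (wdot 1 e). mps_coeff (f n) e)"
    have "mps_coeff (?s - (\<Sum>n<N. f n)) e = 0" if e: "wdot 1 e < N" for e
    proof -
      have "(\<Sum>n<N. mps_coeff (f n) e) = (\<Sum>n<Suc (wdot 1 e). mps_coeff (f n) e)"
      proof (rule sum.mono_neutral_right)
        show "\<forall>n\<in>{..<N} - {..<Suc (wdot 1 e)}. mps_coeff (f n) e = 0"
          using f by (force simp: fl_mps_def)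
      qed (use e in auto)
      then show ?thesis by (simp add: Abs_mps_inverse mps_coeff_sum del: sum.lessThan_Suc)
    qed
    then show "?s - (\<Sum>n<N. f n) \<in> fl N" unfolding fl_mps_def by (auto simp: not_less[symmetric])
  qed
qed

end

lemma fl_mps_iff: "f \<in> fl n \<longleftrightarrow> (\<forall>e. mps_coeff f e \<noteq> 0 \<longrightarrow> n \<le> wdot 1 e)"
  by (simp add: fl_mps_def)

subsection \<open>Monomials\<close>

definition mterm :: "'k::comm_ring_1 \<Rightarrow> nat ^ 'n \<Rightarrow> ('k, 'n::finite) mps" where
  "mterm k a = Abs_mps (\<lambda>e. if e = a then k else 0)"

lemma mps_coeff_mterm: "mps_coeff (mterm k a) e = (if e = a then k else 0)"
  by (simp add: mterm_def Abs_mps_inverse)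

lemma mps_monom_eq_mterm: "mps_monom r = mterm 1 r"
  by (rule mps_eqI) (simp add: mps_coeff_mterm mps_monom.rep_eq)

lemma mterm_0 [simp]: "mterm 0 a = 0" by (rule mps_eqI) (simp add: mps_coeff_mterm)

lemma mterm_1: "mterm 1 0 = 1" by (rule mps_eqI) (simp add: mps_coeff_mterm mps_coeff_one)

lemma mterm_add: "mterm (k + l) a = mterm k a + mterm l a"
  by (rule mps_eqI) (simp add: mps_coeff_mterm)

lemma mterm_in_fl: "n \<le> wdot 1 a \<Longrightarrow> mterm k a \<in> fl n"
  by (simp add: fl_mps_iff mps_coeff_mterm)

lemma mps_coeff_mterm_mult_add: "mps_coeff (mterm k a * f) (a + e) = k * mps_coeff f e"
proof -
  have "mps_coeff (mterm k a * f) (a + e) =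
      (\<Sum>p | fst p + snd p = a + e. mps_coeff (mterm k a) (fst p) * mps_coeff f (snd p))"
    by (simp add: mps_coeff_mult case_prod_unfold)
  also have "\<dots> = (\<Sum>p\<in>{(a, e)}. mps_coeff (mterm k a) (fst p) * mps_coeff f (snd p))"
  proof (rule sum.mono_neutral_right)
    show "finite {p. fst p + snd p = a + e}"
      using finite_exponent_splits[of "a + e"] by (simp add: case_prod_unfold)
  qed (auto simp: mps_coeff_mterm)
  finally show ?thesis by (simp add: mps_coeff_mterm)
qed

lemma mps_coeff_mterm_mult_eq_0: "(\<And>b. e \<noteq> a + b) \<Longrightarrow> mps_coeff (mterm k a * f) e = 0"
  using mps_mult_support[of "mterm k a" f e] by (auto simp: mps_coeff_mterm split: if_splits) metis

lemma mterm_mult: "mterm k a * mterm l b = mterm (k * l) (a + b)"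
proof (rule mps_eqI)
  fix e show "mps_coeff (mterm k a * mterm l b) e = mps_coeff (mterm (k * l) (a + b)) e"
  proof (cases "\<exists>c. e = a + c")
    case True then show ?thesis by (auto simp: mps_coeff_mterm_mult_add mps_coeff_mterm)
  next
    case False then show ?thesis by (auto simp: mps_coeff_mterm_mult_eq_0 mps_coeff_mterm)
  qed
qed

lemma mterm_power: "mterm k a ^ n = mterm (k ^ n) (of_nat n * a)"
  by (induction n) (simp_all add: mterm_1 mterm_mult algebra_simps)

lemma exponent_diff: "(\<forall>i. a $ i \<le> e $ i) \<longleftrightarrow> (\<exists>b. e = a + (b :: nat ^ 'n))"
proof
  assume "\<forall>i. a $ i \<le> e $ i"
  then have "e = a + (\<chi> i. e $ i - a $ i)" by (simp add: vec_eq_iff)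
  then show "\<exists>b. e = a + b" ..
qed auto

lemma mps_truncate_in_fl: "f - (\<Sum>e | wdot 1 e < N. mterm (mps_coeff f e) e) \<in> fl N"
proof -
  have "mps_coeff (\<Sum>a | wdot 1 a < N. mterm (mps_coeff f a) a) e = mps_coeff f e" if "wdot 1 e < N" for e
    using that by (simp add: mps_coeff_sum mps_coeff_mterm finite_exponents)
  then show ?thesis unfolding fl_mps_iff by (auto simp: not_less[symmetric])
qed

lemma filt_map_mps_eqI:
  assumes S: "filt_map S" and T: "filt_map T" and eq: "\<And>k a. S (mterm k a) = T (mterm k a)"
  shows "S f = T f"
proof (rule fl_eqI)
  fix N
  let ?P = "\<Sum>e | wdot 1 e < N. mterm (mps_coeff f e) e"
  have "S ?P = T ?P" by (simp add: filt_mapD(6)[OF S] filt_mapD(6)[OF T] eq)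
  then have "S f - T f = S (f - ?P) - T (f - ?P)"
    by (simp add: filt_mapD(4)[OF S] filt_mapD(4)[OF T])
  then show "S f - T f \<in> fl N"
    by (simp only: fl_diff mps_truncate_in_fl filt_mapD(2)[OF S] filt_mapD(2)[OF T])
qed

lemma filt_hom_mpsI:
  assumes T: "filt_map T"
    and eq: "\<And>k a l b. T (mterm k a * mterm l b) = T (mterm k a) * T (mterm l b)"
    and 1: "T 1 = 1"
  shows "filt_hom T"
proof -
  have *: "T (f * mterm l b) = T f * T (mterm l b)" for f l b
    by (rule filt_map_mps_eqI[OF filt_map_comp[OF T filt_map_mult(1)[OF filt_map_ident]]
          filt_map_mult(1)[OF T] eq])
  have "T (f * g) = T f * T g" for f g
    by (rule filt_map_mps_eqI[OF filt_map_comp[OF T filt_map_mult(2)[OF filt_map_ident]]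
          filt_map_mult(2)[OF T] *])
  then show ?thesis using T 1 by (simp add: filt_hom_def)
qed

subsection \<open>The filtration is the one by powers of the maximal ideal\<close>

lemma mps_unit_iff: "(f :: ('k::field, 'n::finite) mps) dvd 1 \<longleftrightarrow> mps_coeff f 0 \<noteq> 0"
proof
  assume "f dvd 1"
  then obtain g where "1 = f * g" by (rule dvdE)
  then have "mps_coeff (f * g) 0 \<noteq> 0" by (metis mps_coeff_one zero_neq_one)
  then obtain a b where "0 = a + b" "mps_coeff f a \<noteq> 0" using mps_mult_support by blast
  then have "a = 0" by (auto simp: vec_eq_iff)
  then show "mps_coeff f 0 \<noteq> 0" using \<open>mps_coeff f a \<noteq> 0\<close> by simp
next
  assume f: "mps_coeff f 0 \<noteq> 0"
  have "mterm (mps_coeff f 0) 0 * mterm (1 / mps_coeff f 0) 0 = (1 :: ('k, 'n) mps)"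
    using f by (simp add: mterm_mult mterm_1)
  then have u: "mterm (mps_coeff f 0) 0 dvd (1 :: ('k, 'n) mps)" by (rule dvdI[OF sym])
  have "f - mterm (mps_coeff f 0) 0 \<in> fl 1"
  proof -
    have "wdot 1 e \<noteq> 0" if "e \<noteq> 0" for e :: "nat ^ 'n" using that by (auto simp: wdot_def vec_eq_iff)
    then show ?thesis by (auto simp: fl_mps_iff mps_coeff_mterm Suc_le_eq split: if_splits)
  qed
  then show "f dvd 1" using dvd_one_add_fl[OF u] by force
qed

lemma fl_mps_1_iff: "(f :: ('k::comm_ring_1, 'n::finite) mps) \<in> fl (Suc 0) \<longleftrightarrow> mps_coeff f 0 = 0"
proof -
  have "wdot 1 e \<noteq> 0" if "e \<noteq> 0" for e :: "nat ^ 'n" using that by (auto simp: wdot_def vec_eq_iff)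
  then show ?thesis by (auto simp: fl_mps_iff Suc_le_eq) (metis wdot_0(1) less_irrefl)
qed


lemma is_ideal_fl: "is_ideal (fl n)"
  by (rule ideal.subspaceI) (auto intro: fl_add fl_multl)

text \<open>The order of an ideal is defined by powers of the set of non-units. To compare these with the
  filtration, it is enough to divide one factor of order one off each element.\<close>

lemma ideal_power_eq_flI:
  fixes n :: nat
  assumes 1: "max_ideal = (fl 1 :: 'a::filt_ring set)"
    and gen: "\<And>n. fl (Suc n) \<subseteq> ideal_mult (fl 1) (fl n :: 'a set)"
  shows "ideal_power max_ideal n = (fl n :: 'a set)"
proof (induction n)
  case (Suc n)
  have "ideal_mult (fl 1) (fl n) \<subseteq> (fl (Suc n) :: 'a set)"
    unfolding ideal_mult_def
    by (rule ideal.span_minimal[OF _ is_ideal_fl]) (use fl_mult[of _ 1 _ n] in auto)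
  then show ?case using gen[of n] Suc by (auto simp: 1)
qed simp

text \<open>Every exponent $e \ne 0$ is assigned to one variable $x_i$ that divides $x^e$. Collecting the
  monomials assigned to $x_i$ writes a series without constant term as $\sum_i x_i h_i$.\<close>

lemma max_ideal_power_mps: "ideal_power max_ideal n = (fl n :: ('a::field, 'b::finite) mps set)"
proof (rule ideal_power_eq_flI)
    show "max_ideal = (fl 1 :: ('a, 'b) mps set)"
      by (auto simp: max_ideal_def mps_unit_iff fl_mps_1_iff)
    fix n
    show "fl (Suc n) \<subseteq> ideal_mult (fl 1) (fl n :: ('a, 'b) mps set)"
    proof
      fix f :: "('a, 'b) mps" assume f: "f \<in> fl (Suc n)"
      define v where "v e = (SOME i. e $ i \<noteq> 0)" for e :: "nat ^ 'b"
      have v: "e $ (v e) \<noteq> 0" if "mps_coeff f e \<noteq> 0" for e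
      proof -
        have "wdot 1 e \<noteq> 0" using f that by (auto simp: fl_mps_iff)
        then show ?thesis unfolding v_def by (intro someI_ex[of "\<lambda>i. e $ i \<noteq> 0"]) (auto simp: wdot_def)
      qed
      define h where "h i = Abs_mps (\<lambda>e. if v (axis i 1 + e) = i then mps_coeff f (axis i 1 + e) else 0)" for i
      have hc: "mps_coeff (h i) e = (if v (axis i 1 + e) = i then mps_coeff f (axis i 1 + e) else 0)" for i e
        by (simp add: h_def Abs_mps_inverse)
      have deg: "wdot 1 (axis i 1 :: nat ^ 'b) = 1" for i by (simp add: wdot_def axis_def)
      have "f = (\<Sum>i\<in>UNIV. mterm 1 (axis i 1) * h i)"
      proof (rule mps_eqI)
        fix e
        have "mps_coeff (mterm 1 (axis i 1) * h i) e = (if i = v e then mps_coeff f e else 0)" for i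
        proof (cases "\<exists>b. e = axis i 1 + b")
          case True
          then show ?thesis by (auto simp: mps_coeff_mterm_mult_add hc)
        next
          case False
          have "mps_coeff f e = 0" if "i = v e"
          proof (rule ccontr)
            assume "mps_coeff f e \<noteq> 0"
            then have "e $ i \<noteq> 0" using v that by blast
            then have "\<forall>j. axis i 1 $ j \<le> e $ j" by (auto simp: axis_def)
            then show False using False by (simp add: exponent_diff)
          qed
          then show ?thesis using False by (simp add: mps_coeff_mterm_mult_eq_0)
        qed
        then show "mps_coeff f e = mps_coeff (\<Sum>i\<in>UNIV. mterm 1 (axis i 1) * h i) e"
          by (simp add: mps_coeff_sum)
      qed
      moreover have "mterm 1 (axis i 1) * h i \<in> ideal_mult (fl 1) (fl n)" for i
      proof -
        have "h i \<in> fl n" unfolding fl_mps_iff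
        proof (intro allI impI)
          fix e assume "mps_coeff (h i) e \<noteq> 0"
          then have "mps_coeff f (axis i 1 + e) \<noteq> 0" by (auto simp: hc split: if_splits)
          then have "Suc n \<le> wdot 1 (axis i 1 + e)" using f unfolding fl_mps_iff by blast
          then show "n \<le> wdot 1 e" unfolding wdot_add deg by simp
        qed
        moreover have "mterm 1 (axis i 1) \<in> (fl 1 :: ('a, 'b) mps set)" by (rule mterm_in_fl) (use deg[of i] in simp)
        ultimately show ?thesis unfolding ideal_mult_def by (blast intro: ideal.span_base)
      qed
      ultimately show "f \<in> ideal_mult (fl 1) (fl n)"
        unfolding ideal_mult_def by (metis (no_types, lifting) ideal.span_sum)
    qed
qed

lemma max_ideal_power_fps:
  assumes max_ideal_power: "\<And>n. ideal_power max_ideal n = (fl n :: 'a::filt_ring set)"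
  shows "ideal_power max_ideal n = (fl n :: 'a fps set)"
proof -
  have m: "ideal_power max_ideal (Suc 0) = (fl 1 :: 'a set)" using max_ideal_power[of 1] by simp
  have m1: "max_ideal = (fl 1 :: 'a set)"
  proof -
    have *: "a \<in> fl 1" if "\<not> a dvd 1" for a :: 'a
    proof -
      have "a * 1 \<in> ideal_power max_ideal (Suc 0)"
        unfolding ideal_power.simps ideal_mult_def
        by (rule ideal.span_base) (use that in \<open>unfold max_ideal_def, blast\<close>)
      then show ?thesis using m by simp
    qed
    moreover have "\<not> a dvd 1" if a: "a \<in> fl 1" for a :: 'a
    proof
      assume "a dvd 1"
      then obtain b where b: "1 = a * b" by (rule dvdE)
      have "(1 :: 'a) \<in> fl n" for n
        using fl_power[OF fl_multr[OF a, of b], of n] unfolding b[symmetric] by simp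
      then have "(1 :: 'a) = 0" by (rule fl_separated)
      then show False by simp
    qed
    ultimately show ?thesis by (auto simp: max_ideal_def)
  qed
  show "ideal_power max_ideal n = (fl n :: 'a fps set)"
  proof (rule ideal_power_eq_flI)
    show "max_ideal = (fl 1 :: 'a fps set)"
    proof -
      have "a \<in> fl (Suc 0) \<longleftrightarrow> \<not> a dvd 1" for a :: 'a using m1 unfolding max_ideal_def by auto
      then show ?thesis
        by (simp only: max_ideal_def set_eq_iff mem_Collect_eq fps_unit_iff fl_fps_1_iff One_nat_def simp_thms)
    qed
    fix n
    have const: "fps_const a \<in> ideal_mult (fl 1) (fl n)" if "a \<in> fl (Suc n)" for a :: 'a
    proof -
      have "a \<in> ideal_mult (fl 1) (fl n)" using that max_ideal_power[of "Suc n"] max_ideal_power[of n]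
        by (simp add: m1)
      then have "a \<in> gen_ideal {a * b |a b. a \<in> fl 1 \<and> b \<in> fl n}" by (simp add: ideal_mult_def)
      then show ?thesis
      proof (induction rule: ideal.span_induct_alt)
        case base then show ?case unfolding ideal_mult_def by (simp add: ideal.span_zero)
      next
        case (step c x y)
        then obtain a b where x: "x = a * b" "a \<in> fl 1" "b \<in> fl n" by blast
        have "fps_const a * fps_const b \<in> {a * b |a b. a \<in> fl 1 \<and> b \<in> (fl n :: 'a fps set)}"
          using x(2,3) by (intro CollectI exI[of _ "fps_const a"] exI[of _ "fps_const b"]) simp
        then have "fps_const c * (fps_const a * fps_const b) \<in> ideal_mult (fl 1) (fl n)"
          unfolding ideal_mult_def by (rule ideal.span_scale[OF ideal.span_base])
        then have "fps_const c * (fps_const a * fps_const b) + fps_const y \<in> ideal_mult (fl 1) (fl n)"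
          using step(2) unfolding ideal_mult_def by (rule ideal.span_add)
        then show ?case by (simp add: x(1))
      qed
    qed
    show "fl (Suc n) \<subseteq> ideal_mult (fl 1) (fl n :: 'a fps set)"
    proof
      fix F :: "'a fps" assume F: "F \<in> fl (Suc n)"
      have "F = fps_const (fps_nth F 0) + fps_X * fps_shift 1 F"
        by (rule fps_ext) (auto simp: fps_X_mult_nth)
      moreover have "fps_shift 1 F \<in> fl n" using fl_fpsD[OF F, of "Suc _"] by (auto intro!: fl_fpsI)
      then have "fps_X * fps_shift 1 F \<in> {a * b |a b. a \<in> fl 1 \<and> b \<in> (fl n :: 'a fps set)}"
        by (intro CollectI exI[of _ fps_X] exI[of _ "fps_shift 1 F"]) simp
      then have "fps_X * fps_shift 1 F \<in> ideal_mult (fl 1) (fl n)"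
        unfolding ideal_mult_def by (rule ideal.span_base)
      moreover have "fps_const (fps_nth F 0) \<in> ideal_mult (fl 1) (fl n)"
        by (rule const) (use fl_fpsD[OF F, of 0] in simp)
      ultimately show "F \<in> ideal_mult (fl 1) (fl n)"
        unfolding ideal_mult_def using ideal.span_add by fastforce
    qed
  qed
qed

lemma le_ideal_ord_iff_aux:
  assumes max_ideal_power: "\<And>n. ideal_power max_ideal n = (fl n :: 'a::filt_ring set)"
  shows "enat n \<le> ideal_ord J \<longleftrightarrow> J \<subseteq> (fl n :: 'a set)"
proof
  assume n: "enat n \<le> ideal_ord J"
  show "J \<subseteq> fl n"
  proof (rule ccontr)
    assume not: "\<not> J \<subseteq> fl n"
    have "k < n" if "J \<subseteq> (fl k :: 'a set)" for k
      using not that fl_antimono[of n k] by (meson not_le subsetD subsetI)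
    then have "ideal_ord J \<le> enat (n - 1)"
      unfolding ideal_ord_def max_ideal_power by (intro Sup_least) fastforce
    moreover have "0 < n" using not by (cases n) auto
    moreover have "enat n \<le> enat (n - 1)" using n calculation(1) by (rule order_trans)
    ultimately show False by simp
  qed
qed (auto simp: ideal_ord_def max_ideal_power intro: Sup_upper)

lemma le_ideal_ord_iff_mps:
  "enat n \<le> ideal_ord J \<longleftrightarrow> J \<subseteq> (fl n :: ('k::field, 'n::finite) mps set)"
  by (rule le_ideal_ord_iff_aux[OF max_ideal_power_mps])

lemma le_ideal_ord_iff_fps:
  "enat n \<le> ideal_ord J \<longleftrightarrow> J \<subseteq> (fl n :: ('k::field, 'n::finite) mps fps set)"
  by (rule le_ideal_ord_iff_aux[OF max_ideal_power_fps[OF max_ideal_power_mps]])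

section \<open>Weights\<close>

text \<open>The monomials $x^e y^s$ of a series of weight at least $n$, where $x_i$ has weight $w_i$ and
  $y$ has weight $t$. The order is the case of weights one, and divisibility by a power of $x_i$
  is the case where all other weights are zero.\<close>

definition wge :: "nat ^ 'n \<Rightarrow> nat \<Rightarrow> nat \<Rightarrow> ('k::comm_ring_1, 'n::finite) mps fps \<Rightarrow> bool" where
  "wge w t n F \<longleftrightarrow> (\<forall>s e. mps_coeff (fps_nth F s) e \<noteq> 0 \<longrightarrow> n \<le> wdot w e + t * s)"

lemma wgeD: "wge w t n F \<Longrightarrow> mps_coeff (fps_nth F s) e \<noteq> 0 \<Longrightarrow> n \<le> wdot w e + t * s"
  by (simp add: wge_def)

lemma wge_0 [simp]: "wge w t n 0" "wge w t 0 F"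
  by (simp_all add: wge_def)

lemma wge_antimono: "m \<le> n \<Longrightarrow> wge w t n F \<Longrightarrow> wge w t m F"
  unfolding wge_def by (meson order_trans)

lemma wge_add: "wge w t n F \<Longrightarrow> wge w t n G \<Longrightarrow> wge w t n (F + G)"
  unfolding wge_def by (metis add.right_neutral fps_add_nth mps_coeff_add)

lemma wge_uminus: "wge w t n F \<Longrightarrow> wge w t n (- F)"
  by (simp add: wge_def)

lemma wge_diff: "wge w t n F \<Longrightarrow> wge w t n G \<Longrightarrow> wge w t n (F - G)"
  using wge_add[of w t n F "- G"] wge_uminus[of w t n G] by simp

lemma wge_sum: "(\<And>x. x \<in> X \<Longrightarrow> wge w t n (f x)) \<Longrightarrow> wge w t n (sum f X)"
  by (induction X rule: infinite_finite_induct) (auto intro: wge_add)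

lemma wge_cong: "wge w t n (F - G) \<Longrightarrow> wge w t n F \<longleftrightarrow> wge w t n G"
  using wge_add[of w t n "F - G" G] wge_diff[of w t n F "F - G"] by auto

lemma fps_mps_eqI: "(\<And>s e. mps_coeff (fps_nth F s) e = mps_coeff (fps_nth G s) e) \<Longrightarrow> F = G"
  by (intro fps_ext mps_eqI)

lemma fps_mult_support:
  assumes "mps_coeff (fps_nth (F * G) s) e \<noteq> 0"
  shows "\<exists>i j a b. s = i + j \<and> e = a + b \<and> mps_coeff (fps_nth F i) a \<noteq> 0 \<and> mps_coeff (fps_nth G j) b \<noteq> 0"
proof -
  from assms have "(\<Sum>i=0..s. mps_coeff (fps_nth F i * fps_nth G (s - i)) e) \<noteq> 0"
    by (simp add: fps_mult_nth mps_coeff_sum)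
  then obtain i where i: "i \<in> {0..s}" "mps_coeff (fps_nth F i * fps_nth G (s - i)) e \<noteq> 0"
    by (rule sum.not_neutral_contains_not_neutral)
  then show ?thesis
    using mps_mult_support[OF i(2)] by (intro exI[of _ i] exI[of _ "s - i"]) auto
qed

lemma wge_mult: "wge w t m F \<Longrightarrow> wge w t n G \<Longrightarrow> wge w t (m + n) (F * G)"
  unfolding wge_def
proof (intro allI impI)
  fix s e assume h: "\<forall>s e. mps_coeff (fps_nth F s) e \<noteq> 0 \<longrightarrow> m \<le> wdot w e + t * s"
    "\<forall>s e. mps_coeff (fps_nth G s) e \<noteq> 0 \<longrightarrow> n \<le> wdot w e + t * s"
    "mps_coeff (fps_nth (F * G) s) e \<noteq> 0"
  from fps_mult_support[OF h(3)] obtain i j a b where "s = i + j" "e = a + b"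
    "mps_coeff (fps_nth F i) a \<noteq> 0" "mps_coeff (fps_nth G j) b \<noteq> 0" by blast
  then show "m + n \<le> wdot w e + t * s"
    using h(1)[rule_format, of i a] h(2)[rule_format, of j b] by (simp add: wdot_add algebra_simps)
qed

lemma wge_multl: "wge w t n G \<Longrightarrow> wge w t n (F * G)"
  using wge_mult[of w t 0 F n G] by simp

lemma wge_multr: "wge w t n F \<Longrightarrow> wge w t n (F * G)"
  using wge_mult[of w t n F 0 G] by simp

lemma wge_power: "wge w t n F \<Longrightarrow> wge w t (k * n) (F ^ k)"
  by (induction k) (auto intro: wge_mult)

lemma wge_unit:
  assumes "u dvd 1"
  shows "wge w t n (F * u) \<longleftrightarrow> wge w t n F"
proof
  obtain v where "1 = u * v" using assms by (rule dvdE)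
  then have "F = F * u * v" by (simp add: mult.assoc)
  then show "wge w t n (F * u) \<Longrightarrow> wge w t n F" using wge_multr[of w t n "F * u" v] by simp
qed (rule wge_multr)

lemma wge_const_iff: "wge w t n (fps_const a) \<longleftrightarrow> (\<forall>e. mps_coeff a e \<noteq> 0 \<longrightarrow> n \<le> wdot w e)"
proof
  assume "wge w t n (fps_const a)"
  from wgeD[OF this, of 0] show "\<forall>e. mps_coeff a e \<noteq> 0 \<longrightarrow> n \<le> wdot w e" by simp
next
  assume "\<forall>e. mps_coeff a e \<noteq> 0 \<longrightarrow> n \<le> wdot w e"
  then show "wge w t n (fps_const a)" by (simp add: wge_def)
qed

lemma wge_X_power: "wge w t (t * k) (fps_X ^ k)"
  by (auto simp: wge_def fps_X_power_iff)

lemma wge_fl_iff: "wge 1 1 n F \<longleftrightarrow> F \<in> fl n"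
  by (auto simp: wge_def fl_fps_def fl_mps_iff le_diff_conv)

lemma wge_scale:
  fixes w w' :: "nat ^ 'n::finite"
  assumes "0 < k" "\<And>i. w' $ i = k * w $ i" "t' = k * t"
  shows "wge w' t' (k * n) F \<longleftrightarrow> wge w t n F"
proof -
  have "wdot w' e + t' * s = k * (wdot w e + t * s)" for e s
    using assms(2,3) by (simp add: wdot_def sum_distrib_left algebra_simps)
  then show ?thesis using assms(1) by (simp add: wge_def)
qed

lemma wge_fsum:
  assumes f: "\<And>n. f n \<in> fl n" and w: "\<And>n. wge w t m (f n)"
  shows "wge w t m (fsum f)"
  unfolding wge_def
proof (intro allI impI)
  fix s e assume nz: "mps_coeff (fps_nth (fsum f) s) e \<noteq> 0"
  have "fps_nth (fsum f - (\<Sum>n<Suc (wdot 1 e + s). f n)) s \<in> fl (Suc (wdot 1 e + s) - s)"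
    by (rule fl_fpsD[OF fsum[OF f]])
  then have "mps_coeff (fps_nth (fsum f - (\<Sum>n<Suc (wdot 1 e + s). f n)) s) e = 0"
    unfolding fl_mps_iff by (metis add_diff_cancel_right' add_Suc not_less_eq_eq order_refl)
  then have "mps_coeff (fps_nth (\<Sum>n<Suc (wdot 1 e + s). f n) s) e \<noteq> 0" using nz by simp
  moreover have "wge w t m (\<Sum>n<Suc (wdot 1 e + s). f n)" by (rule wge_sum) (rule w)
  ultimately show "m \<le> wdot w e + t * s" by (rule wgeD[rotated])
qed

text \<open>Substituting $y + H$ for $y$ does not lower weights as long as $H$ has at least the weight of $y$.\<close>

lemma wge_shift:
  assumes H: "H \<in> fl (Suc 0)" and w: "\<And>e. mps_coeff H e \<noteq> 0 \<Longrightarrow> t \<le> wdot w e"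
    and F: "wge w t n F"
  shows "wge w t n (shift H F)"
  unfolding shift_def
proof (rule wge_fsum)
  fix j
  show "fps_const (fps_nth F j) * (fps_X + fps_const H) ^ j \<in> fl j" by (rule shift_term_in_fl[OF H])
  have "wge w t (n - t * j) (fps_const (fps_nth F j))"
    using F by (auto simp: wge_const_iff wge_def le_diff_conv)
  moreover have "wge w t (j * t) ((fps_X + fps_const H) ^ j)"
    using wge_X_power[of w t 1] w by (intro wge_power wge_add) (auto simp: wge_const_iff)
  ultimately show "wge w t n (fps_const (fps_nth F j) * (fps_X + fps_const H) ^ j)"
    by (intro wge_antimono[OF _ wge_mult]) (auto simp: mult.commute)
qed

lemma wge_shift_iff:
  assumes H: "H \<in> fl (Suc 0)" and w: "\<And>e. mps_coeff H e \<noteq> 0 \<Longrightarrow> t \<le> wdot w e"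
  shows "wge w t n (shift H F) \<longleftrightarrow> wge w t n F"
  using wge_shift[OF H w, of n F] wge_shift[of "- H" t w n "shift H F"] assms
  by (auto simp: fl_uminus)

subsection \<open>Leading monomials\<close>

text \<open>Products of powers of primes order the monomials totally and compatibly with
  multiplication. Minimal elements for this order give multiplicativity of the weight.\<close>

lemma prime_weights:
  "\<exists>\<nu> :: ('a::finite \<Rightarrow> nat) \<Rightarrow> nat. inj \<nu> \<and> (\<forall>\<epsilon>. 0 < \<nu> \<epsilon>) \<and> (\<forall>\<epsilon> \<delta>. \<nu> (\<lambda>i. \<epsilon> i + \<delta> i) = \<nu> \<epsilon> * \<nu> \<delta>)"
proof -
  have "infinite {p :: nat. prime p}" by (rule primes_infinite)
  then obtain S :: "nat set" where S: "S \<subseteq> {p. prime p}" "finite S" "card S = CARD('a)"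
    by (meson infinite_arbitrarily_large)
  obtain P :: "'a \<Rightarrow> nat" where P: "bij_betw P UNIV S"
    using finite_same_card_bij[of "UNIV :: 'a set" S] S by auto
  have pr: "prime (P i)" for i using P S(1) by (auto simp: bij_betw_def)
  have injP: "inj P" using P by (simp add: bij_betw_def)
  define \<nu> where "\<nu> \<epsilon> = (\<Prod>i\<in>UNIV. P i ^ \<epsilon> i)" for \<epsilon> :: "'a \<Rightarrow> nat"
  have "\<epsilon> i = multiplicity (P i) (\<nu> \<epsilon>)" for \<epsilon> i
  proof -
    have "\<nu> \<epsilon> = (\<Prod>p\<in>S. p ^ \<epsilon> (inv P p))"
      using prod.reindex_bij_betw[OF P, of "\<lambda>p. p ^ \<epsilon> (inv P p)"] by (simp add: \<nu>_def inv_f_f[OF injP])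
    moreover have "multiplicity (P i) (\<Prod>p\<in>S. p ^ \<epsilon> (inv P p)) = (if P i \<in> S then \<epsilon> (inv P (P i)) else 0)"
      by (rule multiplicity_prod_prime_powers[OF S(2) _ pr]) (use S(1) in auto)
    moreover have "P i \<in> S" using P by (auto simp: bij_betw_def)
    ultimately show ?thesis by (simp add: inv_f_f[OF injP])
  qed
  then have "inj \<nu>" by (intro injI ext) metis
  moreover have "0 < \<nu> \<epsilon>" for \<epsilon> using pr by (auto simp: \<nu>_def prod_pos prime_gt_0_nat)
  moreover have "\<nu> (\<lambda>i. \<epsilon> i + \<delta> i) = \<nu> \<epsilon> * \<nu> \<delta>" for \<epsilon> \<delta>
    by (simp add: \<nu>_def power_add prod.distrib)
  ultimately show ?thesis by blast
qed

text \<open>The weights $w$ and $t$ may vanish, so that a form of given weight need not be a polynomial. Among the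
  monomials of lowest weight the one that is minimal for the order just defined is therefore used: the product of
  two such monomials is obtained in only one way.\<close>

lemma not_wge_mult:
  fixes F G :: "('k::idom, 'n::finite) mps fps"
  assumes "\<not> wge w t (Suc m) F" "\<not> wge w t (Suc n) G"
  shows "\<not> wge w t (Suc (m + n)) (F * G)"
proof -
  obtain \<nu>0 :: "('n option \<Rightarrow> nat) \<Rightarrow> nat" where \<nu>0: "inj \<nu>0" "\<And>\<epsilon>. 0 < \<nu>0 \<epsilon>"
    "\<And>\<epsilon> \<delta>. \<nu>0 (\<lambda>i. \<epsilon> i + \<delta> i) = \<nu>0 \<epsilon> * \<nu>0 \<delta>" using prime_weights by blast
  define c :: "nat \<times> (nat ^ 'n) \<Rightarrow> 'n option \<Rightarrow> nat" where
    "c p i = (case i of None \<Rightarrow> fst p | Some j \<Rightarrow> snd p $ j)" for p i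
  define \<nu> where "\<nu> p = \<nu>0 (c p)" for p
  have cadd: "c (p + q) = (\<lambda>i. c p i + c q i)" for p q by (auto simp: c_def split: option.splits)
  have cinj: "p = q" if "c p = c q" for p q
  proof -
    have "c p None = c q None" "c p (Some j) = c q (Some j)" for j using that by auto
    then show ?thesis by (auto simp: c_def prod_eq_iff vec_eq_iff)
  qed
  have \<nu>: "\<nu> (p + q) = \<nu> p * \<nu> q" "0 < \<nu> p" "\<nu> p = \<nu> q \<Longrightarrow> p = q" for p q
    using \<nu>0 by (auto simp: \<nu>_def cadd intro!: cinj dest: injD)
  define W where "W p = wdot w (snd p) + t * fst p" for p :: "nat \<times> (nat ^ 'n)"
  have Wadd: "W (p + q) = W p + W q" for p q by (simp add: W_def wdot_add algebra_simps)
  define co where "co F p = mps_coeff (fps_nth F (fst p)) (snd p)" for F :: "('k, 'n) mps fps" and p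
  have lead: "\<exists>p. co F p \<noteq> 0 \<and> W p \<le> m \<and> (\<forall>q. co F q \<noteq> 0 \<longrightarrow> W p \<le> W q \<and> (W q = W p \<longrightarrow> \<nu> p \<le> \<nu> q))"
    if nw: "\<not> wge w t (Suc m) F" for F m
  proof -
    obtain p0 where p0: "co F p0 \<noteq> 0" "W p0 \<le> m"
      using nw by (force simp: wge_def co_def W_def not_le)
    define S where "S = {q. co F q \<noteq> 0}"
    obtain p1 where p1: "p1 \<in> S" "\<And>q. q \<in> S \<Longrightarrow> W p1 \<le> W q"
      using ex_has_least_nat[of "\<lambda>q. q \<in> S" p0 W] p0 by (auto simp: S_def)
    obtain p where p: "p \<in> S \<and> W p = W p1" "\<And>q. q \<in> S \<and> W q = W p1 \<Longrightarrow> \<nu> p \<le> \<nu> q"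
      using ex_has_least_nat[of "\<lambda>q. q \<in> S \<and> W q = W p1" p1 \<nu>] p1 by auto
    have "W p \<le> m" using p1(2)[of p0] p0 p by (simp add: S_def)
    then show ?thesis using p p1 by (intro exI[of _ p]) (auto simp: S_def)
  qed
  obtain p where p: "co F p \<noteq> 0" "W p \<le> m" "\<And>q. co F q \<noteq> 0 \<Longrightarrow> W p \<le> W q" "\<And>q. co F q \<noteq> 0 \<Longrightarrow> W q = W p \<Longrightarrow> \<nu> p \<le> \<nu> q"
    using lead[OF assms(1)] by blast
  obtain p' where p': "co G p' \<noteq> 0" "W p' \<le> n" "\<And>q. co G q \<noteq> 0 \<Longrightarrow> W p' \<le> W q" "\<And>q. co G q \<noteq> 0 \<Longrightarrow> W q = W p' \<Longrightarrow> \<nu> p' \<le> \<nu> q"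
    using lead[OF assms(2)] by blast
  have uniq: "q = p \<and> q' = p'" if q: "co F q \<noteq> 0" "co G q' \<noteq> 0" "q + q' = p + p'" for q q'
  proof -
    have "W q + W q' = W p + W p'" using q(3) Wadd by metis
    then have W: "W q = W p" "W q' = W p'" using p(3)[OF q(1)] p'(3)[OF q(2)] by auto
    have le: "\<nu> p \<le> \<nu> q" "\<nu> p' \<le> \<nu> q'" using p(4)[OF q(1) W(1)] p'(4)[OF q(2) W(2)] .
    have eq: "\<nu> q * \<nu> q' = \<nu> p * \<nu> p'" using q(3) \<nu>(1) by metis
    have "\<nu> p = \<nu> q"
    proof (rule ccontr)
      assume "\<nu> p \<noteq> \<nu> q"
      then have "\<nu> p * \<nu> p' < \<nu> q * \<nu> q'" using le \<nu>(2) by (intro mult_less_le_imp_less) auto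
      then show False using eq by simp
    qed
    then have "q = p" using \<nu>(3) by metis
    then show ?thesis using q(3) by simp
  qed
  obtain s e s' e' where pe: "p = (s, e)" "p' = (s', e')" by (cases p, cases p')
  have "mps_coeff (fps_nth (F * G) (s + s')) (e + e') =
      (\<Sum>i=0..s + s'. mps_coeff (fps_nth F i * fps_nth G (s + s' - i)) (e + e'))"
    by (simp add: fps_mult_nth mps_coeff_sum)
  also have "\<dots> = (\<Sum>i\<in>{s}. mps_coeff (fps_nth F i * fps_nth G (s + s' - i)) (e + e'))"
  proof (rule sum.mono_neutral_right)
    show "\<forall>i\<in>{0..s + s'} - {s}. mps_coeff (fps_nth F i * fps_nth G (s + s' - i)) (e + e') = 0"
    proof (intro ballI, rule ccontr)
      fix i assume i: "i \<in> {0..s + s'} - {s}" "mps_coeff (fps_nth F i * fps_nth G (s + s' - i)) (e + e') \<noteq> 0"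
      obtain a b where ab: "e + e' = a + b" "mps_coeff (fps_nth F i) a \<noteq> 0"
        "mps_coeff (fps_nth G (s + s' - i)) b \<noteq> 0" using mps_mult_support[OF i(2)] by blast
      have "(i, a) + (s + s' - i, b) = p + p'" using ab(1) i(1) by (simp add: pe)
      then have "(i, a) = p" using uniq[of "(i, a)" "(s + s' - i, b)"] ab by (simp add: co_def)
      then show False using i(1) by (simp add: pe)
    qed
  qed auto
  also have "\<dots> = mps_coeff (fps_nth F s * fps_nth G s') (e + e')" by simp
  also have "\<dots> = (\<Sum>q | fst q + snd q = e + e'. mps_coeff (fps_nth F s) (fst q) * mps_coeff (fps_nth G s') (snd q))"
    by (simp add: mps_coeff_mult case_prod_unfold)
  also have "\<dots> = (\<Sum>q\<in>{(e, e')}. mps_coeff (fps_nth F s) (fst q) * mps_coeff (fps_nth G s') (snd q))"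
  proof (rule sum.mono_neutral_right)
    show "finite {q. fst q + snd q = e + e'}"
      using finite_exponent_splits[of "e + e'"] by (simp add: case_prod_unfold)
    show "\<forall>q\<in>{q. fst q + snd q = e + e'} - {(e, e')}.
        mps_coeff (fps_nth F s) (fst q) * mps_coeff (fps_nth G s') (snd q) = 0"
    proof (intro ballI, rule ccontr)
      fix q assume q: "q \<in> {q. fst q + snd q = e + e'} - {(e, e')}"
        "mps_coeff (fps_nth F s) (fst q) * mps_coeff (fps_nth G s') (snd q) \<noteq> 0"
      then have "(s, fst q) = p \<and> (s', snd q) = p'" by (intro uniq) (auto simp: co_def pe)
      then show False using q by (auto simp: pe prod_eq_iff)
    qed
  qed auto
  also have "\<dots> \<noteq> 0" using p(1) p'(1) by (simp add: co_def pe)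
  finally have "mps_coeff (fps_nth (F * G) (s + s')) (e + e') \<noteq> 0" .
  moreover have "wdot w (e + e') + t * (s + s') \<le> m + n"
    using Wadd[of p p'] p(2) p'(2) by (simp add: W_def pe algebra_simps)
  ultimately show ?thesis unfolding wge_def by (meson Suc_n_not_le_n le_trans not_le)
qed

lemma wge_root:
  fixes F :: "('k::idom, 'n::finite) mps fps"
  assumes "wge w t (Suc (N * n)) (F ^ N)"
  shows "wge w t (Suc n) F"
proof (rule ccontr)
  assume F: "\<not> wge w t (Suc n) F"
  have "\<not> wge w t (Suc (k * n)) (F ^ k)" for k
  proof (induction k)
    case 0
    have "mps_coeff (fps_nth (1 :: ('k, 'n) mps fps) 0) 0 \<noteq> 0" by (simp add: mps_coeff_one)
    then show ?case unfolding wge_def by (metis Suc_n_not_le_n add_0 mult_0 mult_0_right power_0 wdot_0(1))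
  next
    case (Suc k)
    then show ?case using not_wge_mult[OF F Suc] by simp
  qed
  then show False using assms by blast
qed

lemma wge_root_le:
  fixes F :: "('k::idom, 'n::finite) mps fps"
  assumes "wge w t (N * n) (F ^ N)" "0 < N"
  shows "wge w t n F"
proof (cases n)
  case (Suc m)
  have "wge w t (Suc (N * m)) (F ^ N)" using assms by (intro wge_antimono[OF _ assms(1)]) (simp add: Suc)
  then show ?thesis using wge_root Suc by blast
qed simp

lemma fl_mps_const: "a \<in> fl n \<longleftrightarrow> wge 1 1 n (fps_const a)"
  using wge_fl_iff[of n "fps_const a"] by simp

lemma not_fl_mult:
  fixes a b :: "('k::idom, 'n::finite) mps"
  assumes "a \<notin> fl (Suc m)" "b \<notin> fl (Suc n)"
  shows "a * b \<notin> fl (Suc (m + n))"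
  using not_wge_mult[of 1 1 m "fps_const a" n "fps_const b"] assms by (simp add: fl_mps_const)

lemma fl_mps_root:
  fixes a :: "('k::idom, 'n::finite) mps"
  assumes "a ^ N \<in> fl (N * n)" "0 < N"
  shows "a \<in> fl n"
  using wge_root_le[of 1 1 N n "fps_const a"] assms by (simp add: fl_mps_const fps_const_power)

lemma not_fl_power:
  fixes a :: "('k::idom, 'n::finite) mps"
  assumes "a \<notin> fl (Suc m)"
  shows "a ^ k \<notin> fl (Suc (k * m))"
  using wge_root[of 1 1 k m "fps_const a"] assms by (auto simp: fl_mps_const fps_const_power)

section \<open>Powers that are additive\<close>

text \<open>The exponents $q$ for which $a \mapsto a^q$ is additive by the binomial formula: $q = 1$ and the powers
  of the characteristic. Both kinds of characteristic are treated alike in this way.\<close>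

definition frob :: "'k::comm_ring_1 itself \<Rightarrow> nat \<Rightarrow> bool" where
  "frob _ q \<longleftrightarrow> 0 < q \<and> (\<forall>i. 0 < i \<and> i < q \<longrightarrow> of_nat (q choose i) = (0 :: 'k))"

lemma frob_pos: "frob TYPE('k::comm_ring_1) q \<Longrightarrow> 0 < q"
  by (simp add: frob_def)

lemma frob_1: "frob TYPE('k::comm_ring_1) (Suc 0)"
  by (auto simp: frob_def)

lemma frob_add:
  fixes a b :: "'k::comm_ring_1"
  assumes "frob TYPE('k) q"
  shows "(a + b) ^ q = a ^ q + b ^ q"
proof -
  have "(a + b) ^ q = (\<Sum>k\<le>q. of_nat (q choose k) * a ^ k * b ^ (q - k))" by (rule binomial_ring)
  also have "\<dots> = (\<Sum>k\<in>{0, q}. of_nat (q choose k) * a ^ k * b ^ (q - k))"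
    by (rule sum.mono_neutral_right) (use assms in \<open>auto simp: frob_def\<close>)
  also have "\<dots> = a ^ q + b ^ q" using assms by (simp add: frob_def)
  finally show ?thesis .
qed

lemma frob_sum:
  assumes "frob TYPE('k::comm_ring_1) q"
  shows "(sum f X :: 'k) ^ q = (\<Sum>x\<in>X. f x ^ q)"
  using frob_pos[OF assms]
  by (induction X rule: infinite_finite_induct) (auto simp: frob_add[OF assms] zero_power)

lemma frob_diff:
  fixes a b :: "'k::comm_ring_1"
  assumes "frob TYPE('k) q"
  shows "(a - b) ^ q = a ^ q - b ^ q"
  using frob_add[OF assms, of "a - b" b] by simp

lemma of_nat_mps: "(of_nat n :: ('k::comm_ring_1, 'n::finite) mps) = mterm (of_nat n) 0"
  by (induction n) (simp_all add: mterm_add mterm_1)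

lemma frob_mps: "frob TYPE('k::comm_ring_1) q \<Longrightarrow> frob TYPE(('k, 'n::finite) mps) q"
  by (simp add: frob_def of_nat_mps)

lemma frob_fps: "frob TYPE('k::comm_ring_1) q \<Longrightarrow> frob TYPE('k fps) q"
  by (simp add: frob_def flip: fps_of_nat)

text \<open>Lucas' congruence with respect to the base $q$.\<close>

lemma frob_binomial:
  assumes q: "frob TYPE('k::comm_ring_1) q" and "s < q" "v < q"
  shows "(of_nat ((q * t + s) choose (q * u + v)) :: 'k) = of_nat (t choose u) * of_nat (s choose v)"
proof (induction t arbitrary: u)
  case 0
  then show ?case
  proof (cases u)
    case (Suc u')
    then have "s < q * u + v" using assms(2) by simp
    then show ?thesis using Suc by (simp add: binomial_eq_0)
  qed simp
next
  case (Suc t)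
  let ?m = "q * t + s" and ?k = "q * u + v"
  have "of_nat ((q * Suc t + s) choose ?k) = (\<Sum>i\<le>?k. of_nat (q choose i) * of_nat (?m choose (?k - i)) :: 'k)"
    using vandermonde[of q ?m ?k] by (simp add: algebra_simps flip: of_nat_sum of_nat_mult)
  also have "\<dots> = (\<Sum>i\<in>{0, q} \<inter> {..?k}. of_nat (q choose i) * of_nat (?m choose (?k - i)))"
  proof (rule sum.mono_neutral_right)
    show "\<forall>i\<in>{..?k} - {0, q} \<inter> {..?k}. of_nat (q choose i) * of_nat (?m choose (?k - i)) = (0 :: 'k)"
    proof
      fix i assume "i \<in> {..?k} - {0, q} \<inter> {..?k}"
      then have "0 < i \<and> i < q \<or> q < i" by auto
      then have "of_nat (q choose i) = (0 :: 'k)" using q by (auto simp: frob_def binomial_eq_0)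
      then show "of_nat (q choose i) * of_nat (?m choose (?k - i)) = (0 :: 'k)" by simp
    qed
  qed auto
  also have "\<dots> = of_nat (Suc t choose u) * of_nat (s choose v)"
  proof (cases u)
    case 0
    then have "{0, q} \<inter> {..?k} = {0}" using assms(3) by auto
    then show ?thesis using Suc[of 0] by (simp only: 0) simp
  next
    case (Suc u')
    then have "{0, q} \<inter> {..?k} = {0, q}" by auto
    moreover have "?k - q = q * u' + v" using Suc by simp
    ultimately show ?thesis
      using Suc.IH[of u] Suc.IH[of u'] frob_pos[OF q] by (simp add: Suc algebra_simps)
  qed
  finally show ?case .
qed

lemma frob_mult:
  assumes "frob TYPE('k::comm_ring_1) a" "frob TYPE('k) b"
  shows "frob TYPE('k) (a * b)"
  unfolding frob_def
proof (intro conjI allI impI)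
  show "0 < a * b" using assms by (simp add: frob_def)
  fix i assume i: "0 < i \<and> i < a * b"
  have a: "0 < a" using assms by (simp add: frob_def)
  have "of_nat ((a * b + 0) choose (a * (i div a) + i mod a)) =
      (of_nat (b choose (i div a)) * of_nat (0 choose (i mod a)) :: 'k)"
    by (rule frob_binomial[OF assms(1)]) (use a in auto)
  also have "\<dots> = 0"
  proof (cases "i mod a = 0")
    case True
    then have "i = a * (i div a)" using mult_div_mod_eq[of a i] by simp
    then have "0 < i div a" "i div a < b" using i a
      by (metis mult_0_right neq0_conv, metis less_mult_imp_div_less mult.commute)
    then show ?thesis using assms(2) by (simp add: frob_def)
  qed (simp add: binomial_eq_0)
  finally show "of_nat (a * b choose i) = (0 :: 'k)" by simp
qed

lemma frob_CHAR_power: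
  assumes "CHAR('k::idom) \<noteq> 0"
  shows "frob TYPE('k) (CHAR('k) ^ n)"
proof (induction n)
  case (Suc n)
  have p: "prime CHAR('k)" using assms by (intro prime_CHAR_semidom) simp
  have "frob TYPE('k) CHAR('k)"
    using assms dvd_choose_prime[of _ "CHAR('k)"] p
    by (auto simp: frob_def of_nat_eq_0_iff_char_dvd prime_gt_0_nat)
  then show ?case using frob_mult Suc by simp
qed (simp add: frob_1)

text \<open>A $q$-th power is computed monomial by monomial: the exponents are multiplied by $q$ and the
  coefficients are raised to the power $q$.\<close>

lemma mps_frob_power:
  fixes f :: "('k::comm_ring_1, 'n::finite) mps"
  assumes q: "frob TYPE('k) q"
  shows "mps_coeff (f ^ q) (\<chi> i. q * e $ i) = mps_coeff f e ^ q"
    and "mps_coeff (f ^ q) e' \<noteq> 0 \<Longrightarrow> q dvd e' $ i"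
proof -
  have qpos: "0 < q" by (rule frob_pos[OF q])
  have coeff: "mps_coeff (f ^ q) e' = (\<Sum>a | wdot 1 a < N. if e' = (\<chi> i. q * a $ i) then mps_coeff f a ^ q else 0)"
    if N: "wdot 1 e' < N" for N e'
  proof -
    let ?P = "\<Sum>a | wdot 1 a < N. mterm (mps_coeff f a) a"
    have "(f - ?P) ^ q \<in> fl (q * N)" by (intro fl_power mps_truncate_in_fl)
    then have "f ^ q - ?P ^ q \<in> fl N"
      unfolding frob_diff[OF frob_mps[OF q]] by (rule fl_antimono[rotated]) (use qpos in simp)
    then have "mps_coeff (f ^ q - ?P ^ q) e' = 0" using N unfolding fl_mps_iff by (meson not_le)
    then have *: "mps_coeff (f ^ q) e' = mps_coeff (?P ^ q) e'" by simp
    have mul: "of_nat q * a = (\<chi> i. q * a $ i)" for a :: "nat ^ 'n"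
      by (simp add: vec_eq_iff of_nat_index)
    show ?thesis
      unfolding * frob_sum[OF frob_mps[OF q]] mps_coeff_sum mterm_power mps_coeff_mterm mul ..
  qed
  have inj: "(\<chi> i. q * e $ i) = (\<chi> i. q * a $ i) \<longleftrightarrow> e = a" for a e :: "nat ^ 'n"
    using qpos by (simp add: vec_eq_iff)
  show "mps_coeff (f ^ q) (\<chi> i. q * e $ i) = mps_coeff f e ^ q"
  proof -
    have "wdot 1 e \<le> wdot 1 (\<chi> i. q * e $ i)" using qpos by (auto simp: wdot_def intro: sum_mono)
    then show ?thesis
      unfolding coeff[OF lessI] inj
      by (subst sum.delta'[OF finite_exponents]) (simp add: less_Suc_eq_le)
  qed
  show "q dvd e' $ i" if "mps_coeff (f ^ q) e' \<noteq> 0"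
  proof -
    have "\<exists>a. e' = (\<chi> i. q * a $ i)"
    proof (rule ccontr)
      assume "\<not> ?thesis"
      then have "mps_coeff (f ^ q) e' = 0" unfolding coeff[OF lessI] by (intro sum.neutral) auto
      then show False using that by simp
    qed
    then obtain a where "e' = (\<chi> i. q * a $ i)" ..
    then show ?thesis by simp
  qed
qed

lemma fps_frob_power:
  fixes F :: "'a::filt_ring fps"
  assumes q: "frob TYPE('a) q"
  shows "fps_nth (F ^ q) s = (if q dvd s then fps_nth F (s div q) ^ q else 0)"
proof -
  let ?P = "\<Sum>n<Suc s. fps_const (fps_nth F n) * fps_X ^ n"
  have qpos: "0 < q" by (rule frob_pos[OF q])
  have F: "F = ?P + fps_X ^ Suc s * fps_shift (Suc s) F"
  proof (rule fps_ext)
    fix n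
    have "fps_nth (fps_const (fps_nth F j) * fps_X ^ j) n = (if n = j then fps_nth F j else 0)" for j
      by (simp add: fps_X_power_iff)
    then have "fps_nth ?P n = (if n < Suc s then fps_nth F n else 0)"
      by (simp only: fps_sum_nth sum.delta' finite_lessThan lessThan_iff)
    then show "fps_nth F n = fps_nth (?P + fps_X ^ Suc s * fps_shift (Suc s) F) n"
      by (auto simp: fps_X_power_mult_nth simp del: power_Suc sum.lessThan_Suc)
  qed
  have "F ^ q = ?P ^ q + fps_X ^ (Suc s * q) * fps_shift (Suc s) F ^ q"
    by (subst F) (simp only: frob_add[OF frob_fps[OF q]] power_mult_distrib power_mult)
  then have "fps_nth (F ^ q) s = fps_nth (?P ^ q) s + fps_nth (fps_X ^ (Suc s * q) * fps_shift (Suc s) F ^ q) s"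
    by (simp only: fps_add_nth)
  also have "fps_nth (fps_X ^ (Suc s * q) * fps_shift (Suc s) F ^ q) s = 0"
  proof -
    have "s < Suc s * q" using qpos by (cases q) auto
    then show ?thesis by (simp only: fps_X_power_mult_nth if_True)
  qed
  also have "?P ^ q = (\<Sum>n<Suc s. fps_const (fps_nth F n ^ q) * fps_X ^ (q * n))"
    unfolding frob_sum[OF frob_fps[OF q]]
    by (simp only: power_mult_distrib fps_const_power power_mult[symmetric] mult.commute[of _ q])
  also have "fps_nth \<dots> s = (\<Sum>n<Suc s. if n = s div q \<and> q dvd s then fps_nth F n ^ q else 0)"
    unfolding fps_sum_nth
  proof (rule sum.cong[OF refl])
    fix n
    have "s = q * n \<longleftrightarrow> n = s div q \<and> q dvd s" using qpos by auto
    then show "fps_nth (fps_const (fps_nth F n ^ q) * fps_X ^ (q * n)) s =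
        (if n = s div q \<and> q dvd s then fps_nth F n ^ q else 0)"
      by (simp add: fps_X_power_iff)
  qed
  also have "\<dots> = (if q dvd s then fps_nth F (s div q) ^ q else 0)"
    by (cases "q dvd s") (simp_all add: less_Suc_eq_le del: sum.lessThan_Suc)
  finally show ?thesis by simp
qed

section \<open>Coefficients with respect to shifted parameters\<close>

lemma fps_X_power_dvd_iff: "fps_X ^ N dvd (F :: 'a::comm_ring_1 fps) \<longleftrightarrow> (\<forall>i<N. fps_nth F i = 0)"
proof
  assume "fps_X ^ N dvd F"
  then show "\<forall>i<N. fps_nth F i = 0" by (auto simp: fps_X_power_mult_nth elim!: dvdE)
next
  assume *: "\<forall>i<N. fps_nth F i = 0"
  have "F = fps_X ^ N * fps_shift N F" by (rule fps_ext) (use * in \<open>auto simp: fps_X_power_mult_nth\<close>)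
  then show "fps_X ^ N dvd F" by (rule dvdI)
qed

text \<open>The coefficients of $f$ with respect to the parameter $X - g$ are the Taylor coefficients at $g$.\<close>

lemma expands_iff_shift:
  fixes g :: "'a::filt_ring"
  assumes g: "g \<in> fl (Suc 0)"
  shows "expands (fps_X - fps_const g) f a \<longleftrightarrow> a = fps_nth (shift g f)"
proof -
  note h = filt_hom_shift[OF g] and h' = filt_hom_shift[OF fl_uminus[OF g]]
  have w: "shift g (fps_X - fps_const g) = fps_X"
    by (simp only: filt_homD(5)[OF h] shift_X[OF g] shift_const[OF g] add_diff_cancel_right')
  have w': "shift (- g) fps_X = fps_X - fps_const g"
    unfolding shift_X[OF fl_uminus[OF g]] by (simp flip: fps_const_neg)
  have dvd: "(fps_X - fps_const g) ^ N dvd D \<longleftrightarrow> fps_X ^ N dvd shift g D" for N D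
  proof
    assume "(fps_X - fps_const g) ^ N dvd D"
    then obtain E where E: "D = (fps_X - fps_const g) ^ N * E" ..
    have "shift g D = fps_X ^ N * shift g E" unfolding E by (simp only: filt_homD(8,10)[OF h] w)
    then show "fps_X ^ N dvd shift g D" by (rule dvdI)
  next
    assume "fps_X ^ N dvd shift g D"
    then obtain E where E: "shift g D = fps_X ^ N * E" ..
    have "shift (- g) (shift g D) = (fps_X - fps_const g) ^ N * shift (- g) E"
      unfolding E by (simp only: filt_homD(8,10)[OF h'] w')
    then have "D = (fps_X - fps_const g) ^ N * shift (- g) E" unfolding shift_inverse(1)[OF g] .
    then show "(fps_X - fps_const g) ^ N dvd D" by (rule dvdI)
  qed
  have coeff: "fps_nth (shift g (f - (\<Sum>i<N. fps_const (a i) * (fps_X - fps_const g) ^ i))) k =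
      fps_nth (shift g f) k - a k" if "k < N" for N k
  proof -
    have "fps_nth (fps_const (a i) * fps_X ^ i) k = (if k = i then a i else 0)" for i
      by (simp add: fps_X_power_iff)
    then have "fps_nth (\<Sum>i<N. fps_const (a i) * fps_X ^ i) k = a k"
      using that by (simp only: fps_sum_nth sum.delta' finite_lessThan lessThan_iff if_True)
    then show ?thesis
      by (simp only: filt_homD(5)[OF h, of f] filt_homD(7,8,10)[OF h] w shift_const[OF g] fps_sub_nth)
  qed
  have "expands (fps_X - fps_const g) f a \<longleftrightarrow> (\<forall>N k. k < N \<longrightarrow> fps_nth (shift g f) k - a k = 0)"
    unfolding expands_def dvd fps_X_power_dvd_iff using coeff by auto
  then show ?thesis by (auto simp: fun_eq_iff) (metis lessI)
qed

lemma coeff_ideal_shift: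
  fixes g :: "'a::filt_ring"
  assumes "g \<in> fl (Suc 0)"
  shows "coeff_ideal c (fps_X - fps_const g) J =
    gen_ideal {fps_nth (shift g f) i ^ (fact c div (c - i)) |f i. f \<in> J \<and> i < c}"
  unfolding coeff_ideal_def expands_iff_shift[OF assms] by (rule arg_cong[of _ _ gen_ideal]) auto

text \<open>The coefficients of $f$ with respect to $z - g$, written in the parameters $x$ and $y - h$.\<close>

definition coef :: "('k::comm_ring_1, 'n::finite) mps fps \<Rightarrow> ('k, 'n) mps \<Rightarrow> ('k, 'n) mps fps fps \<Rightarrow> nat \<Rightarrow>
    ('k, 'n) mps fps" where
  "coef g h f i = shift h (fps_nth (shift g f) i)"

lemma coef_Taylor:
  assumes g: "g \<in> fl (Suc 0)" and g': "g' \<in> fl (Suc 0)" and h: "h \<in> fl (Suc 0)" and i: "i \<le> c"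
  shows "\<exists>S. coef g' h f i = (\<Sum>j<c. of_nat (j choose i) * coef g h f j * shift h (g' - g) ^ (j - i)) +
    shift h (g' - g) ^ (c - i) * (of_nat (c choose i) * coef g h f c + shift h (g' - g) * S)"
proof -
  note hh = filt_hom_shift[OF h]
  have G: "g' - g \<in> fl (Suc 0)" using g g' by (rule fl_diff[rotated])
  obtain S where S: "fps_nth (shift (g' - g) (shift g f)) i =
    (\<Sum>j\<le>c. of_nat (j choose i) * fps_nth (shift g f) j * (g' - g) ^ (j - i)) + (g' - g) ^ (Suc c - i) * S"
    using shift_Taylor[OF G i] by blast
  have "coef g' h f i = shift h (fps_nth (shift (g' - g) (shift g f)) i)"
    unfolding shift_shift[OF G g] by (simp add: coef_def)
  also have "\<dots> = (\<Sum>j\<le>c. of_nat (j choose i) * coef g h f j * shift h (g' - g) ^ (j - i)) +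
      shift h (g' - g) ^ (Suc c - i) * shift h S"
    unfolding S filt_homD(2,7,8,10,11)[OF hh] coef_def ..
  also have "(\<Sum>j\<le>c. of_nat (j choose i) * coef g h f j * shift h (g' - g) ^ (j - i)) =
      (\<Sum>j<c. of_nat (j choose i) * coef g h f j * shift h (g' - g) ^ (j - i)) +
      of_nat (c choose i) * coef g h f c * shift h (g' - g) ^ (c - i)"
    by (simp add: lessThan_Suc_atMost[symmetric])
  finally show ?thesis using i by (intro exI[of _ "shift h S"]) (simp add: Suc_diff_le algebra_simps)
qed

lemma coef_unit:
  assumes "g \<in> fl (Suc 0)" "h \<in> fl (Suc 0)" "fps_nth f c dvd 1"
  shows "coef g h f c dvd 1" and "fps_nth (shift g f) c - fps_nth f c \<in> fl (Suc 0)"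
proof -
  obtain S where "coef g 0 f c = (\<Sum>j<c. of_nat (j choose c) * coef 0 0 f j * shift 0 (g - 0) ^ (j - c)) +
    shift 0 (g - 0) ^ (c - c) * (of_nat (c choose c) * coef 0 0 f c + shift 0 (g - 0) * S)"
    using coef_Taylor[of 0 g 0 c c f] assms by auto
  then have "fps_nth (shift g f) c = fps_nth f c + g * S"
    by (simp add: coef_def binomial_eq_0)
  then show *: "fps_nth (shift g f) c - fps_nth f c \<in> fl (Suc 0)" using assms by (simp add: fl_multr)
  then have "fps_nth (shift g f) c dvd 1" using dvd_one_add_fl[OF assms(3)] by force
  then show "coef g h f c dvd 1" unfolding coef_def by (rule filt_homD(12)[OF filt_hom_shift[OF assms(2)]])
qed

text \<open>If the coefficients $f_j$ have weight at least $(c - j) \mu$ with respect to both $z - g$ and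
  $z - g'$, then $g' - g$ has weight at least $\mu$: otherwise $\binom{c}{q} f_c (g' - g)^q$ would be the only
  term of lowest weight in the coefficient of index $c - q$. This is the step that raises a lower bound
  for the weight of $G = g' - g$ by one.\<close>

lemma compare_step:
  fixes G :: "('k::idom, 'n::finite) mps fps"
  assumes eq: "F' = (\<Sum>j<c. of_nat (j choose (c - q)) * F j * G ^ (j - (c - q))) + G ^ q * U"
    and U: "U dvd 1" and q: "q \<le> c"
    and G: "wge w t \<nu> G"
    and F: "\<And>j. c - q \<le> j \<Longrightarrow> j < c \<Longrightarrow> wge w t (Suc ((c - j) * \<nu>)) (F j)"
    and F': "wge w t (Suc (q * \<nu>)) F'"
  shows "wge w t (Suc \<nu>) G"
proof -
  have "wge w t (Suc (q * \<nu>)) (of_nat (j choose (c - q)) * F j * G ^ (j - (c - q)))" if j: "j < c" for j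
  proof (cases "c - q \<le> j")
    case True
    have "wge w t (Suc ((c - j) * \<nu>) + (j - (c - q)) * \<nu>) (of_nat (j choose (c - q)) * F j * G ^ (j - (c - q)))"
      by (intro wge_mult wge_multl F wge_power G True j)
    moreover have "(c - j) * \<nu> + (j - (c - q)) * \<nu> = q * \<nu>"
      using True j q by (simp flip: add_mult_distrib)
    ultimately show ?thesis by simp
  qed (simp add: binomial_eq_0)
  then have "wge w t (Suc (q * \<nu>)) (F' - (\<Sum>j<c. of_nat (j choose (c - q)) * F j * G ^ (j - (c - q))))"
    by (intro wge_diff F' wge_sum) auto
  then have "wge w t (Suc (q * \<nu>)) (G ^ q * U)" unfolding eq by simp
  then show ?thesis unfolding wge_unit[OF U] by (rule wge_root)
qed

lemma compare_coef:
  fixes f :: "('k::field, 'n::finite) mps fps fps"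
  assumes g: "g \<in> fl (Suc 0)" and g': "g' \<in> fl (Suc 0)" and h: "h \<in> fl (Suc 0)"
    and f: "fps_nth f c dvd 1" and q: "0 < q" "q \<le> c" and bin: "of_nat (c choose q) \<noteq> (0 :: 'k)"
    and F: "\<And>j. c - q \<le> j \<Longrightarrow> j < c \<Longrightarrow> wge w t ((c - j) * \<mu>) (coef g h f j)"
    and F': "wge w t (q * \<mu>) (coef g' h f (c - q))"
  shows "wge w t \<mu> (shift h (g' - g))"
    and "(\<And>j. c - q \<le> j \<Longrightarrow> j < c \<Longrightarrow> wge w t (Suc ((c - j) * \<mu>)) (coef g h f j)) \<Longrightarrow>
      wge w t (Suc (q * \<mu>)) (coef g' h f (c - q)) \<Longrightarrow> wge w t (Suc \<mu>) (shift h (g' - g))"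
proof -
  let ?G = "shift h (g' - g)"
  note hh = filt_hom_shift[OF h]
  have G: "?G \<in> fl (Suc 0)" by (intro filt_homD(3)[OF hh] fl_diff g g')
  obtain S where "coef g' h f (c - q) = (\<Sum>j<c. of_nat (j choose (c - q)) * coef g h f j * ?G ^ (j - (c - q))) +
    ?G ^ (c - (c - q)) * (of_nat (c choose (c - q)) * coef g h f c + ?G * S)"
    using coef_Taylor[OF g g' h, of "c - q" c f] by auto
  moreover have "c - (c - q) = q" "c choose (c - q) = c choose q"
    using q binomial_symmetric[of q c] by auto
  ultimately have eq: "coef g' h f (c - q) = (\<Sum>j<c. of_nat (j choose (c - q)) * coef g h f j * ?G ^ (j - (c - q))) +
    ?G ^ q * (of_nat (c choose q) * coef g h f c + ?G * S)" by simp
  have "of_nat (c choose q) * coef g h f c dvd 1"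
  proof -
    have "(of_nat (c choose q) :: ('k, 'n) mps fps) dvd 1"
      using bin unfolding fps_unit_iff by (simp add: mps_unit_iff of_nat_mps mps_coeff_mterm flip: fps_of_nat)
    then show ?thesis using coef_unit(1)[OF g h f] mult_dvd_mono[of _ 1 _ 1] by simp
  qed
  then have U: "of_nat (c choose q) * coef g h f c + ?G * S dvd 1"
    using G by (intro dvd_one_add_fl fl_multr) auto
  note step = compare_step[OF eq U q(2), of w t]
  have "wge w t \<nu> ?G" if "\<nu> \<le> \<mu>" for \<nu> using that
  proof (induction \<nu>)
    case (Suc \<nu>)
    show ?case
    proof (rule step)
      show "wge w t \<nu> ?G" using Suc by simp
      show "wge w t (Suc ((c - j) * \<nu>)) (coef g h f j)" if j: "c - q \<le> j" "j < c" for j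
      proof (rule wge_antimono[OF _ F[OF j]])
        have "(c - j) * Suc \<nu> \<le> (c - j) * \<mu>" using Suc by (intro mult_le_mono2)
        then show "Suc ((c - j) * \<nu>) \<le> (c - j) * \<mu>" using j by simp
      qed
      show "wge w t (Suc (q * \<nu>)) (coef g' h f (c - q))"
      proof (rule wge_antimono[OF _ F'])
        have "q * Suc \<nu> \<le> q * \<mu>" using Suc by (intro mult_le_mono2)
        then show "Suc (q * \<nu>) \<le> q * \<mu>" using q by simp
      qed
    qed
  qed simp
  then show "wge w t \<mu> ?G" by simp
  then show "wge w t (Suc \<mu>) ?G" if "\<And>j. c - q \<le> j \<Longrightarrow> j < c \<Longrightarrow> wge w t (Suc ((c - j) * \<mu>)) (coef g h f j)"
    "wge w t (Suc (q * \<mu>)) (coef g' h f (c - q))"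
    by (rule step[OF _ that]) (use \<open>wge w t \<mu> ?G\<close> in auto)
qed

text \<open>Suppose that the coefficients of index between $i$ and $c$ have more than the lowest possible weight. Then a
  change of $z$ by a term of weight $\mu$ affects the coefficient of index $i$ in its lowest possible weight
  $(c - i) \mu$ only by $\binom c i f_c (g' - g)^{c-i}$, since all other terms of the Taylor expansion have larger weight.\<close>

lemma coef_change:
  fixes f :: "('k::comm_ring_1, 'n::finite) mps fps fps"
  assumes g: "g \<in> fl (Suc 0)" and g': "g' \<in> fl (Suc 0)" and h: "h \<in> fl (Suc 0)" and i: "i < c"
    and G: "wge w t \<mu> (shift h (g' - g))" and \<mu>: "0 < \<mu>"
    and F: "\<And>j. i < j \<Longrightarrow> j < c \<Longrightarrow> wge w t (Suc ((c - j) * \<mu>)) (coef g h f j)"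
  shows "wge w t (Suc ((c - i) * \<mu>)) (coef g' h f i - coef g h f i -
    of_nat (c choose i) * coef g h f c * shift h (g' - g) ^ (c - i))"
proof -
  let ?G = "shift h (g' - g)"
  obtain S where S: "coef g' h f i = (\<Sum>j<c. of_nat (j choose i) * coef g h f j * ?G ^ (j - i)) +
    ?G ^ (c - i) * (of_nat (c choose i) * coef g h f c + ?G * S)"
    using coef_Taylor[OF g g' h less_imp_le[OF i], of f] by auto
  have "(\<Sum>j<c. of_nat (j choose i) * coef g h f j * ?G ^ (j - i)) =
      coef g h f i + (\<Sum>j\<in>{..<c} - {i}. of_nat (j choose i) * coef g h f j * ?G ^ (j - i))"
    using i by (subst sum.remove[of _ i]) auto
  then have eq: "coef g' h f i - coef g h f i - of_nat (c choose i) * coef g h f c * ?G ^ (c - i) =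
      (\<Sum>j\<in>{..<c} - {i}. of_nat (j choose i) * coef g h f j * ?G ^ (j - i)) + ?G ^ (c - i) * ?G * S"
    unfolding S by (simp add: algebra_simps)
  have "wge w t (Suc ((c - i) * \<mu>)) (of_nat (j choose i) * coef g h f j * ?G ^ (j - i))"
    if j: "j < c" "j \<noteq> i" for j
  proof (cases "i < j")
    case True
    have "wge w t (Suc ((c - j) * \<mu>) + (j - i) * \<mu>) (of_nat (j choose i) * coef g h f j * ?G ^ (j - i))"
      by (intro wge_mult wge_multl F wge_power G True j)
    moreover have "(c - j) * \<mu> + (j - i) * \<mu> = (c - i) * \<mu>"
      using True j by (simp flip: add_mult_distrib)
    ultimately show ?thesis by simp
  qed (use j in \<open>simp add: binomial_eq_0\<close>)
  moreover have "wge w t (Suc ((c - i) * \<mu>)) (?G ^ (c - i) * ?G * S)"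
    using wge_multr[OF wge_mult[OF wge_power[OF G, of "c - i"] G], of S]
    by (rule wge_antimono[rotated]) (use \<mu> in simp)
  ultimately show ?thesis unfolding eq by (intro wge_add wge_sum) auto
qed

text \<open>A change of $z$ by a term of more than the lowest weight affects no coefficient in its lowest possible weight.\<close>

lemma coef_change_strict:
  fixes f :: "('k::comm_ring_1, 'n::finite) mps fps fps"
  assumes g: "g \<in> fl (Suc 0)" and g': "g' \<in> fl (Suc 0)" and h: "h \<in> fl (Suc 0)" and i: "i < c"
    and G: "wge w t (Suc \<mu>) (shift h (g' - g))"
    and F: "\<And>j. i < j \<Longrightarrow> j < c \<Longrightarrow> wge w t ((c - j) * \<mu>) (coef g h f j)"
  shows "wge w t (Suc ((c - i) * \<mu>)) (coef g' h f i - coef g h f i)"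
proof -
  let ?G = "shift h (g' - g)"
  obtain S where S: "coef g' h f i = (\<Sum>j<c. of_nat (j choose i) * coef g h f j * ?G ^ (j - i)) +
    ?G ^ (c - i) * (of_nat (c choose i) * coef g h f c + ?G * S)"
    using coef_Taylor[OF g g' h less_imp_le[OF i], of f] by auto
  have "(\<Sum>j<c. of_nat (j choose i) * coef g h f j * ?G ^ (j - i)) =
      coef g h f i + (\<Sum>j\<in>{..<c} - {i}. of_nat (j choose i) * coef g h f j * ?G ^ (j - i))"
    using i by (subst sum.remove[of _ i]) auto
  then have eq: "coef g' h f i - coef g h f i =
      (\<Sum>j\<in>{..<c} - {i}. of_nat (j choose i) * coef g h f j * ?G ^ (j - i)) +
      ?G ^ (c - i) * (of_nat (c choose i) * coef g h f c + ?G * S)"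
    unfolding S by simp
  have "wge w t (Suc ((c - i) * \<mu>)) (of_nat (j choose i) * coef g h f j * ?G ^ (j - i))"
    if j: "j < c" "j \<noteq> i" for j
  proof (cases "i < j")
    case True
    have "wge w t ((c - j) * \<mu> + (j - i) * Suc \<mu>) (of_nat (j choose i) * coef g h f j * ?G ^ (j - i))"
      by (intro wge_mult wge_multl F wge_power G True j)
    moreover have "(c - j) * \<mu> + (j - i) * \<mu> = (c - i) * \<mu>"
      using True j by (simp flip: add_mult_distrib)
    then have "Suc ((c - i) * \<mu>) \<le> (c - j) * \<mu> + (j - i) * Suc \<mu>" using True by simp
    ultimately show ?thesis by (rule wge_antimono[rotated])
  qed (use j in \<open>simp add: binomial_eq_0\<close>)
  moreover have "wge w t (Suc ((c - i) * \<mu>)) (?G ^ (c - i) * (of_nat (c choose i) * coef g h f c + ?G * S))"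
    using wge_multr[OF wge_power[OF G, of "c - i"]] by (rule wge_antimono[rotated]) (use i in simp)
  ultimately show ?thesis unfolding eq by (intro wge_add wge_sum) auto
qed

section \<open>Admissible series\<close>

lemma wdot_axis: "wdot (axis i m) e = m * e $ i"
proof -
  have "(\<Sum>j\<in>UNIV. (axis i m :: nat ^ 'a) $ j * e $ j) = (\<Sum>j\<in>UNIV. if j = i then m * e $ j else 0)"
    by (rule sum.cong) (auto simp: axis_def)
  then show ?thesis by (simp add: wdot_def)
qed

lemma wdot_const: "wdot (\<chi> i. m) e = m * wdot 1 e"
  by (simp add: wdot_def sum_distrib_left)

locale exponents =
  fixes r :: "nat ^ 'n::finite" and d c :: nat
  assumes d_pos: "0 < d" and c_pos: "0 < c"
begin

text \<open>All inequalities between exponents are multiplied by $c!$.\<close>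

definition M :: nat where "M = fact c"

lemma M_pos: "0 < M" by (simp add: M_def)

text \<open>The order $n / c!$ at least, for the weights one of $x_i$ and $\sigma$ of $y$.\<close>

abbreviation ord_ge :: "nat \<Rightarrow> nat \<Rightarrow> ('k::comm_ring_1, 'n) mps fps \<Rightarrow> bool" where
  "ord_ge \<sigma> \<equiv> wge (\<chi> i. M) (M * \<sigma>)"

text \<open>The weight of $x^r y^d$.\<close>

definition \<mu> :: "nat \<Rightarrow> nat" where "\<mu> \<sigma> = wdot 1 r + d * \<sigma>"

lemma \<mu>_pos: "0 < \<sigma> \<Longrightarrow> 0 < \<mu> \<sigma>" using d_pos by (simp add: \<mu>_def)

text \<open>The power $F^{c!/l}$ is divisible by $x^r$, and the quotient has weight at least $d \sigma$; for $l = c - i$ this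
  is what is asked of a coefficient $F$ of index $i$. Stated for $F$ itself, the condition makes sense for all
  $l$ and is multiplicative.\<close>

definition adm :: "nat \<Rightarrow> nat \<Rightarrow> ('k::comm_ring_1, 'n) mps fps \<Rightarrow> bool" where
  "adm \<sigma> l F \<longleftrightarrow> (\<forall>i. wge (axis i M) 0 (l * r $ i) F) \<and> ord_ge \<sigma> (l * \<mu> \<sigma>) F"

lemma adm_iff: "adm \<sigma> l F \<longleftrightarrow> (\<forall>s e. mps_coeff (fps_nth F s) e \<noteq> 0 \<longrightarrow>
    (\<forall>i. l * r $ i \<le> M * e $ i) \<and> l * \<mu> \<sigma> \<le> M * (wdot 1 e + \<sigma> * s))"
  by (auto simp: adm_def wge_def wdot_axis wdot_const algebra_simps)

lemma ord_geD: "ord_ge \<sigma> n F \<Longrightarrow> mps_coeff (fps_nth F s) e \<noteq> 0 \<Longrightarrow> n \<le> M * (wdot 1 e + \<sigma> * s)"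
  by (drule (1) wgeD) (simp add: wdot_const algebra_simps)

lemma ord_geI: "(\<And>s e. mps_coeff (fps_nth F s) e \<noteq> 0 \<Longrightarrow> n \<le> M * (wdot 1 e + \<sigma> * s)) \<Longrightarrow> ord_ge \<sigma> n F"
  by (simp add: wge_def wdot_const algebra_simps)

lemma adm_0 [simp]: "adm \<sigma> l 0" "adm \<sigma> 0 F"
  by (simp_all add: adm_def)

lemma adm_add: "adm \<sigma> l F \<Longrightarrow> adm \<sigma> l G \<Longrightarrow> adm \<sigma> l (F + G)"
  by (simp add: adm_def wge_add)

lemma adm_sum: "(\<And>x. x \<in> X \<Longrightarrow> adm \<sigma> l (f x)) \<Longrightarrow> adm \<sigma> l (sum f X)"
  by (simp add: adm_def wge_sum)

lemma adm_mult: "adm \<sigma> l F \<Longrightarrow> adm \<sigma> m G \<Longrightarrow> adm \<sigma> (l + m) (F * G)"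
  by (simp add: adm_def wge_mult add_mult_distrib)

lemma adm_multl: "adm \<sigma> l F \<Longrightarrow> adm \<sigma> l (G * F)"
  by (simp add: adm_def wge_multl)

lemma adm_multr: "adm \<sigma> l F \<Longrightarrow> adm \<sigma> l (F * G)"
  by (simp add: adm_def wge_multr)

lemma adm_power: "adm \<sigma> l F \<Longrightarrow> adm \<sigma> (k * l) (F ^ k)"
  by (induction k) (auto intro: adm_mult)

lemma ord_ge_shift:
  assumes "H \<in> fl \<sigma>" "0 < \<sigma>"
  shows "ord_ge \<sigma> n (shift H F) \<longleftrightarrow> ord_ge \<sigma> n F"
proof (rule wge_shift_iff)
  show "H \<in> fl (Suc 0)" using assms by (auto intro: fl_antimono[of "Suc 0" \<sigma>])
  show "M * \<sigma> \<le> wdot (\<chi> i. M) e" if "mps_coeff H e \<noteq> 0" for e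
    using assms(1) that by (auto simp: wdot_const fl_mps_iff)
qed

lemma adm_shift:
  assumes "H \<in> fl \<sigma>" "0 < \<sigma>"
  shows "adm \<sigma> l (shift H F) \<longleftrightarrow> adm \<sigma> l F"
proof -
  have "H \<in> fl (Suc 0)" using assms by (auto intro: fl_antimono[of "Suc 0" \<sigma>])
  then show ?thesis unfolding adm_def ord_ge_shift[OF assms] by (simp add: wge_shift_iff)
qed

text \<open>If $l d \le c!\, s$ the factor $y^s$ pays for $y^{ld/c!}$ at every weight of $y$. Otherwise the deficit is paid for
  by $x^e$, and it decreases with the weight of $y$.\<close>

lemma adm_antimono:
  assumes F: "adm \<sigma> l F" and "\<sigma>' \<le> \<sigma>"
  shows "adm \<sigma>' l F"
  unfolding adm_iff
proof (intro allI impI conjI)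
  fix s e assume nz: "mps_coeff (fps_nth F s) e \<noteq> 0"
  then have 1: "l * r $ i \<le> M * e $ i" for i using F by (simp add: adm_iff)
  then show "l * r $ i \<le> M * e $ i" for i .
  have r: "l * wdot 1 r \<le> M * wdot 1 e"
    unfolding wdot_def sum_distrib_left using 1 by (intro sum_mono) simp
  have 2: "l * \<mu> \<sigma> \<le> M * (wdot 1 e + \<sigma> * s)" using F nz by (simp add: adm_iff)
  show "l * \<mu> \<sigma>' \<le> M * (wdot 1 e + \<sigma>' * s)"
  proof (cases "l * d \<le> M * s")
    case True
    then have "l * d * \<sigma>' \<le> M * s * \<sigma>'" by (rule mult_le_mono1)
    moreover have "l * \<mu> \<sigma>' = l * wdot 1 r + l * d * \<sigma>'" "M * (wdot 1 e + \<sigma>' * s) = M * wdot 1 e + M * s * \<sigma>'"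
      by (simp_all add: \<mu>_def algebra_simps)
    ultimately show ?thesis using r by linarith
  next
    case False
    then obtain k where k: "l * d = M * s + k" using nat_le_iff_add by (metis le_cases)
    have "l * wdot 1 r + k * \<sigma> \<le> M * wdot 1 e"
    proof -
      have "l * \<mu> \<sigma> = l * wdot 1 r + (M * s + k) * \<sigma>"
        unfolding k[symmetric] by (simp add: \<mu>_def algebra_simps)
      then show ?thesis using 2 by (simp add: algebra_simps)
    qed
    moreover have "k * \<sigma>' \<le> k * \<sigma>" using assms(2) by simp
    moreover have "l * \<mu> \<sigma>' = l * wdot 1 r + (M * s + k) * \<sigma>'"
      unfolding k[symmetric] by (simp add: \<mu>_def algebra_simps)
    moreover have "(M * s + k) * \<sigma>' = M * s * \<sigma>' + k * \<sigma>'" "M * (wdot 1 e + \<sigma>' * s) = M * wdot 1 e + M * s * \<sigma>'"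
      by (simp_all add: algebra_simps)
    ultimately show ?thesis by linarith
  qed
qed

text \<open>This condition on $(g,h)$ says that $J_{-1}^{(g,h)}$ is $x^r$ times an ideal all of whose elements
  have weight at least $d\sigma$, where $y - h$ has weight $\sigma$.\<close>

definition good :: "('k::comm_ring_1, 'n) mps fps fps set \<Rightarrow> nat \<Rightarrow> ('k, 'n) mps fps \<Rightarrow> ('k, 'n) mps \<Rightarrow> bool" where
  "good J \<sigma> g h \<longleftrightarrow> g \<in> fl (Suc 0) \<and> h \<in> fl (Suc 0) \<and> (\<forall>f\<in>J. \<forall>i<c. adm \<sigma> (c - i) (coef g h f i))"

lemma goodD:
  assumes "good J \<sigma> g h"
  shows "g \<in> fl (Suc 0)" "h \<in> fl (Suc 0)" "f \<in> J \<Longrightarrow> i < c \<Longrightarrow> adm \<sigma> (c - i) (coef g h f i)"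
    "f \<in> J \<Longrightarrow> i < c \<Longrightarrow> ord_ge \<sigma> ((c - i) * \<mu> \<sigma>) (coef g h f i)"
  using assms by (simp_all add: good_def adm_def)

lemma good_antimono: "good J \<sigma> g h \<Longrightarrow> \<sigma>' \<le> \<sigma> \<Longrightarrow> good J \<sigma>' g h"
  by (auto simp: good_def intro: adm_antimono)

lemma good_change_g:
  assumes J: "good J \<sigma> g h" and G: "G \<in> fl (Suc 0)" "adm \<sigma> 1 (shift h G)"
  shows "good J \<sigma> (g + G) h"
  unfolding good_def
proof (intro conjI ballI allI impI)
  note gh = goodD(1,2)[OF J]
  have g': "g + G \<in> fl (Suc 0)" using gh G by (simp add: fl_add)
  show "g + G \<in> fl (Suc 0)" "h \<in> fl (Suc 0)" by (rule g' gh)+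
  fix f i assume f: "f \<in> J" and i: "i < c"
  let ?G = "shift h (g + G - g)"
  have adm: "adm \<sigma> k (?G ^ k)" for k using adm_power[OF G(2), of k] by simp
  obtain S where S: "coef (g + G) h f i = (\<Sum>j<c. of_nat (j choose i) * coef g h f j * ?G ^ (j - i)) +
    ?G ^ (c - i) * (of_nat (c choose i) * coef g h f c + ?G * S)"
    using coef_Taylor[OF gh(1) g' gh(2) less_imp_le[OF i], of f] by auto
  have "adm \<sigma> (c - i) (of_nat (j choose i) * coef g h f j * ?G ^ (j - i))" if "j < c" for j
  proof (cases "i \<le> j")
    case True
    have "adm \<sigma> ((c - j) + (j - i)) (of_nat (j choose i) * coef g h f j * ?G ^ (j - i))"
      by (intro adm_mult adm_multl goodD(3)[OF J f that] adm)
    then show ?thesis using True that by simp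
  qed (simp add: binomial_eq_0)
  then show "adm \<sigma> (c - i) (coef (g + G) h f i)"
    unfolding S by (intro adm_add adm_sum adm_multr[OF adm]) auto
qed

lemma coef_change_h: "h \<in> fl (Suc 0) \<Longrightarrow> h' \<in> fl (Suc 0) \<Longrightarrow> coef g h' f i = shift (h' - h) (coef g h f i)"
  by (simp add: coef_def shift_shift fl_diff)

text \<open>Here $h' - h$ has at least the weight $\sigma$ of $y - h$.\<close>

lemma good_change_h:
  assumes J: "good J \<sigma> g h" and H: "h' - h \<in> fl \<sigma>" "0 < \<sigma>"
  shows "good J \<sigma> g h'"
proof -
  have "h' - h \<in> fl (Suc 0)" using H by (auto intro: fl_antimono[of "Suc 0" \<sigma>])
  then have h': "h' \<in> fl (Suc 0)" using goodD(2)[OF J] fl_cong by blast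
  show ?thesis
    using J h' unfolding good_def by (simp add: coef_change_h[of h h'] adm_shift[OF H])
qed

text \<open>The comparison of weights is made for the weight $\sigma$ of $y$ and for each variable $x_i$ alone.\<close>

lemma good_compare:
  fixes J :: "('k::field, 'n) mps fps fps set"
  assumes J: "good J \<sigma> g h" "good J \<sigma> g' h"
    and f: "f \<in> J" "fps_nth f c dvd 1" and q: "0 < q" "q \<le> c" "of_nat (c choose q) \<noteq> (0 :: 'k)"
  shows "adm \<sigma> 1 (shift h (g' - g))"
  unfolding adm_def
proof (intro conjI allI)
  note gh = goodD(1,2)[OF J(1)] goodD(1)[OF J(2)]
  show "wge (axis i M) 0 (1 * r $ i) (shift h (g' - g))" for i
    unfolding mult_1
  proof (rule compare_coef(1)[OF gh(1,3,2) f(2) q])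
    show "wge (axis i M) 0 ((c - j) * r $ i) (coef g h f j)" if "j < c" for j
      using goodD(3)[OF J(1) f(1) that] by (simp add: adm_def)
    show "wge (axis i M) 0 (q * r $ i) (coef g' h f (c - q))"
      using goodD(3)[OF J(2) f(1), of "c - q"] q by (simp add: adm_def)
  qed
  show "ord_ge \<sigma> (1 * \<mu> \<sigma>) (shift h (g' - g))"
    unfolding mult_1
  proof (rule compare_coef(1)[OF gh(1,3,2) f(2) q])
    show "ord_ge \<sigma> ((c - j) * \<mu> \<sigma>) (coef g h f j)" if "j < c" for j
      using goodD(3)[OF J(1) f(1) that] by (simp add: adm_def)
    show "ord_ge \<sigma> (q * \<mu> \<sigma>) (coef g' h f (c - q))"
      using goodD(3)[OF J(2) f(1), of "c - q"] q by (simp add: adm_def)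
  qed
qed

text \<open>More than the lowest weight that is admissible at level $l$.\<close>

abbreviation strict :: "nat \<Rightarrow> nat \<Rightarrow> ('k::comm_ring_1, 'n) mps fps \<Rightarrow> bool" where
  "strict \<sigma> l F \<equiv> ord_ge \<sigma> (Suc (l * \<mu> \<sigma>)) F"

abbreviation pmono :: "'k::comm_ring_1 \<Rightarrow> nat ^ 'n \<Rightarrow> nat \<Rightarrow> ('k, 'n) mps fps" where
  "pmono b e D \<equiv> fps_const (mterm b e) * fps_X ^ D"

text \<open>At a weight of $y$ below $\sigma$, a series that is admissible for $\sigma$ has at most one monomial of the lowest
  admissible weight: it is the $x^e y^D$ with $c!\,(e, D) = l\,(r, d)$. Indeed a monomial with more $x$ and
  less $y$ would have too little weight for $\sigma$.\<close>

lemma adm_lead: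
  assumes F: "adm \<sigma> l F"
  shows "\<exists>b e D. (b \<noteq> 0 \<longrightarrow> (\<forall>i. M * e $ i = l * r $ i) \<and> M * D = l * d) \<and>
    (\<forall>\<sigma>'. 0 < \<sigma>' \<longrightarrow> \<sigma>' < \<sigma> \<longrightarrow> strict \<sigma>' l (F - pmono b e D))"
proof -
  have key: "(\<forall>i. M * e $ i = l * r $ i) \<and> M * s = l * d"
    if nz: "mps_coeff (fps_nth F s) e \<noteq> 0" and le: "M * (wdot 1 e + \<sigma>' * s) \<le> l * \<mu> \<sigma>'" and \<sigma>': "0 < \<sigma>'" "\<sigma>' < \<sigma>"
    for e s \<sigma>'
  proof -
    have 1: "l * r $ i \<le> M * e $ i" for i using F nz by (simp add: adm_iff)
    have r: "l * wdot 1 r \<le> M * wdot 1 e"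
      unfolding wdot_def sum_distrib_left using 1 by (intro sum_mono) simp
    have 2: "l * \<mu> \<sigma> \<le> M * (wdot 1 e + \<sigma> * s)" using F nz by (simp add: adm_iff)
    have le': "M * wdot 1 e + M * s * \<sigma>' \<le> l * wdot 1 r + l * d * \<sigma>'"
      using le by (simp add: \<mu>_def algebra_simps)
    have two: "l * wdot 1 r + l * d * \<sigma> \<le> M * wdot 1 e + M * s * \<sigma>"
      using 2 by (simp add: \<mu>_def algebra_simps)
    have "M * s * \<sigma>' \<le> l * d * \<sigma>'" using le' r by linarith
    then have s1: "M * s \<le> l * d" using \<sigma>' by simp
    then obtain k where k: "l * d = M * s + k" using nat_le_iff_add by blast
    have "M * wdot 1 e \<le> \<sigma>' * k + l * wdot 1 r" using le' unfolding k by (simp add: algebra_simps)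
    moreover have "\<sigma> * k + l * wdot 1 r \<le> M * wdot 1 e" using two unfolding k by (simp add: algebra_simps)
    ultimately have "\<sigma> * k \<le> \<sigma>' * k" by linarith
    then have "k = 0" using \<sigma>' by simp
    then have s: "M * s = l * d" using k by simp
    then have sum: "(\<Sum>i\<in>UNIV. M * e $ i) = (\<Sum>i\<in>UNIV. l * r $ i)"
      using le' r by (simp add: wdot_def sum_distrib_left)
    have "M * e $ i = l * r $ i" for i
    proof (rule ccontr)
      assume "M * e $ i \<noteq> l * r $ i"
      then have "(\<Sum>i\<in>UNIV. l * r $ i) < (\<Sum>i\<in>UNIV. M * e $ i)"
        using 1 \<open>M * e $ i \<noteq> l * r $ i\<close> le_neq_implies_less[of "l * r $ i" "M * e $ i"]
        by (intro sum_strict_mono_ex1) auto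
      then show False using sum by simp
    qed
    then show ?thesis using s by blast
  qed
  have co: "mps_coeff (fps_nth (pmono b e D) s) e' = (if s = D \<and> e' = e then b else 0)" for b e D s e'
    by (auto simp: fps_X_power_iff mps_coeff_mterm)
  show ?thesis
  proof (cases "\<exists>e D. (\<forall>i. M * e $ i = l * r $ i) \<and> M * D = l * d")
    case True
    then obtain e D where eD: "\<forall>i. M * e $ i = l * r $ i" "M * D = l * d" by blast
    have uniq: "e' = e \<and> s = D" if "\<forall>i. M * e' $ i = l * r $ i" "M * s = l * d" for e' s
    proof -
      have "M * e' $ i = M * e $ i" "M * s = M * D" for i using that eD by auto
      then show ?thesis using M_pos by (simp add: vec_eq_iff)
    qed
    have "strict \<sigma>' l (F - pmono (mps_coeff (fps_nth F D) e) e D)" if \<sigma>': "0 < \<sigma>'" "\<sigma>' < \<sigma>" for \<sigma>'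
    proof (rule ord_geI, rule ccontr)
      fix s e' assume nz: "mps_coeff (fps_nth (F - pmono (mps_coeff (fps_nth F D) e) e D) s) e' \<noteq> 0"
        and "\<not> Suc (l * \<mu> \<sigma>') \<le> M * (wdot 1 e' + \<sigma>' * s)"
      then have le: "M * (wdot 1 e' + \<sigma>' * s) \<le> l * \<mu> \<sigma>'" by simp
      have ne: "\<not> (s = D \<and> e' = e)" "mps_coeff (fps_nth F s) e' \<noteq> 0"
        using nz unfolding fps_sub_nth mps_coeff_diff co by (auto split: if_splits)
      from key[OF ne(2) le \<sigma>'] uniq ne(1) show False by blast
    qed
    then show ?thesis using eD by blast
  next
    case False
    have "strict \<sigma>' l (F - pmono 0 0 0)" if \<sigma>': "0 < \<sigma>'" "\<sigma>' < \<sigma>" for \<sigma>'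
    proof (rule ord_geI, rule ccontr)
      fix s e' assume nz: "mps_coeff (fps_nth (F - pmono 0 0 0) s) e' \<noteq> 0"
        and "\<not> Suc (l * \<mu> \<sigma>') \<le> M * (wdot 1 e' + \<sigma>' * s)"
      then have le: "M * (wdot 1 e' + \<sigma>' * s) \<le> l * \<mu> \<sigma>'" by simp
      have "mps_coeff (fps_nth F s) e' \<noteq> 0" using nz by simp
      from key[OF this le \<sigma>'] False show False by blast
    qed
    then show ?thesis by (intro exI[of _ 0]) auto
  qed
qed

lemma pmono_nth: "mps_coeff (fps_nth (pmono b e D) s) e' = (if s = D \<and> e' = e then b else 0)"
  by (auto simp: fps_X_power_iff mps_coeff_mterm)

lemma not_strict_pmono:
  assumes "\<forall>i. M * e $ i = l * r $ i" "M * D = l * d" "strict \<sigma> l (pmono b e D)"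
  shows "b = 0"
proof (rule ccontr)
  assume "b \<noteq> 0"
  then have "Suc (l * \<mu> \<sigma>) \<le> M * (wdot 1 e + \<sigma> * D)"
    using ord_geD[OF assms(3), of D e] by (simp add: mps_coeff_mterm)
  moreover have "M * wdot 1 e = l * wdot 1 r" using assms(1) by (simp add: wdot_def sum_distrib_left)
  moreover have "M * (wdot 1 e + \<sigma> * D) = M * wdot 1 e + \<sigma> * (M * D)" "l * \<mu> \<sigma> = l * wdot 1 r + \<sigma> * (l * d)"
    by (simp_all add: \<mu>_def algebra_simps)
  ultimately show False using assms(2) by simp
qed

end

section \<open>The factorization of the first coefficient ideal\<close>

context exponents
begin

abbreviation xr :: "('k::comm_ring_1, 'n) mps fps" where
  "xr \<equiv> fps_const (mps_monom r)"

lemma xr_mult_nth: "mps_coeff (fps_nth (xr * F) s) (r + e) = mps_coeff (fps_nth F s) e"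
  by (simp add: mps_monom_eq_mterm mps_coeff_mterm_mult_add)

lemma xr_mult_nth_0: "(\<And>b. e \<noteq> r + b) \<Longrightarrow> mps_coeff (fps_nth (xr * F) s) e = 0"
  by (simp add: mps_monom_eq_mterm mps_coeff_mterm_mult_eq_0)

lemma xr_mult_support:
  assumes "mps_coeff (fps_nth (xr * F) s) e \<noteq> 0"
  shows "\<exists>b. e = r + b \<and> mps_coeff (fps_nth F s) b \<noteq> 0"
  using assms xr_mult_nth xr_mult_nth_0 by metis

lemma xr_cancel: "xr * F = xr * G \<Longrightarrow> F = G"
  by (rule fps_mps_eqI) (metis xr_mult_nth)

lemma xr_dividesI:
  assumes "\<And>s e i. mps_coeff (fps_nth F s) e \<noteq> 0 \<Longrightarrow> r $ i \<le> e $ i"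
  shows "\<exists>G. F = xr * G"
proof
  let ?G = "Abs_fps (\<lambda>s. Abs_mps (\<lambda>e. mps_coeff (fps_nth F s) (r + e)))"
  show "F = xr * ?G"
  proof (rule fps_mps_eqI)
    fix s e show "mps_coeff (fps_nth F s) e = mps_coeff (fps_nth (xr * ?G) s) e"
    proof (cases "\<exists>b. e = r + b")
      case True
      then show ?thesis by (auto simp: xr_mult_nth Abs_mps_inverse simp del: fps_mult_left_const_nth)
    next
      case False
      then have "mps_coeff (fps_nth F s) e = 0" using assms exponent_diff[of r e] by blast
      then show ?thesis using False xr_mult_nth_0[of e ?G s] by simp
    qed
  qed
qed

lemma ideal_mult_xr:
  fixes I :: "('k::comm_ring_1, 'n) mps fps set"
  assumes I: "is_ideal I"
  shows "ideal_mult (gen_ideal {xr}) I = (\<lambda>F. xr * F) ` I"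
proof
  have sub: "is_ideal ((\<lambda>F. xr * F) ` I)"
  proof (rule ideal.subspaceI)
    show "0 \<in> (\<lambda>F. xr * F) ` I" by (rule image_eqI[of _ _ 0]) (simp_all add: ideal.subspace_0[OF I])
    show "x + y \<in> (\<lambda>F. xr * F) ` I" if "x \<in> (\<lambda>F. xr * F) ` I" "y \<in> (\<lambda>F. xr * F) ` I" for x y
      using that ideal.subspace_add[OF I] by (auto simp: distrib_left[symmetric])
    show "k * x \<in> (\<lambda>F. xr * F) ` I" if x: "x \<in> (\<lambda>F. xr * F) ` I" for k x
    proof -
      obtain F where F: "x = xr * F" "F \<in> I" using x by blast
      have "k * x = xr * (k * F)" unfolding F(1) by (simp only: mult_ac)
      then show ?thesis using ideal.subspace_scale[OF I F(2)] by blast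
    qed
  qed
  show "ideal_mult (gen_ideal {xr}) I \<subseteq> (\<lambda>F. xr * F) ` I"
    unfolding ideal_mult_def
  proof (rule ideal.span_minimal[OF _ sub], safe)
    fix a b :: "('k, 'n) mps fps" assume "a \<in> gen_ideal {xr}" and b: "b \<in> I"
    then obtain k where "a = k * xr" by (auto simp: ideal.span_singleton)
    then have "a * b = xr * (k * b)" by (simp only: mult_ac)
    then show "a * b \<in> (\<lambda>F. xr * F) ` I" using ideal.subspace_scale[OF I b] by blast
  qed
  show "(\<lambda>F. xr * F) ` I \<subseteq> ideal_mult (gen_ideal {xr}) I"
    unfolding ideal_mult_def by (auto intro!: ideal.span_base)
qed

lemma factorizationD:
  assumes "factorization r d A (I :: ('k::field, 'n) mps fps set)"
  shows "is_ideal I" "A = (\<lambda>F. xr * F) ` I" "I \<subseteq> fl d" "\<not> I \<subseteq> fl (Suc d)"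
proof -
  show I: "is_ideal I" and "A = (\<lambda>F. xr * F) ` I"
    using assms ideal_mult_xr[of I] by (auto simp: factorization_def)
  have "ideal_ord I = enat d" using assms by (simp add: factorization_def)
  then show "I \<subseteq> fl d" "\<not> I \<subseteq> fl (Suc d)"
    by (simp_all flip: le_ideal_ord_iff_fps)
qed

lemma factorizationI:
  assumes "is_ideal (I :: ('k::field, 'n) mps fps set)" "A = (\<lambda>F. xr * F) ` I" "I \<subseteq> fl d" "\<not> I \<subseteq> fl (Suc d)"
  shows "factorization r d A I"
proof -
  have "enat d \<le> ideal_ord I" "\<not> enat (Suc d) \<le> ideal_ord I"
    using assms by (simp_all add: le_ideal_ord_iff_fps)
  then have "ideal_ord I = enat d" by (cases "ideal_ord I") auto
  then show ?thesis using assms by (simp add: factorization_def ideal_mult_xr)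
qed

text \<open>This is what makes the definite description in \<open>I1\<close> meaningful.\<close>

lemma I1_eq:
  assumes "factorization r d (J1 c J g) (I :: ('k::field, 'n) mps fps set)"
  shows "I1 r c d J g = I"
  unfolding I1_def
proof (rule the_equality[where P = "factorization r d (J1 c J g)", OF assms])
  fix I' assume "factorization r d (J1 c J g) I'"
  then have "(\<lambda>F. xr * F) ` I' = (\<lambda>F. xr * F) ` I" using factorizationD(2) assms by metis
  moreover have "inj (\<lambda>F :: ('k, 'n) mps fps. xr * F)" by (rule injI) (rule xr_cancel)
  ultimately show "I' = I" by (simp add: inj_image_eq_iff)
qed

lemma gen_ideal_subset: "is_ideal S \<Longrightarrow> (\<And>x. P x \<Longrightarrow> x \<in> S) \<Longrightarrow> gen_ideal {x. P x} \<subseteq> S"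
  by (rule ideal.span_minimal) auto

lemma exponent_mult: "i < c \<Longrightarrow> (fact c div (c - i)) * (c - i) = M"
  unfolding M_def by (intro dvd_div_mult_self dvd_fact) auto

lemma J1_generator:
  assumes "g \<in> fl (Suc 0)" "f \<in> J" "i < c"
  shows "fps_nth (shift g f) i ^ (fact c div (c - i)) \<in> J1 c J g"
  unfolding J1_def coeff_ideal_shift[OF assms(1)] by (rule ideal.span_base) (use assms in blast)

text \<open>The powers that generate $J_{-1}$ and the coefficients themselves satisfy equivalent conditions, because
  weights are multiplicative.\<close>

lemma adm_of_power:
  fixes F :: "('k::idom, 'n) mps fps"
  assumes i: "i < c" and N: "N * (c - i) = M"
    and F: "\<And>s e. mps_coeff (fps_nth (F ^ N) s) e \<noteq> 0 \<Longrightarrow>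
      (\<forall>j. r $ j \<le> e $ j) \<and> \<mu> \<sigma> \<le> wdot 1 e + \<sigma> * s"
  shows "adm \<sigma> (c - i) F"
  unfolding adm_def
proof (intro conjI allI)
  have Npos: "0 < N" using N M_pos by (cases N) auto
  show "wge (axis j M) 0 ((c - i) * r $ j) F" for j
  proof (rule wge_root_le[OF _ Npos])
    show "wge (axis j M) 0 (N * ((c - i) * r $ j)) (F ^ N)"
      unfolding wge_def wdot_axis mult.assoc[symmetric] N using F by simp
  qed
  show "ord_ge \<sigma> ((c - i) * \<mu> \<sigma>) F"
  proof (rule wge_root_le[OF _ Npos])
    show "ord_ge \<sigma> (N * ((c - i) * \<mu> \<sigma>)) (F ^ N)"
      by (rule ord_geI) (use F in \<open>simp add: mult.assoc[symmetric] N\<close>)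
  qed
qed

lemma power_of_adm:
  assumes i: "i < c" and N: "N * (c - i) = M" and F: "adm \<sigma> (c - i) F"
    and nz: "mps_coeff (fps_nth (F ^ N) s) e \<noteq> 0"
  shows "r $ j \<le> e $ j" "\<mu> \<sigma> \<le> wdot 1 e + \<sigma> * s"
proof -
  have "adm \<sigma> M (F ^ N)" using adm_power[OF F, of N] by (simp add: N)
  then show "r $ j \<le> e $ j" "\<mu> \<sigma> \<le> wdot 1 e + \<sigma> * s"
    using nz M_pos by (auto simp: adm_iff)
qed

lemma strict_power:
  fixes F :: "('k::idom, 'n) mps fps"
  assumes i: "i < c" and N: "N * (c - i) = M"
  shows "strict 1 (c - i) F \<longleftrightarrow> F ^ N \<in> fl (Suc (\<mu> 1))"
proof -
  have Npos: "0 < N" using N M_pos by (cases N) auto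
  have fl: "F ^ N \<in> fl (Suc n) \<longleftrightarrow> ord_ge 1 (Suc (M * n)) (F ^ N)" for n
  proof -
    have "ord_ge 1 (Suc (M * n)) (F ^ N) \<longleftrightarrow> ord_ge 1 (M * Suc n) (F ^ N)"
    proof -
      have "Suc (M * n) \<le> M * k \<longleftrightarrow> M * Suc n \<le> M * k" for k
        using M_pos by (metis Suc_le_eq mult_le_cancel1 mult_less_cancel1)
      then show ?thesis by (simp add: wge_def wdot_const flip: distrib_left)
    qed
    also have "\<dots> \<longleftrightarrow> wge 1 1 (Suc n) (F ^ N)"
      by (rule wge_scale[OF M_pos]) auto
    finally show ?thesis unfolding wge_fl_iff mult_1_right ..
  qed
  have eq: "N * ((c - i) * \<mu> 1) = M * \<mu> 1" by (simp add: mult.assoc[symmetric] N)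
  show ?thesis
  proof
    assume "strict 1 (c - i) F"
    from wge_power[OF this, of N] have "ord_ge 1 (N * Suc ((c - i) * \<mu> 1)) (F ^ N)" .
    then have "ord_ge 1 (Suc (M * \<mu> 1)) (F ^ N)"
    proof (rule wge_antimono[rotated])
      show "Suc (M * \<mu> 1) \<le> N * Suc ((c - i) * \<mu> 1)"
        using Npos unfolding eq[symmetric] mult_Suc_right by linarith
    qed
    then show "F ^ N \<in> fl (Suc (\<mu> 1))" using fl by blast
  next
    assume "F ^ N \<in> fl (Suc (\<mu> 1))"
    then have "ord_ge 1 (Suc (N * ((c - i) * \<mu> 1))) (F ^ N)" unfolding fl eq .
    then show "strict 1 (c - i) F" by (rule wge_root)
  qed
qed

lemma strict_shift: "h \<in> fl (Suc 0) \<Longrightarrow> strict 1 l (shift h F) \<longleftrightarrow> strict 1 l F"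
  by (rule ord_ge_shift) auto

text \<open>Good pairs come from members of $I_{-1}$ of large weight: the condition on the generators of
  $J_{-1} = x^r I_{-1}$ descends to the coefficients by taking roots.\<close>

lemma good_of_factorization:
  fixes J :: "('k::field, 'n) mps fps fps set"
  assumes fac: "factorization r d (J1 c J g) I" and g: "g \<in> fl (Suc 0)" and h: "h \<in> fl (Suc 0)"
    and I: "\<And>F s e. F \<in> I \<Longrightarrow> mps_coeff (fps_nth (shift h F) s) e \<noteq> 0 \<Longrightarrow> d * \<sigma> \<le> wdot 1 e + \<sigma> * s"
  shows "good J \<sigma> g h"
  unfolding good_def
proof (intro conjI ballI allI impI g h)
  fix f i assume f: "f \<in> J" and i: "i < c"
  let ?N = "fact c div (c - i) :: nat"
  note hh = filt_hom_shift[OF h]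
  obtain F where F: "fps_nth (shift g f) i ^ ?N = xr * F" "F \<in> I"
    using J1_generator[OF g f i] factorizationD(2)[OF fac] by blast
  have eq: "coef g h f i ^ ?N = xr * shift h F"
    unfolding coef_def filt_homD(10)[OF hh, symmetric] F filt_homD(8)[OF hh] shift_const[OF h] ..
  show "adm \<sigma> (c - i) (coef g h f i)"
  proof (rule adm_of_power[OF i exponent_mult[OF i]])
    fix s e assume "mps_coeff (fps_nth (coef g h f i ^ ?N) s) e \<noteq> 0"
    then obtain b where b: "e = r + b" "mps_coeff (fps_nth (shift h F) s) b \<noteq> 0"
      unfolding eq using xr_mult_support by blast
    then show "(\<forall>j. r $ j \<le> e $ j) \<and> \<mu> \<sigma> \<le> wdot 1 e + \<sigma> * s"
      using I[OF F(2) b(2)] by (simp add: \<mu>_def wdot_add)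
  qed
qed

lemma xr_mult_in_fl: "xr * F \<in> fl (wdot 1 r + n) \<longleftrightarrow> F \<in> fl n"
proof -
  have "wge 1 1 (wdot 1 r + n) (xr * F) \<longleftrightarrow> wge 1 1 n F"
  proof
    assume *: "wge 1 1 (wdot 1 r + n) (xr * F)"
    show "wge 1 1 n F" unfolding wge_def
    proof (intro allI impI)
      fix s e assume "mps_coeff (fps_nth F s) e \<noteq> 0"
      then have "mps_coeff (fps_nth (xr * F) s) (r + e) \<noteq> 0" by (simp only: xr_mult_nth not_False_eq_True)
      from wgeD[OF * this] show "n \<le> wdot 1 e + 1 * s" by (simp add: wdot_add)
    qed
  next
    assume *: "wge 1 1 n F"
    show "wge 1 1 (wdot 1 r + n) (xr * F)" unfolding wge_def
    proof (intro allI impI)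
      fix s e assume "mps_coeff (fps_nth (xr * F) s) e \<noteq> 0"
      then obtain b where "e = r + b" "mps_coeff (fps_nth F s) b \<noteq> 0" using xr_mult_support by blast
      with wgeD[OF * this(2)] show "wdot 1 r + n \<le> wdot 1 e + 1 * s" by (simp add: wdot_add)
    qed
  qed
  then show ?thesis by (simp only: wge_fl_iff)
qed

lemma factorization_not_strict:
  fixes J :: "('k::field, 'n) mps fps fps set"
  assumes fac: "factorization r d (J1 c J g) I" and g: "g \<in> fl (Suc 0)" and h: "h \<in> fl (Suc 0)"
  shows "\<exists>f\<in>J. \<exists>i<c. \<not> strict 1 (c - i) (coef g h f i)"
proof (rule ccontr)
  assume "\<not> ?thesis"
  then have *: "strict 1 (c - i) (fps_nth (shift g f) i)" if "f \<in> J" "i < c" for f i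
    using that strict_shift[OF h] unfolding coef_def by blast
  have "J1 c J g \<subseteq> fl (Suc (\<mu> 1))"
    unfolding J1_def coeff_ideal_shift[OF g]
  proof (rule gen_ideal_subset[OF is_ideal_fl])
    fix x assume "\<exists>f i. x = fps_nth (shift g f) i ^ (fact c div (c - i)) \<and> f \<in> J \<and> i < c"
    then show "x \<in> fl (Suc (\<mu> 1))" using * strict_power exponent_mult by blast
  qed
  then have "xr * F \<in> fl (wdot 1 r + Suc d)" if "F \<in> I" for F
    using that factorizationD(2)[OF fac] by (auto simp: \<mu>_def)
  then have "I \<subseteq> fl (Suc d)" using xr_mult_in_fl by blast
  then show False using factorizationD(4)[OF fac] by blast
qed

text \<open>If a pair is good for all weights, $x^r$ divides $J_{-1}$ and the quotient has weight at least $d \sigma$ for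
  all $\sigma$. Letting $\sigma$ grow shows that it is contained in the ideal of $(y - h)^d$, hence $J_{-2} = 0$. The order
  of the quotient is exactly $d$ provided that the order of $J_{-1}$ did not increase.\<close>

lemma good_all_imp_J2_zero:
  fixes J :: "('k::field, 'n) mps fps fps set"
  assumes good: "\<And>\<sigma>. 0 < \<sigma> \<Longrightarrow> good J \<sigma> g h"
    and ns: "\<exists>f\<in>J. \<exists>i<c. \<not> strict 1 (c - i) (coef g h f i)"
  shows "(g, h) \<in> coord_changes r c d J \<and> ideal_ord (J2 r c d J g h) = \<infinity>"
proof -
  note gh = goodD(1,2)[OF good[of 1, simplified]]
  note hh = filt_hom_shift[OF gh(2)]
  \<comment> \<open>The ideal of the series whose transform by $y \mapsto y + h$ has the required monomials only.\<close>
  define T where "T = {F. \<forall>s e. mps_coeff (fps_nth (shift h F) s) e \<noteq> 0 \<longrightarrow>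
    (\<forall>j. r $ j \<le> e $ j) \<and> (\<forall>\<sigma>>0. \<mu> \<sigma> \<le> wdot 1 e + \<sigma> * s)}"
  have T_iff: "F \<in> T \<longleftrightarrow> (\<forall>j. wge (axis j 1) 0 (r $ j) (shift h F)) \<and> (\<forall>\<sigma>>0. wge 1 \<sigma> (\<mu> \<sigma>) (shift h F))" for F
    by (auto simp: T_def wge_def wdot_axis)
  have T: "is_ideal T"
    by (rule ideal.subspaceI) (auto simp: T_iff filt_homD(2,4,8)[OF hh] wge_add wge_multl)
  have "J1 c J g \<subseteq> T"
    unfolding J1_def coeff_ideal_shift[OF gh(1)]
  proof (rule gen_ideal_subset[OF T])
    fix x assume "\<exists>f i. x = fps_nth (shift g f) i ^ (fact c div (c - i)) \<and> f \<in> J \<and> i < c"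
    then obtain f i where x: "x = fps_nth (shift g f) i ^ (fact c div (c - i))" "f \<in> J" "i < c" by blast
    have "shift h x = coef g h f i ^ (fact c div (c - i))" by (simp add: x coef_def filt_homD(10)[OF hh])
    then show "x \<in> T"
      using power_of_adm[OF x(3) exponent_mult[OF x(3)] goodD(3)[OF good x(2,3)]] unfolding T_def by auto
  qed
  have T_div: "\<exists>G. F = xr * G" if F: "F \<in> T" for F
  proof -
    obtain G where G: "shift h F = xr * G"
      using xr_dividesI[of "shift h F"] F unfolding T_def by auto
    have "shift (- h) (shift h F) = xr * shift (- h) G"
      unfolding G filt_homD(8)[OF filt_hom_shift[OF fl_uminus[OF gh(2)]]] shift_const[OF fl_uminus[OF gh(2)]] ..
    then show ?thesis unfolding shift_inverse(1)[OF gh(2)] by blast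
  qed
  define I where "I = {F. xr * F \<in> J1 c J g}"
  have J1_ideal: "is_ideal (J1 c J g)" unfolding J1_def coeff_ideal_def by (rule ideal.subspace_span)
  have I: "is_ideal I"
    unfolding I_def
    by (rule ideal.subspaceI) (auto simp: distrib_left mult.left_commute[of _ _ "_ :: ('k, 'n) mps fps"]
        ideal.subspace_0[OF J1_ideal] ideal.subspace_add[OF J1_ideal] ideal.subspace_scale[OF J1_ideal])
  have J1: "J1 c J g = (\<lambda>F. xr * F) ` I"
    using \<open>J1 c J g \<subseteq> T\<close> T_div by (fastforce simp: I_def)
  have I_low: "d * \<sigma> \<le> wdot 1 e + \<sigma> * s"
    if "F \<in> I" "mps_coeff (fps_nth (shift h F) s) e \<noteq> 0" "0 < \<sigma>" for F s e \<sigma>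
  proof -
    have "xr * F \<in> T" using that \<open>J1 c J g \<subseteq> T\<close> by (auto simp: I_def)
    moreover have "shift h (xr * F) = xr * shift h F"
      unfolding filt_homD(8)[OF hh] shift_const[OF gh(2)] ..
    moreover have "mps_coeff (fps_nth (xr * shift h F) s) (r + e) \<noteq> 0"
      using that(2) by (simp only: xr_mult_nth not_False_eq_True)
    ultimately have "\<mu> \<sigma> \<le> wdot 1 (r + e) + \<sigma> * s" using that(3) unfolding T_def by auto
    then show ?thesis by (simp add: \<mu>_def wdot_add)
  qed
  have fac: "factorization r d (J1 c J g) I"
  proof (rule factorizationI[OF I J1])
    show "I \<subseteq> fl d"
    proof
      fix F assume F: "F \<in> I"
      have "wge 1 1 d (shift h F)" using I_low[OF F, of _ _ 1] by (simp add: wge_def)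
      then have "shift (- h) (shift h F) \<in> fl d"
        unfolding wge_fl_iff by (rule filt_homD(3)[OF filt_hom_shift[OF fl_uminus[OF gh(2)]]])
      then show "F \<in> fl d" unfolding shift_inverse(1)[OF gh(2)] .
    qed
    show "\<not> I \<subseteq> fl (Suc d)"
    proof
      assume I_sub: "I \<subseteq> fl (Suc d)"
      have "J1 c J g \<subseteq> fl (Suc (\<mu> 1))"
      proof
        fix x assume "x \<in> J1 c J g"
        then obtain F where "x = xr * F" "F \<in> I" using J1 by blast
        then show "x \<in> fl (Suc (\<mu> 1))" using I_sub xr_mult_in_fl[of F "Suc d"] by (auto simp: \<mu>_def)
      qed
      then have "strict 1 (c - i) (coef g h f i)" if "f \<in> J" "i < c" for f i
        using that J1_generator[OF gh(1) that] strict_power[OF that(2) exponent_mult[OF that(2)]]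
          strict_shift[OF gh(2)] unfolding coef_def by blast
      then show False using ns by blast
    qed
  qed
  have vanish: "fps_nth (shift h F) s = 0" if F: "F \<in> I" and s: "s < d" for F s
  proof (rule mps_eqI, rule ccontr)
    fix e assume "mps_coeff (fps_nth (shift h F) s) e \<noteq> mps_coeff 0 e"
    then have "d * \<sigma> \<le> wdot 1 e + \<sigma> * s" if "0 < \<sigma>" for \<sigma> using I_low[OF F _ that] by simp
    from this[of "Suc (wdot 1 e)"] have "d * Suc (wdot 1 e) \<le> wdot 1 e + Suc (wdot 1 e) * s" by simp
    moreover have "Suc s * Suc (wdot 1 e) \<le> d * Suc (wdot 1 e)" using s by (intro mult_le_mono1) simp
    ultimately show False by (simp add: algebra_simps)
  qed
  have "J2 r c d J g h \<subseteq> {0}"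
    unfolding J2_def I1_eq[OF fac] coeff_ideal_shift[OF gh(2)]
  proof (rule gen_ideal_subset[OF ideal.subspace_single_0])
    fix x assume "\<exists>F s. x = fps_nth (shift h F) s ^ (fact d div (d - s)) \<and> F \<in> I \<and> s < d"
    then obtain F s where x: "x = fps_nth (shift h F) s ^ (fact d div (d - s))" "F \<in> I" "s < d" by blast
    have "(d - s) dvd fact d" using x(3) by (intro dvd_fact) auto
    then have "0 < (fact d div (d - s) :: nat)" using x(3) by (metis dvd_div_eq_0_iff fact_nonzero gr0I)
    then show "x \<in> {0}" using vanish[OF x(2,3)] x(1) by (simp add: zero_power)
  qed
  then have "J2 r c d J g h \<subseteq> fl n" for n by (auto dest: subsetD)
  then have "enat n \<le> ideal_ord (J2 r c d J g h)" for n by (simp add: le_ideal_ord_iff_mps)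
  then have "ideal_ord (J2 r c d J g h) = \<infinity>"
    by (metis Suc_ile_eq enat_ord_code(4) less_irrefl not_infinity_eq)
  moreover have "(g, h) \<in> coord_changes r c d J"
    using fac gh le_ideal_ord_iff_fps[of 1 "{g}"] le_ideal_ord_iff_mps[of 1 "{h}"]
    by (auto simp: coord_changes_def one_enat_def)
  ultimately show ?thesis by blast
qed

lemma coord_changesD:
  fixes J :: "('k::field, 'n) mps fps fps set"
  assumes "(g, h) \<in> coord_changes r c d J"
  shows "g \<in> fl (Suc 0)" "h \<in> fl (Suc 0)" "\<exists>I. factorization r d (J1 c J g) I"
  using assms le_ideal_ord_iff_fps[of 1 "{g}"] le_ideal_ord_iff_mps[of 1 "{h}"]
  by (auto simp: coord_changes_def one_enat_def)

text \<open>The converse: the order of $J_{-2}$ bounds the weight of $I_{-1}$, hence a large value of $s_{(g,h)}$ makes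
  $(g,h)$ good for large weights.\<close>

lemma good_of_J2_ord:
  fixes J :: "('k::field, 'n) mps fps fps set"
  assumes cc: "(g, h) \<in> coord_changes r c d J"
    and ord: "enat (fact d * \<sigma>) \<le> ideal_ord (J2 r c d J g h)"
  shows "good J \<sigma> g h"
proof -
  obtain I where fac: "factorization r d (J1 c J g) I" using coord_changesD(3)[OF cc] by blast
  note gh = coord_changesD(1,2)[OF cc]
  show ?thesis
  proof (rule good_of_factorization[OF fac gh])
    fix F s e assume F: "F \<in> I" and nz: "mps_coeff (fps_nth (shift h F) s) e \<noteq> 0"
    show "d * \<sigma> \<le> wdot 1 e + \<sigma> * s"
    proof (cases "s < d")
      case True
      let ?N = "fact d div (d - s) :: nat"
      have N: "?N * (d - s) = fact d" using True by (intro dvd_div_mult_self dvd_fact) auto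
      then have Npos: "0 < ?N" by (metis fact_nonzero gr0I mult_zero_left)
      have "fps_nth (shift h F) s ^ ?N \<in> J2 r c d J g h"
        unfolding J2_def I1_eq[OF fac] coeff_ideal_shift[OF gh(2)]
        by (rule ideal.span_base) (use F True in blast)
      then have "fps_nth (shift h F) s ^ ?N \<in> fl (fact d * \<sigma>)"
        using ord by (auto simp: le_ideal_ord_iff_mps)
      then have "fps_nth (shift h F) s ^ ?N \<in> fl (?N * ((d - s) * \<sigma>))"
        by (simp only: N mult.assoc[symmetric])
      then have "fps_nth (shift h F) s \<in> fl ((d - s) * \<sigma>)" by (rule fl_mps_root[OF _ Npos])
      then have "(d - s) * \<sigma> \<le> wdot 1 e" using nz by (simp add: fl_mps_iff)
      moreover have "d * \<sigma> = (d - s) * \<sigma> + s * \<sigma>" using True by (simp flip: add_mult_distrib)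
      ultimately show ?thesis by (simp add: mult.commute)
    next
      case False
      then have "d * \<sigma> \<le> s * \<sigma>" by simp
      then show ?thesis by (simp add: mult.commute trans_le_add2)
    qed
  qed
qed

lemma good_1_of_factorization:
  fixes J :: "('k::field, 'n) mps fps fps set"
  assumes fac: "factorization r d (J1 c J g) I" and g: "g \<in> fl (Suc 0)" and h: "h \<in> fl (Suc 0)"
  shows "good J 1 g h"
proof (rule good_of_factorization[OF fac g h])
  fix F s e assume F: "F \<in> I" and nz: "mps_coeff (fps_nth (shift h F) s) e \<noteq> 0"
  have "shift h F \<in> fl d" using F factorizationD(3)[OF fac] filt_homD(3)[OF filt_hom_shift[OF h]] by blast
  then have "wge 1 1 d (shift h F)" by (simp only: wge_fl_iff)
  from wgeD[OF this nz] show "d * 1 \<le> wdot 1 e + 1 * s" by simp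
qed

lemma ideal_ord_J1:
  assumes fac: "factorization r d A (I :: ('k::field, 'n) mps fps set)"
  shows "ideal_ord A = enat (\<mu> 1)"
proof -
  have "enat n \<le> ideal_ord A \<longleftrightarrow> n \<le> \<mu> 1" for n
  proof (cases "wdot 1 r \<le> n")
    case True
    then obtain k where n: "n = wdot 1 r + k" using le_iff_add by blast
    have "A \<subseteq> fl n \<longleftrightarrow> I \<subseteq> fl k"
      unfolding factorizationD(2)[OF fac] n using xr_mult_in_fl by blast
    also have "\<dots> \<longleftrightarrow> k \<le> d"
      using factorizationD(3,4)[OF fac] fl_antimono[of k d] fl_antimono[of "Suc d" k] by (meson not_less_eq_eq subset_eq)
    finally show ?thesis by (simp add: le_ideal_ord_iff_fps n \<mu>_def)
  next
    case False
    have "A \<subseteq> fl (wdot 1 r + 0)" unfolding factorizationD(2)[OF fac] xr_mult_in_fl image_subset_iff by simp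
    then have "A \<subseteq> fl n" using False fl_antimono[of n "wdot 1 r"] by auto
    then show ?thesis using False by (simp add: le_ideal_ord_iff_fps \<mu>_def)
  qed
  note * = this
  show ?thesis
  proof (cases "ideal_ord A")
    case (enat k)
    then show ?thesis using *[of k] *[of "\<mu> 1"] by simp
  next
    case infinity
    then show ?thesis using *[of "Suc (\<mu> 1)"] by simp
  qed
qed

end

section \<open>Comparing good pairs by means of a clean element\<close>

lemma of_nat_mps_fps: "(of_nat n :: ('k::comm_ring_1, 'n::finite) mps fps) = fps_const (mterm (of_nat n) 0)"
  by (simp add: of_nat_mps flip: fps_of_nat)

lemma mps_fps_frob_power:
  fixes F :: "('k::comm_ring_1, 'n::finite) mps fps"
  assumes q: "frob TYPE('k) q"
  shows "mps_coeff (fps_nth (F ^ q) s) e =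
    (if q dvd s \<and> (\<forall>i. q dvd e $ i) then mps_coeff (fps_nth F (s div q)) (\<chi> i. e $ i div q) ^ q else 0)"
proof (cases "q dvd s \<and> (\<forall>i. q dvd e $ i)")
  case True
  then have "e = (\<chi> i. q * (\<chi> i. e $ i div q) $ i)" by (simp add: vec_eq_iff)
  then have "mps_coeff (fps_nth F (s div q) ^ q) e = mps_coeff (fps_nth F (s div q)) (\<chi> i. e $ i div q) ^ q"
    using mps_frob_power(1)[OF q, of "fps_nth F (s div q)" "\<chi> i. e $ i div q"] by simp
  then show ?thesis using True by (simp add: fps_frob_power[OF frob_mps[OF q]])
next
  case False
  then show ?thesis
    using mps_frob_power(2)[OF q, of "fps_nth F (s div q)" e] by (auto simp: fps_frob_power[OF frob_mps[OF q]])
qed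

text \<open>What is used of a clean element: its coefficient of index $c$ is a unit, and $q$ is $1$ or a power of the characteristic
  for which $\binom c q$ is the first nonzero binomial coefficient after $\binom c 0$. The constant $\kappa$ is chosen
  such that $\binom c q f_c G^q$ and $(\kappa G)^q$ agree up to terms of higher order.\<close>

locale clean_element = exponents r d c for r :: "nat ^ 'n::finite" and d c :: nat +
  fixes J :: "('k::alg_closed_field, 'n) mps fps fps set" and f :: "('k, 'n) mps fps fps"
    and q :: nat and \<kappa> :: 'k
  assumes f: "f \<in> J" "fps_nth f c dvd 1"
    and q: "frob TYPE('k) q" "q dvd c" "of_nat (c choose q) \<noteq> (0 :: 'k)"
    and \<kappa>: "\<kappa> ^ q = of_nat (c choose q) * mps_coeff (fps_nth (fps_nth f c) 0) 0" "\<kappa> \<noteq> 0"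
    and good_0: "good J 1 0 0"
    and not_strict_0: "\<exists>f\<in>J. \<exists>i<c. \<not> strict 1 (c - i) (fps_nth f i)"
begin

lemma q_pos: "0 < q" using q(1) by (rule frob_pos)

lemma q_le: "q \<le> c" using q(2) c_pos by (rule dvd_imp_le)

lemmas frobB = frob_fps[OF frob_mps[OF q(1)]]

abbreviation K0 :: "('k, 'n) mps fps" where "K0 \<equiv> fps_const (mterm \<kappa> 0)"

lemma good_0_h: "h \<in> fl (Suc 0) \<Longrightarrow> good J 1 0 h"
  by (rule good_change_h[OF good_0]) auto

lemma coef_0: "coef 0 h f' i = shift h (fps_nth f' i)"
  by (simp add: coef_def)

lemma compare:
  assumes "good J \<sigma> g h" "good J \<sigma> g' h"
  shows "adm \<sigma> 1 (shift h (g' - g))" "ord_ge \<sigma> (\<mu> \<sigma>) (shift h (g' - g))"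
  using good_compare[OF assms f q_pos q_le q(3)] by (simp_all add: adm_def)

lemma binomial_0:
  assumes "c - q < i" "i < c"
  shows "of_nat (c choose i) = (0 :: 'k)"
proof -
  obtain t where t: "c = q * t" using q(2) by blast
  then have "0 < t" using c_pos by (cases t) auto
  then obtain t' where t': "t = Suc t'" by (cases t) auto
  define v where "v = i - q * t'"
  have v: "i = q * t' + v" "0 < v" "v < q" using assms t t' by (auto simp: v_def)
  have "(of_nat ((q * t + 0) choose (q * t' + v)) :: 'k) = of_nat (t choose t') * of_nat (0 choose v)"
    by (rule frob_binomial[OF q(1) q_pos v(3)])
  then show ?thesis using v by (simp add: t binomial_eq_0)
qed

text \<open>The binomial coefficients between the index $c - q$ and $c$ vanish. So the coefficients in this range do not notice
  a change of $g$ in their lowest weight, up to the first one that has this weight.\<close>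

lemma middle_change:
  assumes gg: "good J \<sigma> g h" "good J \<sigma> g' h" and \<sigma>: "0 < \<sigma>" and i: "c - q < i" "i < c"
    and st: "\<And>j. i < j \<Longrightarrow> j < c \<Longrightarrow> strict \<sigma> (c - j) (coef g h f j)"
  shows "strict \<sigma> (c - i) (coef g' h f i - coef g h f i)"
proof -
  have "(of_nat (c choose i) :: ('k, 'n) mps fps) = 0"
    using binomial_0[OF i] by (simp add: of_nat_mps_fps)
  then show ?thesis
    using coef_change[OF goodD(1)[OF gg(1)] goodD(1)[OF gg(2)] goodD(2)[OF gg(1)] i(2) compare(2)[OF gg] \<mu>_pos[OF \<sigma>] st]
    by simp
qed

lemma ord_ge_1:
  assumes "F \<in> fl (Suc 0)" "0 < \<sigma>"
  shows "ord_ge \<sigma> (Suc 0) F"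
proof (rule ord_geI)
  fix s e assume nz: "mps_coeff (fps_nth F s) e \<noteq> 0"
  have "wge 1 1 (Suc 0) F" using assms(1) by (simp only: wge_fl_iff)
  from wgeD[OF this nz] have "0 < wdot 1 e + \<sigma> * s" using assms(2) by (cases s) auto
  then show "Suc 0 \<le> M * (wdot 1 e + \<sigma> * s)" using M_pos by (metis Suc_leI nat_0_less_mult_iff)
qed

text \<open>The coefficient of index $c - q$ changes by a $q$-th power in its lowest weight.\<close>

lemma q_change:
  assumes gg: "good J \<sigma> g h" "good J \<sigma> g' h" and \<sigma>: "0 < \<sigma>"
    and st: "\<And>j. c - q < j \<Longrightarrow> j < c \<Longrightarrow> strict \<sigma> (c - j) (coef g h f j)"
  shows "strict \<sigma> q (coef g' h f (c - q) - coef g h f (c - q) - (K0 * shift h (g' - g)) ^ q)"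
proof -
  let ?G = "shift h (g' - g)" and ?C = "of_nat (c choose q) :: ('k, 'n) mps fps"
  note gh = goodD(1,2)[OF gg(1)]
  have bin: "c choose (c - q) = c choose q" "c - (c - q) = q"
    using q_le binomial_symmetric[of q c] by auto
  have 1: "strict \<sigma> q (coef g' h f (c - q) - coef g h f (c - q) - ?C * coef g h f c * ?G ^ q)"
    using coef_change[OF gh(1) goodD(1)[OF gg(2)] gh(2) _ compare(2)[OF gg] \<mu>_pos[OF \<sigma>] st, of "c - q"]
      q_pos c_pos unfolding bin by simp
  let ?a = "mps_coeff (fps_nth (fps_nth f c) 0) 0"
  have "coef g h f c - fps_const (mterm ?a 0) \<in> fl (Suc 0)"
  proof -
    have "fps_nth (shift g f) c - fps_nth f c \<in> fl (Suc 0)" by (rule coef_unit(2)[OF gh f(2)])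
    moreover have "fps_nth f c - fps_const (mterm ?a 0) \<in> fl (Suc 0)"
      by (simp add: fl_fps_1_iff fl_mps_1_iff mps_coeff_mterm)
    ultimately have "fps_nth (shift g f) c - fps_const (mterm ?a 0) \<in> fl (Suc 0)" by (rule fl_trans)
    then have "shift h (fps_nth (shift g f) c - fps_const (mterm ?a 0)) \<in> fl (Suc 0)"
      by (rule filt_homD(3)[OF filt_hom_shift[OF gh(2)]])
    then show ?thesis unfolding filt_homD(5)[OF filt_hom_shift[OF gh(2)]] shift_const[OF gh(2)] coef_def .
  qed
  then have "ord_ge \<sigma> (Suc 0) (?C * (coef g h f c - fps_const (mterm ?a 0)))"
    by (intro wge_multl ord_ge_1 \<sigma>)
  then have "ord_ge \<sigma> (Suc 0 + q * \<mu> \<sigma>) (?C * (coef g h f c - fps_const (mterm ?a 0)) * ?G ^ q)"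
    by (intro wge_mult wge_power compare(2)[OF gg])
  moreover have "K0 ^ q = ?C * fps_const (mterm ?a 0)"
    by (simp add: fps_const_power mterm_power \<kappa>(1) of_nat_mps_fps mterm_mult)
  then have "?C * (coef g h f c - fps_const (mterm ?a 0)) * ?G ^ q = ?C * coef g h f c * ?G ^ q - (K0 * ?G) ^ q"
    by (simp only: power_mult_distrib right_diff_distrib left_diff_distrib)
  ultimately have 2: "strict \<sigma> q (?C * coef g h f c * ?G ^ q - (K0 * ?G) ^ q)" by simp
  have "coef g' h f (c - q) - coef g h f (c - q) - (K0 * ?G) ^ q =
      (coef g' h f (c - q) - coef g h f (c - q) - ?C * coef g h f c * ?G ^ q) +
      (?C * coef g h f c * ?G ^ q - (K0 * ?G) ^ q)" by simp
  then show ?thesis using wge_add[OF 1 2] by (simp only:)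
qed

text \<open>A leading monomial that is visible for a weight of $y$ below $\sigma$ is visible for the weight one.\<close>

lemma strict_lift:
  assumes F: "adm \<sigma> l F" and st: "strict 1 l F" and \<sigma>: "0 < \<sigma>'" "\<sigma>' < \<sigma>"
  shows "strict \<sigma>' l F"
proof -
  obtain b e D where b: "b \<noteq> 0 \<longrightarrow> (\<forall>i. M * e $ i = l * r $ i) \<and> M * D = l * d"
    "\<And>\<sigma>'. 0 < \<sigma>' \<Longrightarrow> \<sigma>' < \<sigma> \<Longrightarrow> strict \<sigma>' l (F - pmono b e D)" using adm_lead[OF F] by blast
  have "strict 1 l (F - pmono b e D)" using b(2)[of 1] \<sigma> by simp
  then have "strict 1 l (F - (F - pmono b e D))" using st by (rule wge_diff[rotated])
  then have "strict 1 l (pmono b e D)" by simp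
  then have "b = 0" using b(1) not_strict_pmono[of e l D 1 b] by blast
  then show ?thesis using b(2)[OF \<sigma>] by simp
qed

subsection \<open>The three kinds of clean elements\<close>

text \<open>These conditions refer to the given coordinates. The next lemmas show that they persist for all good
  pairs.\<close>

definition middle :: bool where
  "middle \<longleftrightarrow> (\<exists>i. c - q < i \<and> i < c \<and> \<not> strict 1 (c - i) (fps_nth f i))"

definition high :: bool where "high \<longleftrightarrow> strict 1 q (fps_nth f (c - q))"

definition not_power :: bool where
  "not_power \<longleftrightarrow> (\<forall>\<Gamma>. \<not> strict 1 q (fps_nth f (c - q) - \<Gamma> ^ q))"

lemma middle_good:
  assumes "middle"
  obtains i where "c - q < i" "i < c"
    "\<And>g h \<sigma>. good J \<sigma> g h \<Longrightarrow> 0 < \<sigma> \<Longrightarrow> \<not> strict 1 (c - i) (coef g h f i)"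
    "\<And>g h \<sigma> j. good J \<sigma> g h \<Longrightarrow> 0 < \<sigma> \<Longrightarrow> i < j \<Longrightarrow> j < c \<Longrightarrow> strict 1 (c - j) (coef g h f j)"
proof -
  let ?P = "\<lambda>i. c - q < i \<and> i < c \<and> \<not> strict 1 (c - i) (fps_nth f i)"
  define i where "i = (GREATEST i. ?P i)"
  have "\<exists>i. ?P i" using assms by (simp add: middle_def)
  then have i: "?P i" unfolding i_def by (rule GreatestI_ex_nat[where b = c]) auto
  have max: "strict 1 (c - j) (fps_nth f j)" if "i < j" "j < c" for j
  proof (rule ccontr)
    assume "\<not> strict 1 (c - j) (fps_nth f j)"
    then have "?P j" using that i by auto
    then have "j \<le> i" unfolding i_def by (rule Greatest_le_nat[where b = c]) auto
    then show False using that by simp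
  qed
  have change: "strict 1 (c - j) (coef g h f j) \<longleftrightarrow> strict 1 (c - j) (fps_nth f j)"
    if g: "good J \<sigma> g h" "0 < \<sigma>" and j: "i \<le> j" "j < c" for g h \<sigma> j
  proof -
    have g1: "good J 1 g h" using good_antimono[OF g(1), of 1] g(2) by simp
    note h = goodD(2)[OF g1]
    have "strict 1 (c - j) (coef g h f j - coef 0 h f j)"
      using middle_change[OF good_0_h[OF h] g1, of j] max i j by (simp add: coef_0 strict_shift[OF h, simplified])
    then have "strict 1 (c - j) (coef g h f j) \<longleftrightarrow> strict 1 (c - j) (coef 0 h f j)" by (rule wge_cong)
    then show ?thesis unfolding coef_0 strict_shift[OF h] .
  qed
  show thesis
  proof (rule that[of i])
    show "c - q < i" "i < c" using i by auto
    show "\<not> strict 1 (c - i) (coef g h f i)" if "good J \<sigma> g h" "0 < \<sigma>" for g h \<sigma>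
      using change[OF that, of i] i by blast
    show "strict 1 (c - j) (coef g h f j)" if "good J \<sigma> g h" "0 < \<sigma>" "i < j" "j < c" for g h \<sigma> j
      using change[OF that(1,2), of j] max[of j] that(3,4) by simp
  qed
qed

lemma not_middle_good:
  assumes nm: "\<not> middle" and g: "good J \<sigma> g h" "0 < \<sigma>"
  shows "c - q < j \<Longrightarrow> j < c \<Longrightarrow> strict 1 (c - j) (coef g h f j)"
    and "strict 1 q (coef g h f (c - q) - shift h (fps_nth f (c - q)) - (K0 * shift h g) ^ q)"
proof -
  have g1: "good J 1 g h" using good_antimono[OF g(1), of 1] g(2) by simp
  note h = goodD(2)[OF g1]
  have st: "strict 1 (c - j) (coef 0 h f j)" if "c - q < j" "j < c" for j
    unfolding coef_0 strict_shift[OF h] using nm that by (auto simp: middle_def)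
  show "strict 1 (c - j) (coef g h f j)" if j: "c - q < j" "j < c"
  proof -
    have "strict 1 (c - j) (coef g h f j - coef 0 h f j)"
      by (rule middle_change[OF good_0_h[OF h] g1 _ j st]) (use j in auto)
    then show ?thesis using st[OF j] wge_cong by blast
  qed
  show "strict 1 q (coef g h f (c - q) - shift h (fps_nth f (c - q)) - (K0 * shift h g) ^ q)"
    using q_change[OF good_0_h[OF h] g1 _ st] by (simp add: coef_0)
qed

lemma not_power_good:
  assumes nm: "\<not> middle" and np: "not_power" and g: "good J \<sigma> g h" "0 < \<sigma>"
  shows "\<not> strict 1 q (coef g h f (c - q) - \<Gamma> ^ q)"
proof
  note h = goodD(2)[OF g(1)]
  note hh = filt_hom_shift[OF h] and hm = filt_hom_shift[OF fl_uminus[OF h]]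
  assume "strict 1 q (coef g h f (c - q) - \<Gamma> ^ q)"
  from wge_diff[OF this not_middle_good(2)[OF nm g]]
  have "strict 1 q (shift h (fps_nth f (c - q)) - (\<Gamma> ^ q - (K0 * shift h g) ^ q))"
    by (simp add: algebra_simps)
  then have "strict 1 q (shift h (fps_nth f (c - q)) - (\<Gamma> - K0 * shift h g) ^ q)"
    by (simp only: frob_diff[OF frobB])
  then have "strict 1 q (shift (- h) (shift h (fps_nth f (c - q)) - (\<Gamma> - K0 * shift h g) ^ q))"
    unfolding strict_shift[OF fl_uminus[OF h]] .
  then have "strict 1 q (fps_nth f (c - q) - shift (- h) (\<Gamma> - K0 * shift h g) ^ q)"
    by (simp only: filt_homD(5)[OF hm, of "shift h (fps_nth f (c - q))"] filt_homD(10)[OF hm] shift_inverse(1)[OF h])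
  then show False using np unfolding not_power_def by blast
qed

text \<open>The order of $J_{-1}$ does not increase under a good change. If $f_{c-q}$ is of high order, an increase would force
  $g$ to be of high order, and then the order of $J_{-1}$ would have been too large before the change.\<close>

lemma not_strict_good:
  assumes clean: "middle \<or> high \<or> not_power" and g: "good J \<sigma> g h" "0 < \<sigma>"
  shows "\<exists>f\<in>J. \<exists>i<c. \<not> strict 1 (c - i) (coef g h f i)"
proof (cases middle)
  case True
  then show ?thesis using middle_good f(1) g by metis
next
  case nm: False
  have cq: "c - q < c" using q_pos c_pos by simp
  show ?thesis
  proof (cases not_power)
    case True
    have "\<not> strict 1 q (coef g h f (c - q) - 0 ^ q)" by (rule not_power_good[OF nm True g])
    then have "\<not> strict 1 (c - (c - q)) (coef g h f (c - q))" using q_pos q_le by (simp add: zero_power)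
    then show ?thesis using f(1) cq by blast
  next
    case False
    then have hi: high using clean nm by blast
    have g1: "good J 1 g h" using good_antimono[OF g(1), of 1] g(2) by simp
    note h = goodD(2)[OF g1]
    show ?thesis
    proof (rule ccontr)
      assume "\<not> ?thesis"
      then have st: "strict 1 (c - i) (coef g h f' i)" if "f' \<in> J" "i < c" for f' i using that by blast
      have 1: "strict 1 q (coef g h f (c - q))" using st[OF f(1) cq] q_le by simp
      have 2: "strict 1 q (shift h (fps_nth f (c - q)))" using hi unfolding strict_shift[OF h] high_def .
      have "strict 1 q (coef g h f (c - q) - shift h (fps_nth f (c - q)) - (coef g h f (c - q) -
          shift h (fps_nth f (c - q)) - (K0 * shift h g) ^ q))"
        by (rule wge_diff[OF wge_diff[OF 1 2] not_middle_good(2)[OF nm g]])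
      then have "strict 1 q ((K0 * shift h g) ^ q)" by simp
      then have "ord_ge 1 (Suc (\<mu> 1)) (K0 * shift h g)" by (rule wge_root)
      then have "ord_ge 1 (Suc (\<mu> 1)) (fps_const (mterm (1 / \<kappa>) 0) * (K0 * shift h g))" by (rule wge_multl)
      moreover have "fps_const (mterm (1 / \<kappa>) 0) * (K0 * shift h g) = shift h g"
        using \<kappa>(2) by (simp add: mult.assoc[symmetric] mterm_mult mterm_1)
      ultimately have G: "ord_ge 1 (Suc (\<mu> 1)) (shift h (g - 0))" by simp
      have "strict 1 (c - i) (fps_nth f' i)" if f': "f' \<in> J" "i < c" for f' i
      proof -
        have "strict 1 (c - i) (coef g h f' i - coef 0 h f' i)"
          by (rule coef_change_strict[OF _ goodD(1)[OF g1] h f'(2) G])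
            (use goodD(4)[OF good_0_h[OF h] f'(1)] in auto)
        then have "strict 1 (c - i) (coef 0 h f' i)" using st[OF f'] wge_cong by blast
        then show ?thesis unfolding coef_0 strict_shift[OF h] .
      qed
      then show False using not_strict_0 by blast
    qed
  qed
qed

subsection \<open>Rigidity of $h$\<close>

text \<open>Let $h' - h$ have order $\sigma_0 < \sigma$. In its lowest weight for $\sigma_0$, the coefficient of index $i$ is
  $b\,x^e (y - h)^D$ by the first pair and $b' x^{e'} (y - h')^{D'}$ by the second. If a change from $g$ to $g'$ does not affect
  it, these agree. Setting $y = h$ shows that both vanish, since $D > 0$.\<close>

lemma rigid_difference:
  assumes g: "good J \<sigma> g h" and g': "good J \<sigma>' g' h'" and \<sigma>0: "0 < \<sigma>0" "\<sigma>0 < \<sigma>" "\<sigma>0 < \<sigma>'"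
    and H: "h' - h \<in> fl \<sigma>0" "h' - h \<notin> fl (Suc \<sigma>0)" and f': "f' \<in> J" and i: "i < c"
    and st: "strict \<sigma>0 (c - i) (coef g' h f' i - coef g h f' i)"
  shows "strict 1 (c - i) (coef g h f' i)"
proof -
  let ?l = "c - i" and ?H = "- (h' - h)"
  have H1: "?H \<in> fl (Suc 0)" "?H \<in> fl \<sigma>0" using fl_uminus[OF H(1)] fl_antimono[of "Suc 0" \<sigma>0] \<sigma>0(1) by auto
  note hH = filt_hom_shift[OF H1(1)]
  obtain b e D where b: "b \<noteq> 0 \<longrightarrow> (\<forall>i. M * e $ i = ?l * r $ i) \<and> M * D = ?l * d"
    "\<And>\<sigma>'. 0 < \<sigma>' \<Longrightarrow> \<sigma>' < \<sigma> \<Longrightarrow> strict \<sigma>' ?l (coef g h f' i - pmono b e D)"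
    using adm_lead[OF goodD(3)[OF g f' i]] by blast
  obtain b' e' D' where b': "b' \<noteq> 0 \<longrightarrow> (\<forall>i. M * e' $ i = ?l * r $ i) \<and> M * D' = ?l * d"
    "\<And>\<sigma>''. 0 < \<sigma>'' \<Longrightarrow> \<sigma>'' < \<sigma>' \<Longrightarrow> strict \<sigma>'' ?l (coef g' h' f' i - pmono b' e' D')"
    using adm_lead[OF goodD(3)[OF g' f' i]] by blast
  have eq: "coef g' h f' i = shift ?H (coef g' h' f' i)"
    using coef_change_h[OF goodD(2)[OF g'] goodD(2)[OF g], of g' f' i] by simp
  have pm: "shift ?H (pmono b' e' D') = fps_const (mterm b' e') * (fps_X + fps_const ?H) ^ D'"
    by (rule shift_monom[OF H1(1)])
  have "strict \<sigma>0 ?l (shift ?H (coef g' h' f' i - pmono b' e' D'))"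
    unfolding ord_ge_shift[OF H1(2) \<sigma>0(1)] by (rule b'(2)[OF \<sigma>0(1,3)])
  then have s': "strict \<sigma>0 ?l (coef g' h f' i - shift ?H (pmono b' e' D'))"
    unfolding filt_homD(5)[OF hH] eq .
  have "strict \<sigma>0 ?l (coef g' h f' i - coef g h f' i + (coef g h f' i - pmono b e D) -
      (coef g' h f' i - shift ?H (pmono b' e' D')))"
    by (rule wge_diff[OF wge_add[OF st b(2)[OF \<sigma>0(1,2)]] s'])
  then have st0: "strict \<sigma>0 ?l (shift ?H (pmono b' e' D') - pmono b e D)" by simp
  have "b' = 0"
  proof (rule ccontr)
    assume nz: "b' \<noteq> 0"
    then have e': "\<forall>i. M * e' $ i = ?l * r $ i" "M * D' = ?l * d" using b'(1) by auto
    have "fps_nth (shift ?H (pmono b' e' D') - pmono b e D) 0 = mterm b' e' * ?H ^ D'"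
    proof -
      have "fps_nth (pmono b e D) 0 = 0"
        using b(1) i d_pos by (cases "b = 0") (auto simp: fps_X_power_iff)
      then show ?thesis unfolding pm by (simp add: fps_nth_power_0)
    qed
    moreover have "mterm b' e' \<notin> fl (Suc (wdot 1 e'))" using nz by (auto simp: fl_mps_iff mps_coeff_mterm)
    moreover have "?H \<notin> fl (Suc \<sigma>0)" using H(2) fl_uminus by fastforce
    ultimately have "fps_nth (shift ?H (pmono b' e' D') - pmono b e D) 0 \<notin> fl (Suc (wdot 1 e' + D' * \<sigma>0))"
      using not_fl_mult not_fl_power by metis
    then obtain a where a: "mps_coeff (fps_nth (shift ?H (pmono b' e' D') - pmono b e D) 0) a \<noteq> 0"
      "wdot 1 a \<le> wdot 1 e' + D' * \<sigma>0" unfolding fl_mps_iff by (auto simp: not_le)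
    have "Suc (?l * \<mu> \<sigma>0) \<le> M * wdot 1 a" using ord_geD[OF st0 a(1)] by simp
    also have "\<dots> \<le> M * (wdot 1 e' + D' * \<sigma>0)" by (rule mult_le_mono2[OF a(2)])
    also have "\<dots> = M * wdot 1 e' + (M * D') * \<sigma>0" by (simp add: algebra_simps)
    also have "\<dots> = ?l * \<mu> \<sigma>0"
    proof -
      have "M * wdot 1 e' = ?l * wdot 1 r" using e'(1) by (simp add: wdot_def sum_distrib_left)
      then show ?thesis unfolding e'(2) by (simp add: \<mu>_def algebra_simps)
    qed
    finally show False by simp
  qed
  then have "shift ?H (pmono b' e' D') = 0" unfolding pm by simp
  then have "strict \<sigma>0 ?l (pmono b e D)"
    using wge_uminus[OF st0] by (simp only: diff_0 minus_minus)
  then have "b = 0" using b(1) not_strict_pmono[of e ?l D \<sigma>0 b] by blast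
  then show ?thesis using b(2)[of 1] \<sigma>0 by simp
qed

text \<open>If the coefficient of index $c - q$ is not a $q$-th power, it may change by a $q$-th power $\Gamma^q$. For
  $D' \ge q$ this does not matter: in the expansion of $x^{e'} (y + H)^{D'}$ the term of degree $D' \bmod q$ in $y$ is
  $x^{e'} H^{D' - D' \bmod q}$, and it is not cancelled by a $q$-th power.\<close>

lemma rigid_not_power:
  fixes e e' :: "nat ^ 'n" and b b' :: 'k
  assumes st: "strict \<sigma>0 q (pmono b e D - fps_const (mterm b' e') * (fps_X + fps_const H) ^ D' + \<Gamma> ^ q)"
    and b: "b \<noteq> 0 \<Longrightarrow> M * D = q * d" and b': "b' \<noteq> 0"
    and e': "\<forall>i. M * e' $ i = q * r $ i" and D': "M * D' = q * d" and large: "q \<le> D'"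
    and np: "\<not> (q dvd D' \<and> (\<forall>i. q dvd e' $ i))"
    and H: "H \<notin> fl (Suc \<sigma>0)"
  shows False
proof -
  let ?F = "pmono b e D - fps_const (mterm b' e') * (fps_X + fps_const H) ^ D' + \<Gamma> ^ q"
  define i t where "i = D' mod q" and "t = D' div q"
  have D'_eq: "D' = q * t + i" by (simp add: i_def t_def)
  have i: "i < q" by (simp add: i_def q_pos)
  have pw: "fps_nth ((fps_X + fps_const H) ^ D') i = (H ^ t) ^ q"
  proof -
    have "fps_nth ((fps_X + fps_const H) ^ D') i = of_nat (D' choose i) * H ^ (D' - i)"
      by (rule fps_nth_linear_power)
    moreover have "(of_nat ((q * t + i) choose (q * 0 + i)) :: 'k) = of_nat (t choose 0) * of_nat (i choose i)"
      by (rule frob_binomial[OF q(1) i i])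
    then have "(of_nat (D' choose i) :: ('k, 'n) mps) = 1" by (simp add: D'_eq of_nat_mps mterm_1)
    moreover have "H ^ (D' - i) = (H ^ t) ^ q" by (simp add: D'_eq mult.commute flip: power_mult)
    ultimately show ?thesis by simp
  qed
  have "fps_nth (pmono b e D) i = 0"
  proof (cases "b = 0")
    case False
    then have "D = D'" using b D' M_pos by (metis mult_cancel1 not_less_zero)
    then show ?thesis using i large by (simp add: fps_X_power_iff)
  qed simp
  then have Fi: "fps_nth ?F i = - (mterm b' e' * (H ^ t) ^ q) + fps_nth (\<Gamma> ^ q) i"
    by (simp add: pw)
  have "mterm b' e' \<notin> fl (Suc (wdot 1 e'))" using b' by (auto simp: fl_mps_iff mps_coeff_mterm)
  moreover have "(H ^ t) ^ q \<notin> fl (Suc (q * (t * \<sigma>0)))" by (intro not_fl_power H)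
  ultimately have "mterm b' e' * (H ^ t) ^ q \<notin> fl (Suc (wdot 1 e' + q * (t * \<sigma>0)))" by (rule not_fl_mult)
  then obtain a where a: "mps_coeff (mterm b' e' * (H ^ t) ^ q) a \<noteq> 0" "wdot 1 a \<le> wdot 1 e' + q * (t * \<sigma>0)"
    unfolding fl_mps_iff by (auto simp: not_le)
  obtain a1 a2 where a12: "a = a1 + a2" "mps_coeff (mterm b' e') a1 \<noteq> 0" "mps_coeff ((H ^ t) ^ q) a2 \<noteq> 0"
    using mps_mult_support[OF a(1)] by blast
  have a1: "a1 = e'" using a12(2) by (simp add: mps_coeff_mterm split: if_splits)
  have a2: "q dvd a2 $ j" for j using mps_frob_power(2)[OF q(1) a12(3)] .
  have "mps_coeff (fps_nth (\<Gamma> ^ q) i) a = 0"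
  proof (cases "q dvd i")
    case True
    then have "q dvd D'" using D'_eq by simp
    then obtain j where "\<not> q dvd e' $ j" using np by blast
    then have "\<not> q dvd a $ j" using a2[of j] by (simp add: a12(1) a1 dvd_add_left_iff)
    then show ?thesis unfolding mps_fps_frob_power[OF q(1)] by auto
  qed (simp add: mps_fps_frob_power[OF q(1)])
  then have "mps_coeff (fps_nth ?F i) a \<noteq> 0" using a(1) unfolding Fi by simp
  then have "Suc (q * \<mu> \<sigma>0) \<le> M * (wdot 1 a + \<sigma>0 * i)" by (rule ord_geD[OF st])
  also have "\<dots> \<le> M * (wdot 1 e' + q * (t * \<sigma>0) + \<sigma>0 * i)" using a(2) by simp
  also have "\<dots> = M * wdot 1 e' + (M * D') * \<sigma>0" by (simp add: D'_eq algebra_simps)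
  also have "\<dots> = q * \<mu> \<sigma>0"
  proof -
    have "M * wdot 1 e' = q * wdot 1 r" using e' by (simp add: wdot_def sum_distrib_left)
    then show ?thesis unfolding D' by (simp add: \<mu>_def algebra_simps)
  qed
  finally show False by simp
qed

text \<open>If the coefficient of index $c - q$ is of high order, the only monomial that a good pair can create in it
  is the $q$-th power of a multiple of $x^{r/c!} (y - h)^{d/c!}$. It disappears when the latter is removed
  from $g$.\<close>

lemma normalize_high:
  assumes nm: "\<not> middle" and hi: "high" and g: "good J \<sigma> g h" "1 < \<sigma>"
  shows "\<exists>g'. good J \<sigma> g' h \<and> strict 1 q (coef g' h f (c - q))"
proof -
  note h = goodD(2)[OF g(1)]
  obtain g' where g': "good J \<sigma> g' h"
    "\<And>e D. \<forall>i. M * e $ i = r $ i \<Longrightarrow> M * D = d \<Longrightarrow> mps_coeff (fps_nth (shift h g') D) e = 0"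
  proof (cases "\<exists>e D. (\<forall>i. M * e $ i = r $ i) \<and> M * D = d")
    case True
    then obtain e D where eD: "\<forall>i. M * e $ i = r $ i" "M * D = d" by blast
    define P where "P = pmono (- mps_coeff (fps_nth (shift h g) D) e) e D"
    have P1: "P \<in> fl (Suc 0)" using eD(2) d_pos
      unfolding P_def fl_fps_1_iff by (auto simp: fps_X_power_iff intro: gr0I)
    have inv: "shift h (shift (- h) P) = P" by (rule shift_inverse(2)[OF h])
    have "good J \<sigma> (g + shift (- h) P) h"
    proof (rule good_change_g[OF g(1)])
      show "shift (- h) P \<in> fl (Suc 0)" by (rule filt_homD(3)[OF filt_hom_shift[OF fl_uminus[OF h]] P1])
      show "adm \<sigma> 1 (shift h (shift (- h) P))"
        unfolding inv unfolding adm_iff P_def pmono_nth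
      proof (intro allI impI)
        fix s e'
        assume "(if s = D \<and> e' = e then - mps_coeff (fps_nth (shift h g) D) e else 0) \<noteq> 0"
        then have "s = D" "e' = e" by (auto split: if_splits)
        moreover have "M * wdot 1 e = wdot 1 r" using eD(1) by (simp add: wdot_def sum_distrib_left)
        moreover have "M * (wdot 1 e + \<sigma> * D) = M * wdot 1 e + \<sigma> * (M * D)" by (simp add: algebra_simps)
        ultimately show "(\<forall>i. 1 * r $ i \<le> M * e' $ i) \<and> 1 * \<mu> \<sigma> \<le> M * (wdot 1 e' + \<sigma> * s)"
          using eD by (simp add: \<mu>_def mult.commute)
      qed
    qed
    moreover have "mps_coeff (fps_nth (shift h (g + shift (- h) P)) D') e' = 0"
      if "\<forall>i. M * e' $ i = r $ i" "M * D' = d" for e' D'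
    proof -
      have "M * e' $ i = M * e $ i" "M * D' = M * D" for i using that eD by auto
      then have "e' = e" "D' = D" using M_pos by (simp_all add: vec_eq_iff)
      then show ?thesis
        unfolding filt_homD(2)[OF filt_hom_shift[OF h]] inv fps_add_nth mps_coeff_add unfolding P_def pmono_nth by simp
    qed
    ultimately show thesis by (rule that)
  next
    case False
    then show thesis using that[OF g(1)] by blast
  qed
  let ?F = "coef g' h f (c - q)"
  have cq: "c - q < c" "c - (c - q) = q" using q_pos q_le c_pos by auto
  have admF: "adm \<sigma> q ?F" using goodD(3)[OF g'(1) f(1) cq(1)] cq(2) by simp
  obtain b e D where b: "b \<noteq> 0 \<longrightarrow> (\<forall>i. M * e $ i = q * r $ i) \<and> M * D = q * d"
    "\<And>\<sigma>'. 0 < \<sigma>' \<Longrightarrow> \<sigma>' < \<sigma> \<Longrightarrow> strict \<sigma>' q (?F - pmono b e D)" using adm_lead[OF admF] by blast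
  have b1: "strict 1 q (?F - pmono b e D)" using b(2)[of 1] g(2) by simp
  have "b = 0"
  proof (rule ccontr)
    assume nz: "b \<noteq> 0"
    then have eD: "\<forall>i. M * e $ i = q * r $ i" "M * D = q * d" using b(1) by auto
    have hi': "strict 1 q (shift h (fps_nth f (c - q)))" using hi unfolding strict_shift[OF h] high_def .
    have \<sigma>: "0 < \<sigma>" using g(2) by simp
    have "strict 1 q (?F - shift h (fps_nth f (c - q)) - (K0 * shift h g') ^ q + shift h (fps_nth f (c - q)) -
        (?F - pmono b e D))"
      by (rule wge_diff[OF wge_add[OF not_middle_good(2)[OF nm g'(1) \<sigma>] hi'] b1])
    then have st: "strict 1 q (pmono b e D - (K0 * shift h g') ^ q)" by simp
    have "mps_coeff (fps_nth (pmono b e D - (K0 * shift h g') ^ q) D) e = 0"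
    proof (rule ccontr)
      assume "mps_coeff (fps_nth (pmono b e D - (K0 * shift h g') ^ q) D) e \<noteq> 0"
      then have "Suc (q * \<mu> 1) \<le> M * (wdot 1 e + 1 * D)" by (rule ord_geD[OF st])
      moreover have "M * wdot 1 e = q * wdot 1 r" using eD(1) by (simp add: wdot_def sum_distrib_left)
      ultimately show False using eD(2) by (simp add: \<mu>_def algebra_simps)
    qed
    then have "mps_coeff (fps_nth ((K0 * shift h g') ^ q) D) e = b"
      unfolding fps_sub_nth mps_coeff_diff pmono_nth by simp
    then have dv: "q dvd D" "\<forall>i. q dvd e $ i" and
      co: "mps_coeff (fps_nth (K0 * shift h g') (D div q)) (\<chi> i. e $ i div q) ^ q = b"
      using nz unfolding mps_fps_frob_power[OF q(1)] by (auto split: if_splits)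
    have "mps_coeff (fps_nth (shift h g') (D div q)) (\<chi> i. e $ i div q) = 0"
    proof (rule g'(2))
      have *: "M * (x div q) = y" if "M * x = q * y" "q dvd x" for x y
        using that q_pos by (auto elim!: dvdE)
      show "\<forall>i. M * (\<chi> i. e $ i div q) $ i = r $ i" using * eD(1) dv(2) by simp
      show "M * (D div q) = d" using * eD(2) dv(1) by blast
    qed
    moreover have "mps_coeff (fps_nth (K0 * shift h g') (D div q)) (0 + (\<chi> i. e $ i div q)) =
        \<kappa> * mps_coeff (fps_nth (shift h g') (D div q)) (\<chi> i. e $ i div q)"
      unfolding fps_mult_left_const_nth by (rule mps_coeff_mterm_mult_add)
    ultimately have "b = 0" using co q_pos by (simp add: zero_power)
    then show False using nz by simp
  qed
  then show ?thesis using b1 g'(1) by auto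
qed

text \<open>The cases in which $h$ is determined by the weight up to which $(g,h)$ is good. Note that $c! \le d$ means
  $D \ge q$ for the leading monomial $x^e y^D$ of the coefficient of index $c - q$.\<close>

definition rigid :: bool where
  "rigid \<longleftrightarrow> middle \<or> high \<or> (not_power \<and> M \<le> d)"

text \<open>When $f_{c-q}$ is only of high order, a good $g$ has to be normalized first.\<close>

definition normal :: "nat \<Rightarrow> ('k, 'n) mps fps \<Rightarrow> ('k, 'n) mps \<Rightarrow> bool" where
  "normal \<sigma> g h \<longleftrightarrow> good J \<sigma> g h \<and> (\<not> middle \<longrightarrow> \<not> not_power \<longrightarrow> strict 1 q (coef g h f (c - q)))"

text \<open>Suppose that $h' - h$ has order $\sigma_0 < \sigma$. Both pairs are good for the weight $\sigma_0$, at which $h$ and $h'$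
  can be interchanged. In each of the three cases some coefficient is left unchanged in its lowest weight, or
  changed by a $q$-th power only, by the passage from $g$ to $g'$, and this contradicts its two leading forms.\<close>

lemma rigid_h:
  assumes rigid: "rigid" and g: "normal \<sigma> g h" and g': "normal \<sigma>' g' h'" and \<sigma>: "0 < \<sigma>" "\<sigma> \<le> \<sigma>'"
  shows "h' - h \<in> fl \<sigma>"
proof (rule ccontr)
  assume notin: "h' - h \<notin> fl \<sigma>"
  define \<sigma>0 where "\<sigma>0 = (GREATEST n. h' - h \<in> fl n)"
  have gg: "good J \<sigma> g h" "good J \<sigma>' g' h'" using g g' by (auto simp: normal_def)
  note h = goodD(2)[OF gg(1)] goodD(2)[OF gg(2)]
  have h1: "h' - h \<in> fl (Suc 0)" using h by (simp add: fl_diff)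
  have bound: "n \<le> \<sigma>" if "h' - h \<in> fl n" for n
    using that notin fl_antimono[of \<sigma> n] by (metis nat_le_linear)
  have in0: "h' - h \<in> fl \<sigma>0" unfolding \<sigma>0_def by (rule GreatestI_nat[where P = "\<lambda>n. h' - h \<in> fl n", OF h1]) (rule bound)
  have le: "n \<le> \<sigma>0" if "h' - h \<in> fl n" for n unfolding \<sigma>0_def by (rule Greatest_le_nat[where P = "\<lambda>n. h' - h \<in> fl n", OF that]) (rule bound)
  have \<sigma>0: "0 < \<sigma>0" "\<sigma>0 < \<sigma>" "\<sigma>0 < \<sigma>'" using le[OF h1] bound[OF in0] notin in0 \<sigma> by (auto simp: le_less)
  have notin0: "h' - h \<notin> fl (Suc \<sigma>0)" using le[of "Suc \<sigma>0"] by auto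
  have g0: "good J \<sigma>0 g h" using good_antimono[OF gg(1)] \<sigma>0 by simp
  have "good J \<sigma>0 g' h'" using good_antimono[OF gg(2)] \<sigma>0 by simp
  moreover have hh': "h - h' \<in> fl \<sigma>0" using in0 fl_commute by blast
  ultimately have g0': "good J \<sigma>0 g' h" by (rule good_change_h) (rule \<sigma>0)
  have cq: "c - q < c" "c - (c - q) = q" using q_pos q_le c_pos by auto
  note diff = rigid_difference[OF gg \<sigma>0 in0 notin0]
  have \<sigma>pos: "0 < \<sigma>'" using \<sigma> by simp
  show False
  proof (cases middle)
    case True
    obtain i where i: "c - q < i" "i < c" "\<And>g h \<sigma>. good J \<sigma> g h \<Longrightarrow> 0 < \<sigma> \<Longrightarrow> \<not> strict 1 (c - i) (coef g h f i)"
      "\<And>g h \<sigma> j. good J \<sigma> g h \<Longrightarrow> 0 < \<sigma> \<Longrightarrow> i < j \<Longrightarrow> j < c \<Longrightarrow> strict 1 (c - j) (coef g h f j)"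
      using middle_good[OF True] by blast
    have "strict \<sigma>0 (c - i) (coef g' h f i - coef g h f i)"
    proof (rule middle_change[OF g0 g0' \<sigma>0(1) i(1,2)])
      fix j assume j: "i < j" "j < c"
      show "strict \<sigma>0 (c - j) (coef g h f j)"
        by (rule strict_lift[OF goodD(3)[OF gg(1) f(1) j(2)] i(4)[OF gg(1) \<sigma>(1) j] \<sigma>0(1,2)])
    qed
    from diff[OF f(1) i(2) this] show False using i(3)[OF gg(1) \<sigma>(1)] by blast
  next
    case nm: False
    have st: "strict \<sigma>0 (c - j) (coef g h f j)" if j: "c - q < j" "j < c" for j
      by (rule strict_lift[OF goodD(3)[OF gg(1) f(1) j(2)] not_middle_good(1)[OF nm gg(1) \<sigma>(1) j] \<sigma>0(1,2)])
    have adm: "adm \<sigma> q (coef g h f (c - q))" "adm \<sigma>' q (coef g' h' f (c - q))"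
      using goodD(3)[OF gg(1) f(1) cq(1)] goodD(3)[OF gg(2) f(1) cq(1)] by (simp_all add: cq(2))
    note qch = q_change[OF g0 g0' \<sigma>0(1) st]
    show False
    proof (cases not_power)
      case np: False
      then have hi: high using rigid nm by (auto simp: rigid_def)
      have n: "strict 1 q (coef g h f (c - q))" "strict 1 q (coef g' h' f (c - q))"
        using g g' nm np by (auto simp: normal_def)
      have s1: "strict \<sigma>0 q (coef g h f (c - q))" by (rule strict_lift[OF adm(1) n(1) \<sigma>0(1,2)])
      have "strict \<sigma>0 q (coef g' h' f (c - q))" by (rule strict_lift[OF adm(2) n(2) \<sigma>0(1,3)])
      then have s2: "strict \<sigma>0 q (coef g' h f (c - q))"
        unfolding coef_change_h[OF h(2) h(1)] ord_ge_shift[OF hh' \<sigma>0(1)] .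
      have G: "ord_ge \<sigma>0 (Suc (\<mu> \<sigma>0)) (shift h (g' - g))"
      proof (rule compare_coef(2)[OF goodD(1)[OF gg(1)] goodD(1)[OF gg(2)] h(1) f(2) q_pos q_le q(3)])
        show "ord_ge \<sigma>0 ((c - j) * \<mu> \<sigma>0) (coef g h f j)" if "j < c" for j
          using goodD(4)[OF g0 f(1) that] .
        show "ord_ge \<sigma>0 (q * \<mu> \<sigma>0) (coef g' h f (c - q))" using goodD(4)[OF g0' f(1) cq(1)] by (simp add: cq(2))
        show "ord_ge \<sigma>0 (Suc (q * \<mu> \<sigma>0)) (coef g' h f (c - q))" by (rule s2)
        show "ord_ge \<sigma>0 (Suc ((c - j) * \<mu> \<sigma>0)) (coef g h f j)" if j: "c - q \<le> j" "j < c" for j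
          using st[of j] s1 j cq(2) by (cases "j = c - q") auto
      qed
      obtain f' i where f': "f' \<in> J" "i < c" "\<not> strict 1 (c - i) (coef g h f' i)"
        using not_strict_good[OF _ gg(1) \<sigma>(1)] hi by blast
      have "strict \<sigma>0 (c - i) (coef g' h f' i - coef g h f' i)"
        by (rule coef_change_strict[OF goodD(1)[OF gg(1)] goodD(1)[OF gg(2)] h(1) f'(2) G])
          (rule goodD(4)[OF g0 f'(1)])
      from diff[OF f'(1,2) this] show False using f'(3) by blast
    next
      case np: True
      note npg = not_power_good[OF nm np]
      obtain b e D where b: "b \<noteq> 0 \<longrightarrow> (\<forall>i. M * e $ i = q * r $ i) \<and> M * D = q * d"
        "\<And>\<sigma>''. 0 < \<sigma>'' \<Longrightarrow> \<sigma>'' < \<sigma> \<Longrightarrow> strict \<sigma>'' q (coef g h f (c - q) - pmono b e D)"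
        using adm_lead[OF adm(1)] by blast
      obtain b' e' D' where b': "b' \<noteq> 0 \<longrightarrow> (\<forall>i. M * e' $ i = q * r $ i) \<and> M * D' = q * d"
        "\<And>\<sigma>''. 0 < \<sigma>'' \<Longrightarrow> \<sigma>'' < \<sigma>' \<Longrightarrow> strict \<sigma>'' q (coef g' h' f (c - q) - pmono b' e' D')"
        using adm_lead[OF adm(2)] by blast
      have b1': "strict 1 q (coef g' h' f (c - q) - pmono b' e' D')" using b'(2)[of 1] \<sigma>0 by simp
      have "b' \<noteq> 0"
      proof
        assume "b' = 0"
        then have "strict 1 q (coef g' h' f (c - q) - 0 ^ q)" using b1' q_pos by (simp add: zero_power)
        then show False using npg[OF gg(2) \<sigma>pos] by blast
      qed
      then have e': "\<forall>i. M * e' $ i = q * r $ i" "M * D' = q * d" using b'(1) by auto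
      have ndvd: "\<not> (q dvd D' \<and> (\<forall>i. q dvd e' $ i))"
      proof
        assume dv: "q dvd D' \<and> (\<forall>i. q dvd e' $ i)"
        obtain x where x: "x ^ q = b'" using nth_root_exists[of q b'] q_pos by blast
        have "of_nat q * (\<chi> i. e' $ i div q) = e'" using dv by (simp add: vec_eq_iff of_nat_index)
        then have "mterm x (\<chi> i. e' $ i div q) ^ q = mterm b' e'" by (simp add: mterm_power x)
        then have eqp: "pmono b' e' D' = pmono x (\<chi> i. e' $ i div q) (D' div q) ^ q"
          using dv by (simp only: power_mult_distrib fps_const_power power_mult[symmetric] dvd_div_mult_self)
        show False using b1' unfolding eqp by (rule notE[OF npg[OF gg(2) \<sigma>pos]])
      qed
      have large: "q \<le> D'"
      proof -
        have "M \<le> d" using rigid nm np q_pos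
          unfolding rigid_def
        proof -
          assume "middle \<or> high \<or> not_power \<and> M \<le> d"
          moreover have "\<not> high"
          proof
            assume high
            then have "strict 1 q (fps_nth f (c - q) - 0 ^ q)" using q_pos by (simp add: high_def zero_power)
            then show False using np unfolding not_power_def by blast
          qed
          ultimately show ?thesis using nm by blast
        qed
        then have "q * M \<le> M * D'" unfolding e'(2) by simp
        then show ?thesis using M_pos by (simp add: mult.commute)
      qed
      let ?H = "- (h' - h)"
      have H1: "?H \<in> fl (Suc 0)" "?H \<in> fl \<sigma>0" by (rule fl_uminus[OF h1], rule fl_uminus[OF in0])
      have eq: "coef g' h f (c - q) = shift ?H (coef g' h' f (c - q))"
        using coef_change_h[OF h(2) h(1), of g' f "c - q"] by simp
      have "strict \<sigma>0 q (shift ?H (coef g' h' f (c - q) - pmono b' e' D'))"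
        unfolding ord_ge_shift[OF H1(2) \<sigma>0(1)] by (rule b'(2)[OF \<sigma>0(1,3)])
      then have s': "strict \<sigma>0 q (coef g' h f (c - q) - fps_const (mterm b' e') * (fps_X + fps_const ?H) ^ D')"
        unfolding filt_homD(5)[OF filt_hom_shift[OF H1(1)]] eq shift_monom[OF H1(1)] .
      have "strict \<sigma>0 q (coef g' h f (c - q) - fps_const (mterm b' e') * (fps_X + fps_const ?H) ^ D' -
          (coef g' h f (c - q) - coef g h f (c - q) - (K0 * shift h (g' - g)) ^ q) -
          (coef g h f (c - q) - pmono b e D))"
        by (rule wge_diff[OF wge_diff[OF s' qch] b(2)[OF \<sigma>0(1,2)]])
      then have st': "strict \<sigma>0 q (pmono b e D - fps_const (mterm b' e') * (fps_X + fps_const ?H) ^ D' +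
          (K0 * shift h (g' - g)) ^ q)"
        by (simp add: algebra_simps)
      have "?H \<notin> fl (Suc \<sigma>0)" using notin0 fl_uminus by fastforce
      from rigid_not_power[OF st' _ \<open>b' \<noteq> 0\<close> e' large ndvd this] b(1) show False by blast
    qed
  qed
qed

end

section \<open>Limits of good pairs\<close>

context exponents
begin

text \<open>If $h$ converges then so does $g$, monomial by monomial: by comparison two good $g$ agree in all
  monomials $x^e (y - h)^s$ of low weight. Monomials with $c!\,s \ge d$ have large weight for every $\sigma$, so
  there any choice will do, although $g$ need not converge.\<close>

lemma good_limit:
  fixes J :: "('k::field, 'n) mps fps fps set"
  assumes f: "f \<in> J" "fps_nth f c dvd 1" and q: "0 < q" "q \<le> c" "of_nat (c choose q) \<noteq> (0 :: 'k)"
    and good: "\<And>\<sigma>. 0 < \<sigma> \<Longrightarrow> good J \<sigma> (gs \<sigma>) (hs \<sigma>)"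
    and hs: "\<And>\<sigma> \<sigma>'. 0 < \<sigma> \<Longrightarrow> \<sigma> \<le> \<sigma>' \<Longrightarrow> hs \<sigma>' - hs \<sigma> \<in> fl \<sigma>"
  shows "\<exists>g h. \<forall>\<sigma>>0. good J \<sigma> g h"
proof -
  have "hs (Suc (Suc n)) - hs (Suc n) \<in> fl n" for n
    using hs[of "Suc n" "Suc (Suc n)"] by (auto intro: fl_antimono[of n "Suc n"])
  then obtain h where "h - hs (Suc n) \<in> fl n" for n
    using Cauchy_limit[of "\<lambda>n. hs (Suc n)"] by blast
  then have h: "h - hs \<sigma> \<in> fl \<sigma>" if "0 < \<sigma>" for \<sigma>
    using fl_trans[of h "hs (Suc \<sigma>)" \<sigma> "hs \<sigma>"] hs[OF that, of "Suc \<sigma>"] by simp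
  have good_h: "good J \<sigma> (gs \<sigma>) h" if "0 < \<sigma>" for \<sigma>
    by (rule good_change_h[OF good[OF that] h[OF that] that])
  note h1 = goodD(2)[OF good_h[of 1, simplified]]
  note hh = filt_hom_shift[OF h1] and hm = filt_hom_shift[OF fl_uminus[OF h1]]
  define \<gamma> where "\<gamma> \<sigma> = shift h (gs \<sigma>)" for \<sigma>
  have \<gamma>: "adm \<sigma> 1 (\<gamma> \<sigma>' - \<gamma> \<sigma>)" if "0 < \<sigma>" "\<sigma> \<le> \<sigma>'" for \<sigma> \<sigma>'
  proof -
    have "good J \<sigma> (gs \<sigma>') h" using good_antimono[OF good_h[of \<sigma>'], of \<sigma>] that by simp
    from good_compare[OF good_h[OF that(1)] this f q]
    show ?thesis by (simp only: \<gamma>_def filt_homD(5)[OF hh])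
  qed
  \<comment> \<open>A monomial $x^e y^s$ with $c!\,s < d$ has weight below $\mu$ at the weight $k(e)$ of $y$.\<close>
  define k where "k e = Suc (M * wdot 1 e)" for e :: "nat ^ 'n"
  define \<Gamma> where "\<Gamma> = Abs_fps (\<lambda>s. Abs_mps (\<lambda>e. mps_coeff (fps_nth (\<gamma> (k e)) s) e))"
  have \<Gamma>_nth: "mps_coeff (fps_nth \<Gamma> s) e = mps_coeff (fps_nth (\<gamma> (k e)) s) e" for s e
    by (simp add: \<Gamma>_def Abs_mps_inverse)
  have limit: "adm \<sigma> 1 (\<Gamma> - \<gamma> \<sigma>)" if \<sigma>: "0 < \<sigma>" for \<sigma>
    unfolding adm_iff
  proof (intro allI impI)
    fix s e assume "mps_coeff (fps_nth (\<Gamma> - \<gamma> \<sigma>) s) e \<noteq> 0"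
    then have nz: "mps_coeff (fps_nth (\<gamma> (k e)) s) e \<noteq> mps_coeff (fps_nth (\<gamma> \<sigma>) s) e"
      by (simp add: \<Gamma>_nth)
    show "(\<forall>i. 1 * r $ i \<le> M * e $ i) \<and> 1 * \<mu> \<sigma> \<le> M * (wdot 1 e + \<sigma> * s)"
    proof (cases "\<sigma> \<le> k e")
      case True
      then show ?thesis using \<gamma>[OF \<sigma> True] nz unfolding adm_iff by (simp add: right_minus_eq)
    next
      case False
      then have "adm (k e) 1 (\<gamma> \<sigma> - \<gamma> (k e))" by (intro \<gamma>) (auto simp: k_def)
      moreover have "mps_coeff (fps_nth (\<gamma> \<sigma> - \<gamma> (k e)) s) e \<noteq> 0" using nz by simp
      ultimately have r: "\<And>i. r $ i \<le> M * e $ i" and w: "\<mu> (k e) \<le> M * (wdot 1 e + k e * s)"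
        unfolding adm_iff by auto
      have r': "wdot 1 r \<le> M * wdot 1 e"
        unfolding wdot_def sum_distrib_left using r by (intro sum_mono) simp
      have "d \<le> M * s"
      proof (rule ccontr)
        assume "\<not> d \<le> M * s"
        then have "Suc (M * s) * k e \<le> d * k e" by (intro mult_le_mono1) simp
        then show False using w by (simp add: \<mu>_def k_def algebra_simps)
      qed
      then have "d * \<sigma> \<le> M * s * \<sigma>" by (rule mult_le_mono1)
      moreover have "M * (wdot 1 e + \<sigma> * s) = M * wdot 1 e + M * s * \<sigma>" by (simp add: algebra_simps)
      ultimately have "\<mu> \<sigma> \<le> M * (wdot 1 e + \<sigma> * s)" using r' unfolding \<mu>_def by linarith
      then show ?thesis using r by simp
    qed
  qed
  define g where "g = shift (- h) \<Gamma>"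
  have \<Theta>g: "shift h g = \<Gamma>" unfolding g_def by (rule shift_inverse(2)[OF h1])
  have "\<gamma> (Suc 0) \<in> fl (Suc 0)"
    unfolding \<gamma>_def by (rule filt_homD(3)[OF hh goodD(1)[OF good_h]]) simp
  then have "\<Gamma> \<in> fl (Suc 0)"
    unfolding fl_fps_1_iff fl_mps_1_iff \<Gamma>_nth by (simp add: k_def)
  then have g1: "g \<in> fl (Suc 0)" unfolding g_def by (rule filt_homD(3)[OF hm])
  have "good J \<sigma> g h" if \<sigma>: "0 < \<sigma>" for \<sigma>
  proof -
    have "good J \<sigma> (gs \<sigma> + (g - gs \<sigma>)) h"
    proof (rule good_change_g[OF good_h[OF \<sigma>]])
      show "g - gs \<sigma> \<in> fl (Suc 0)" by (intro fl_diff g1 goodD(1)[OF good_h[OF \<sigma>]])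
      show "adm \<sigma> 1 (shift h (g - gs \<sigma>))"
        unfolding filt_homD(5)[OF hh] \<Theta>g using limit[OF \<sigma>] by (simp only: \<gamma>_def)
    qed
    then show ?thesis by simp
  qed
  then show ?thesis by blast
qed

end

context clean_element
begin

lemma rigid_limit:
  assumes rigid: "rigid" and good: "\<And>\<sigma>. 0 < \<sigma> \<Longrightarrow> \<exists>g h. good J \<sigma> g h"
  shows "\<exists>g h. \<forall>\<sigma>>0. good J \<sigma> g h"
proof -
  have ex: "\<exists>g h. normal (Suc \<sigma>) g h" if "0 < \<sigma>" for \<sigma>
  proof -
    obtain g h where g: "good J (Suc \<sigma>) g h" using good[of "Suc \<sigma>"] by auto
    show ?thesis
    proof (cases "\<not> middle \<and> \<not> not_power")
      case True
      then have "high" using rigid by (simp add: rigid_def)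
      then show ?thesis using normalize_high[OF _ _ g] True that unfolding normal_def by auto
    next
      case False
      then show ?thesis using g unfolding normal_def by blast
    qed
  qed
  then obtain gs hs where gh: "\<And>\<sigma>. 0 < \<sigma> \<Longrightarrow> normal (Suc \<sigma>) (gs \<sigma>) (hs \<sigma>)" by metis
  show ?thesis
  proof (rule good_limit[OF f q_pos q_le q(3)])
    show "good J \<sigma> (gs \<sigma>) (hs \<sigma>)" if "0 < \<sigma>" for \<sigma>
      using gh[OF that] good_antimono[of J "Suc \<sigma>" "gs \<sigma>" "hs \<sigma>" \<sigma>] by (simp add: normal_def)
    show "hs \<sigma>' - hs \<sigma> \<in> fl \<sigma>" if "0 < \<sigma>" "\<sigma> \<le> \<sigma>'" for \<sigma> \<sigma>'
    proof (rule fl_antimono)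
      show "hs \<sigma>' - hs \<sigma> \<in> fl (Suc \<sigma>)" by (rule rigid_h[OF rigid gh gh]) (use that in auto)
    qed simp
  qed
qed

end

section \<open>Series in one variable over a power series ring\<close>

lemma fl_common: "a - c \<in> fl n \<Longrightarrow> b - c \<in> fl n \<Longrightarrow> a - b \<in> fl n"
  using fl_diff[of "a - c" n "b - c"] by simp

text \<open>A series that takes small values at sufficiently many points, no two of which are close, is
  itself small, by Newton interpolation: each division by $X - G_i$ costs at most the order $m$
  of the differences but gains one degree.\<close>

lemma interpolation:
  fixes \<Phi> :: "('k::idom, 'n::finite) mps fps" and G :: "'i \<Rightarrow> ('k, 'n) mps"
  assumes "finite X" "\<And>i. i \<in> X \<Longrightarrow> G i \<in> fl (Suc 0)"
    and "\<And>i j. i \<in> X \<Longrightarrow> j \<in> X \<Longrightarrow> i \<noteq> j \<Longrightarrow> G i - G j \<notin> fl (Suc m)"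
    and "\<And>i. i \<in> X \<Longrightarrow> fps_nth (shift (G i) \<Phi>) 0 \<in> fl (B + card X * m)"
  shows "\<Phi> \<in> fl (min (card X) B)"
  using assms
proof (induction X arbitrary: \<Phi> rule: finite_induct)
  case (insert k X)
  let ?n = "card X"
  have G: "G k \<in> fl (Suc 0)" using insert by simp
  let ?c = "fps_nth (shift (G k) \<Phi>) 0"
  have c: "?c \<in> fl (B + Suc ?n * m)" using insert.prems(3)[of k] insert.hyps by simp
  obtain \<Psi> where \<Psi>: "\<Phi> = fps_const ?c + (fps_X - fps_const (G k)) * \<Psi>"
    using fps_linear_division[OF G] by blast
  have "\<Psi> \<in> fl (min ?n B)"
  proof (rule insert.IH)
    fix l assume l: "l \<in> X"
    have Gl: "G l \<in> fl (Suc 0)" using insert.prems(1)[of l] l by simp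
    note h = filt_hom_eval[OF Gl]
    have "fps_nth (shift (G l) \<Phi>) 0 = ?c + (G l - G k) * fps_nth (shift (G l) \<Psi>) 0"
      by (subst \<Psi>) (simp add: filt_homD(2,5,8)[OF h] shift_const[OF Gl] shift_X[OF Gl])
    then have "(G l - G k) * fps_nth (shift (G l) \<Psi>) 0 = fps_nth (shift (G l) \<Phi>) 0 - ?c" by simp
    moreover have "fps_nth (shift (G l) \<Phi>) 0 \<in> fl (B + Suc ?n * m)"
      using insert.prems(3)[of l] insert.hyps l by simp
    ultimately have prod: "(G l - G k) * fps_nth (shift (G l) \<Psi>) 0 \<in> fl (B + Suc ?n * m)"
      using c by (simp add: fl_diff)
    show "fps_nth (shift (G l) \<Psi>) 0 \<in> fl (B + ?n * m)"
    proof (cases "B + ?n * m")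
      case (Suc b)
      show ?thesis
      proof (rule ccontr)
        assume "fps_nth (shift (G l) \<Psi>) 0 \<notin> fl (B + ?n * m)"
        moreover have "G l - G k \<notin> fl (Suc m)" using insert.prems(2)[of l k] insert.hyps l by auto
        ultimately have "(G l - G k) * fps_nth (shift (G l) \<Psi>) 0 \<notin> fl (Suc (m + b))"
          using not_fl_mult Suc by metis
        moreover have "Suc (m + b) = B + Suc ?n * m" using Suc by simp
        ultimately show False using prod by simp
      qed
    next
      case 0 then show ?thesis by (simp only: fl_0 UNIV_I)
    qed
  qed (use insert.prems in auto)
  moreover have "fps_X - fps_const (G k) \<in> fl (Suc 0)" using G by (intro fl_diff) auto
  ultimately have "(fps_X - fps_const (G k)) * \<Psi> \<in> fl (Suc 0 + min ?n B)" by (intro fl_mult)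
  then have 1: "(fps_X - fps_const (G k)) * \<Psi> \<in> fl (min (Suc ?n) B)"
    by (rule fl_antimono[rotated]) simp
  have 2: "fps_const ?c \<in> fl (min (Suc ?n) B)"
    using fl_antimono[OF _ c, of "min (Suc ?n) B"] by simp
  have "fps_const ?c + (fps_X - fps_const (G k)) * \<Psi> \<in> fl (min (Suc ?n) B)" by (rule fl_add[OF 2 1])
  then show ?case using insert.hyps by (simp add: \<Psi>[symmetric])
qed simp

text \<open>This plays the part of the identity theorem: a series is determined by its values at infinitely many
  separated points, even if the values are known only approximately, with growing precision.\<close>

lemma identity_principle:
  fixes \<Phi> :: "('k::idom, 'n::finite) mps fps" and G :: "nat \<Rightarrow> ('k, 'n) mps"
  assumes X: "infinite X" and G: "\<And>i. i \<in> X \<Longrightarrow> G i \<in> fl (Suc 0)"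
    and sep: "\<And>i j. i \<in> X \<Longrightarrow> j \<in> X \<Longrightarrow> i \<noteq> j \<Longrightarrow> G i - G j \<notin> fl (Suc m)"
    and small: "\<And>B. \<exists>k0. \<forall>k\<in>X. k0 \<le> k \<longrightarrow> fps_nth (shift (G k) \<Phi>) 0 \<in> fl B"
  shows "\<Phi> = 0"
proof (rule fl_separated)
  fix n
  obtain k0 where k0: "\<And>k. k \<in> X \<Longrightarrow> k0 \<le> k \<Longrightarrow> fps_nth (shift (G k) \<Phi>) 0 \<in> fl (n + n * m)"
    using small by blast
  have "infinite (X - {..<k0})" using X by simp
  then obtain Y where Y: "Y \<subseteq> X - {..<k0}" "finite Y" "card Y = n"
    by (meson infinite_arbitrarily_large)
  have "\<Phi> \<in> fl (min (card Y) n)"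
    by (rule interpolation[OF Y(2), of G m]) (use Y k0 G sep in \<open>auto simp: subset_eq\<close>)
  then show "\<Phi> \<in> fl n" using Y by simp
qed

text \<open>If there is no infinite separated subfamily, the pigeonhole principle applies to the residue classes modulo
  each \<open>fl n\<close>, and a diagonal sequence is Cauchy.\<close>

lemma Cauchy_or_separated:
  fixes a :: "nat \<Rightarrow> 'a::filt_ring"
  obtains (Cauchy) \<kappa> where "\<And>l. l \<le> \<kappa> l" "\<And>l l'. l \<le> l' \<Longrightarrow> a (\<kappa> l') - a (\<kappa> l) \<in> fl l"
  | (separated) m X where "infinite X" "\<And>i j. i \<in> X \<Longrightarrow> j \<in> X \<Longrightarrow> i \<noteq> j \<Longrightarrow> a i - a j \<notin> fl (Suc m)"
proof (cases "\<exists>m X. infinite X \<and> (\<forall>i\<in>X. \<forall>j\<in>X. i \<noteq> j \<longrightarrow> a i - a j \<notin> fl (Suc m))")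
  case True
  then show thesis using separated by blast
next
  case False
  have step: "\<exists>Z\<subseteq>Y. infinite Z \<and> (\<forall>i\<in>Z. \<forall>j\<in>Z. a i - a j \<in> fl n)" if Y: "infinite Y" for Y n
  proof -
    define cl where "cl i = {x. x - a i \<in> fl n}" for i
    have cl: "cl i = cl j \<longleftrightarrow> a i - a j \<in> fl n" for i j
    proof
      assume "cl i = cl j"
      moreover have "a i \<in> cl i" by (simp add: cl_def)
      ultimately show "a i - a j \<in> fl n" by (simp add: cl_def)
    next
      assume *: "a i - a j \<in> fl n"
      show "cl i = cl j" unfolding cl_def using fl_trans[OF _ *] fl_trans[OF _ iffD1[OF fl_commute *]] by blast
    qed
    have "finite (cl ` Y)"
    proof (rule ccontr)
      assume inf: "infinite (cl ` Y)"
      obtain Z where Z: "Z \<subseteq> Y" "inj_on cl Z" "cl ` Y = cl ` Z" by (rule subset_image_inj[THEN iffD1, elim_format, of "cl ` Y" cl Y]) auto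
      have "infinite Z" using inf Z(3) by auto
      moreover have "a i - a j \<notin> fl (Suc n)" if "i \<in> Z" "j \<in> Z" "i \<noteq> j" for i j
        using that Z(2) cl[of i j] fl_Suc by (auto dest: inj_onD)
      ultimately show False using False by blast
    qed
    from pigeonhole_infinite[OF Y this] obtain i0 where "infinite {i \<in> Y. cl i = cl i0}" by blast
    then show ?thesis by (intro exI[of _ "{i \<in> Y. cl i = cl i0}"]) (auto simp: cl[symmetric])
  qed
  have "\<exists>Z. \<forall>n. (infinite (Z n) \<and> (\<forall>i\<in>Z n. \<forall>j\<in>Z n. a i - a j \<in> fl n)) \<and> Z (Suc n) \<subseteq> Z n"
  proof (rule dependent_nat_choice)
    show "\<exists>Z. infinite Z \<and> (\<forall>i\<in>Z. \<forall>j\<in>Z. a i - a j \<in> fl 0)" by (rule exI[of _ UNIV]) simp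
    fix Z n assume "infinite Z \<and> (\<forall>i\<in>Z. \<forall>j\<in>Z. a i - a j \<in> fl n)"
    then show "\<exists>Z'. (infinite Z' \<and> (\<forall>i\<in>Z'. \<forall>j\<in>Z'. a i - a j \<in> fl (Suc n))) \<and> Z' \<subseteq> Z"
      using step[of Z "Suc n"] by (elim conjE) meson
  qed
  then obtain Z where Z0: "\<forall>n. (infinite (Z n) \<and> (\<forall>i\<in>Z n. \<forall>j\<in>Z n. a i - a j \<in> fl n)) \<and> Z (Suc n) \<subseteq> Z n"
    by (rule exE)
  have Z: "infinite (Z n)" "i \<in> Z n \<Longrightarrow> j \<in> Z n \<Longrightarrow> a i - a j \<in> fl n" "Z (Suc n) \<subseteq> Z n" for n i j
    using spec[OF Z0, of n] by simp_all
  have "\<exists>k. k \<in> Z l \<and> l \<le> k" for l using Z(1)[of l] by (metis infinite_nat_iff_unbounded_le)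
  then obtain \<kappa> where \<kappa>: "\<And>l. \<kappa> l \<in> Z l" "\<And>l. l \<le> \<kappa> l" by metis
  have "Z l' \<subseteq> Z l" if "l \<le> l'" for l l' using that Z(3) by (rule lift_Suc_antimono_le[rotated])
  then have "a (\<kappa> l') - a (\<kappa> l) \<in> fl l" if "l \<le> l'" for l l'
    using Z(2)[of "\<kappa> l'" l "\<kappa> l"] \<kappa>(1)[of l] \<kappa>(1)[of l'] that by (simp add: subset_iff)
  then show thesis using \<kappa>(2) by (rule Cauchy[rotated])
qed

subsection \<open>Decomposition of a series according to residues of the exponents\<close>

definition sect :: "nat \<Rightarrow> nat \<Rightarrow> 'a::comm_ring_1 fps \<Rightarrow> 'a fps" where
  "sect N \<rho> F = Abs_fps (\<lambda>n. fps_nth F (\<rho> + N * n))"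

lemma sect_nth [simp]: "fps_nth (sect N \<rho> F) n = fps_nth F (\<rho> + N * n)"
  by (simp add: sect_def)

lemma sum_residues:
  fixes N T :: nat
  shows "(\<Sum>j<N * T. f j) = (\<Sum>\<rho><N. \<Sum>n<T. f (\<rho> + N * n) :: 'a::comm_monoid_add)"
proof (induction T)
  case (Suc T)
  have "(\<Sum>j<N * Suc T. f j) = (\<Sum>j<N * T. f j) + (\<Sum>\<rho><N. f (\<rho> + N * T))"
  proof -
    have "{..<N * Suc T} = {..<N * T} \<union> (\<lambda>\<rho>. \<rho> + N * T) ` {..<N}"
    proof -
      have "x \<in> (\<lambda>\<rho>. \<rho> + N * T) ` {..<N}" if "x < N * Suc T" "\<not> x < N * T" for x
        by (rule image_eqI[of _ _ "x - N * T"]) (use that in auto)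
      then show ?thesis by auto
    qed
    moreover have "(\<Sum>j\<in>(\<lambda>\<rho>. \<rho> + N * T) ` {..<N}. f j) = (\<Sum>\<rho><N. f (\<rho> + N * T))"
      by (subst sum.reindex) (auto simp: inj_on_def)
    moreover have "(\<Sum>j\<in>{..<N * T} \<union> (\<lambda>\<rho>. \<rho> + N * T) ` {..<N}. f j) =
        (\<Sum>j<N * T. f j) + (\<Sum>j\<in>(\<lambda>\<rho>. \<rho> + N * T) ` {..<N}. f j)"
      by (rule sum.union_disjoint) auto
    ultimately show ?thesis by simp
  qed
  then show ?case by (simp add: Suc sum.distrib)
qed simp

text \<open>When the $N$-th power is additive, the first $N$ Taylor coefficients at $H$ depend only on the values of
  the residue parts at $H^N$, through a unitriangular matrix.\<close>

lemma shift_residues: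
  fixes F :: "'a::filt_ring fps"
  assumes N: "frob TYPE('a) N" and H: "H \<in> fl (Suc 0)" and v: "v < N"
  shows "fps_nth (shift H F) v =
    (\<Sum>\<rho><N. of_nat (\<rho> choose v) * H ^ (\<rho> - v) * fps_nth (shift (H ^ N) (sect N \<rho> F)) 0)"
proof (rule fl_eqI)
  fix T
  have Npos: "0 < N" by (rule frob_pos[OF N])
  have HN: "H ^ N \<in> fl (Suc 0)"
    using fl_power[OF H, of N] Npos by (auto intro: fl_antimono[of "Suc 0" "N * Suc 0"])
  let ?T = "T + v"
  have 1: "fps_nth (shift H F) v - (\<Sum>j<N * ?T. of_nat (j choose v) * fps_nth F j * H ^ (j - v)) \<in> fl T"
    by (rule fl_antimono[OF _ shift_Taylor_mod[OF H]]) (use Npos in \<open>cases N, auto\<close>)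
  have trm: "of_nat ((\<rho> + N * n) choose v) * fps_nth F (\<rho> + N * n) * H ^ (\<rho> + N * n - v) =
      of_nat (\<rho> choose v) * H ^ (\<rho> - v) * (fps_nth F (\<rho> + N * n) * (H ^ N) ^ n)" if "\<rho> < N" for \<rho> n
  proof (cases "v \<le> \<rho>")
    case True
    have "(of_nat ((N * n + \<rho>) choose (N * 0 + v)) :: 'a) = of_nat (n choose 0) * of_nat (\<rho> choose v)"
      by (rule frob_binomial[OF N that v])
    then have b: "(of_nat ((\<rho> + N * n) choose v) :: 'a) = of_nat (\<rho> choose v)" by (simp add: add.commute)
    have "H ^ (\<rho> + N * n - v) = H ^ (\<rho> - v) * (H ^ N) ^ n" using True by (simp flip: power_mult power_add)
    then show ?thesis unfolding b by (simp only: mult_ac)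
  next
    case False
    have "(of_nat ((N * n + \<rho>) choose (N * 0 + v)) :: 'a) = of_nat (n choose 0) * of_nat (\<rho> choose v)"
      by (rule frob_binomial[OF N that v])
    then have "(of_nat ((\<rho> + N * n) choose v) :: 'a) = 0" using False by (simp add: add.commute binomial_eq_0)
    then show ?thesis using False by (simp add: binomial_eq_0)
  qed
  have 2: "(\<Sum>j<N * ?T. of_nat (j choose v) * fps_nth F j * H ^ (j - v)) =
      (\<Sum>\<rho><N. of_nat (\<rho> choose v) * H ^ (\<rho> - v) * (\<Sum>n<?T. fps_nth F (\<rho> + N * n) * (H ^ N) ^ n))"
    unfolding sum_residues sum_distrib_left by (intro sum.cong refl trm) auto
  have 3: "fps_nth (shift (H ^ N) (sect N \<rho> F)) 0 - (\<Sum>n<?T. fps_nth F (\<rho> + N * n) * (H ^ N) ^ n) \<in> fl T" for \<rho>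
    using shift_Taylor_mod[OF HN, of "sect N \<rho> F" 0 ?T] by (auto intro: fl_antimono[of T ?T])
  have "(\<Sum>\<rho><N. of_nat (\<rho> choose v) * H ^ (\<rho> - v) * fps_nth (shift (H ^ N) (sect N \<rho> F)) 0) -
      (\<Sum>\<rho><N. of_nat (\<rho> choose v) * H ^ (\<rho> - v) * (\<Sum>n<?T. fps_nth F (\<rho> + N * n) * (H ^ N) ^ n)) \<in> fl T"
    unfolding sum_subtractf[symmetric] right_diff_distrib[symmetric] by (intro fl_sum fl_multl 3)
  then show "fps_nth (shift H F) v -
      (\<Sum>\<rho><N. of_nat (\<rho> choose v) * H ^ (\<rho> - v) * fps_nth (shift (H ^ N) (sect N \<rho> F)) 0) \<in> fl T"
    using 1 unfolding 2 by (rule fl_common[rotated])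
qed

text \<open>Back substitution in the unitriangular system.\<close>

lemma residues_small:
  fixes F :: "'a::filt_ring fps"
  assumes N: "frob TYPE('a) N" and H: "H \<in> fl (Suc 0)"
    and F: "\<And>v. v < N \<Longrightarrow> fps_nth (shift H F) v \<in> fl k" and \<rho>: "\<rho> < N"
  shows "fps_nth (shift (H ^ N) (sect N \<rho> F)) 0 \<in> fl k"
  using \<rho>
proof (induction "N - \<rho>" arbitrary: \<rho> rule: less_induct)
  case less
  let ?E = "\<lambda>\<rho>. fps_nth (shift (H ^ N) (sect N \<rho> F)) 0"
  have "fps_nth (shift H F) \<rho> = (\<Sum>\<rho>'<N. of_nat (\<rho>' choose \<rho>) * H ^ (\<rho>' - \<rho>) * ?E \<rho>')"
    by (rule shift_residues[OF N H less.prems])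
  also have "\<dots> = ?E \<rho> + (\<Sum>\<rho>'\<in>{..<N} - {\<rho>}. of_nat (\<rho>' choose \<rho>) * H ^ (\<rho>' - \<rho>) * ?E \<rho>')"
    using less.prems by (subst sum.remove[of _ \<rho>]) auto
  finally have eq: "?E \<rho> = fps_nth (shift H F) \<rho> -
      (\<Sum>\<rho>'\<in>{..<N} - {\<rho>}. of_nat (\<rho>' choose \<rho>) * H ^ (\<rho>' - \<rho>) * ?E \<rho>')" by simp
  have "of_nat (\<rho>' choose \<rho>) * H ^ (\<rho>' - \<rho>) * ?E \<rho>' \<in> fl k" if "\<rho>' \<in> {..<N} - {\<rho>}" for \<rho>'
  proof (cases "\<rho> < \<rho>'")
    case True
    then show ?thesis using less.hyps[of \<rho>'] that by (intro fl_multl) auto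
  next
    case False
    then show ?thesis using that by (simp add: binomial_eq_0)
  qed
  then show ?case unfolding eq by (intro fl_diff F less.prems fl_sum)
qed

section \<open>Extracting roots of the variables\<close>

text \<open>The substitution $x_i \mapsto x_i^m$.\<close>

definition ramify :: "nat \<Rightarrow> ('k::comm_ring_1, 'n::finite) mps \<Rightarrow> ('k, 'n) mps" where
  "ramify m f = Abs_mps (\<lambda>e. if \<forall>i. m dvd e $ i then mps_coeff f (\<chi> i. e $ i div m) else 0)"

lemma ramify_coeff:
  "mps_coeff (ramify m f) e = (if \<forall>i. m dvd e $ i then mps_coeff f (\<chi> i. e $ i div m) else 0)"
  by (simp add: ramify_def Abs_mps_inverse)

lemma ramify_coeff_mult: "0 < m \<Longrightarrow> mps_coeff (ramify m f) (\<chi> i. m * e $ i) = mps_coeff f e"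
  by (simp add: ramify_coeff)

lemma ramify_support:
  assumes "mps_coeff (ramify m f) e \<noteq> 0"
  shows "\<exists>a. e = (\<chi> i. m * a $ i) \<and> mps_coeff f a \<noteq> 0"
proof -
  have "\<forall>i. m dvd e $ i" "mps_coeff f (\<chi> i. e $ i div m) \<noteq> 0"
    using assms by (auto simp: ramify_coeff split: if_splits)
  then show ?thesis by (intro exI[of _ "\<chi> i. e $ i div m"]) (simp add: vec_eq_iff)
qed

lemma wdot_mult: "wdot 1 (\<chi> i. m * a $ i) = m * wdot 1 a"
  by (simp add: wdot_def sum_distrib_left)

lemma filt_hom_ramify:
  assumes m: "0 < m"
  shows "filt_hom (ramify m :: ('k::comm_ring_1, 'n::finite) mps \<Rightarrow> ('k, 'n) mps)"
proof (rule filt_hom_mpsI)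
  have "ramify m f \<in> fl n" if f: "f \<in> fl n" for f :: "('k, 'n) mps" and n
    unfolding fl_mps_iff
  proof (intro allI impI)
    fix e assume "mps_coeff (ramify m f) e \<noteq> 0"
    then obtain a where a: "e = (\<chi> i. m * a $ i)" "mps_coeff f a \<noteq> 0" using ramify_support by blast
    have "n \<le> wdot 1 a" using f a(2) by (simp add: fl_mps_iff)
    also have "\<dots> \<le> wdot 1 e" using m by (simp add: a(1) wdot_mult)
    finally show "n \<le> wdot 1 e" .
  qed
  moreover have "ramify m (f + g) = ramify m f + ramify m g" for f g :: "('k, 'n) mps"
    by (rule mps_eqI) (simp add: ramify_coeff)
  ultimately show "filt_map (ramify m :: ('k, 'n) mps \<Rightarrow> ('k, 'n) mps)" by (simp add: filt_map_def)
  have trm: "ramify m (mterm k a) = mterm k (\<chi> i. m * a $ i)" for k :: 'k and a :: "nat ^ 'n"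
  proof (rule mps_eqI)
    fix e
    show "mps_coeff (ramify m (mterm k a)) e = mps_coeff (mterm k (\<chi> i. m * a $ i)) e"
    proof (cases "e = (\<chi> i. m * a $ i)")
      case True
      then show ?thesis using m by (simp add: ramify_coeff_mult mps_coeff_mterm)
    next
      case False
      then have "mps_coeff (ramify m (mterm k a)) e = 0"
        using ramify_support[of m "mterm k a" e] by (auto simp: mps_coeff_mterm split: if_splits) metis
      then show ?thesis using False by (simp add: mps_coeff_mterm)
    qed
  qed
  show "ramify m (mterm k a * mterm l b) = ramify m (mterm k a) * ramify m (mterm l b)" for k l :: 'k and a b :: "nat ^ 'n"
  proof -
    have "(\<chi> i. m * (a + b) $ i) = (\<chi> i. m * a $ i) + (\<chi> i. m * b $ i)" by (simp add: vec_eq_iff algebra_simps)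
    then show ?thesis by (simp add: mterm_mult trm)
  qed
  have "(\<chi> i. m * (0 :: nat ^ 'n) $ i) = 0" by (simp add: vec_eq_iff)
  then show "ramify m (1 :: ('k, 'n) mps) = 1" using trm[of 1 0] by (simp add: mterm_1)
qed

lemma ramify_fl:
  assumes "ramify m f \<in> fl (m * n)" "0 < m"
  shows "f \<in> fl n"
  unfolding fl_mps_iff
proof (intro allI impI)
  fix e assume "mps_coeff f e \<noteq> 0"
  then have "mps_coeff (ramify m f) (\<chi> i. m * e $ i) \<noteq> 0" using assms(2) by (simp add: ramify_coeff_mult)
  then have "m * n \<le> wdot 1 (\<chi> i. m * e $ i)" using assms(1) by (simp add: fl_mps_iff)
  then show "n \<le> wdot 1 e" using assms(2) by (simp add: wdot_mult)
qed

lemma ramify_eq_0: "0 < m \<Longrightarrow> ramify m f = 0 \<Longrightarrow> f = 0"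
  by (rule mps_eqI) (metis ramify_coeff_mult mps_coeff_zero)

text \<open>Division by $x^s$, where non-divisible monomials are dropped.\<close>

definition mdiv :: "nat ^ 'n \<Rightarrow> ('k::comm_ring_1, 'n::finite) mps \<Rightarrow> ('k, 'n) mps" where
  "mdiv s f = Abs_mps (\<lambda>e. mps_coeff f (s + e))"

lemma mdiv_coeff: "mps_coeff (mdiv s f) e = mps_coeff f (s + e)"
  by (simp add: mdiv_def Abs_mps_inverse)

lemma mdiv_mult:
  assumes "\<And>e i. mps_coeff f e \<noteq> 0 \<Longrightarrow> s $ i \<le> e $ i"
  shows "mterm 1 s * mdiv s f = f"
proof (rule mps_eqI)
  fix e show "mps_coeff (mterm 1 s * mdiv s f) e = mps_coeff f e"
  proof (cases "\<exists>b. e = s + b")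
    case True then show ?thesis by (auto simp: mps_coeff_mterm_mult_add mdiv_coeff)
  next
    case False
    then have "mps_coeff f e = 0" using assms exponent_diff[of s e] by blast
    then show ?thesis using False by (simp add: mps_coeff_mterm_mult_eq_0)
  qed
qed

lemma mterm_mult_fl: "mterm 1 s * f \<in> fl (wdot 1 s + n) \<Longrightarrow> f \<in> fl n"
  unfolding fl_mps_iff by (metis mps_coeff_mterm_mult_add mult_1 wdot_add nat_add_left_cancel_le)

lemma mterm_cancel: "mterm 1 s * f = mterm 1 s * g \<Longrightarrow> f = (g :: ('k::comm_ring_1, 'n::finite) mps)"
  by (rule mps_eqI) (metis mps_coeff_mterm_mult_add mult_1)

subsection \<open>Exchanging $y$ and $z$\<close>

text \<open>The coefficient of $y^s$, as a series in $z$.\<close>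

definition zrow :: "nat \<Rightarrow> 'a::comm_ring_1 fps fps \<Rightarrow> 'a fps" where
  "zrow s f = Abs_fps (\<lambda>j. fps_nth (fps_nth f j) s)"

lemma zrow_nth [simp]: "fps_nth (zrow s f) j = fps_nth (fps_nth f j) s"
  by (simp add: zrow_def)

lemma shift_zrow:
  fixes f :: "'a::filt_ring fps fps"
  assumes G: "G \<in> fl (Suc 0)"
  shows "fps_nth (fps_nth (shift (fps_const G) f) i) s = fps_nth (shift G (zrow s f)) i"
proof (rule fl_eqI)
  fix T
  let ?L = "T + i + s"
  have G': "fps_const G \<in> fl (Suc 0)" using G by simp
  have "fps_nth (shift (fps_const G) f) i -
      (\<Sum>j<?L. of_nat (j choose i) * fps_nth f j * fps_const G ^ (j - i)) \<in> fl (?L - i)"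
    by (rule shift_Taylor_mod[OF G'])
  from fl_fpsD[OF this, of s]
  have 1: "fps_nth (fps_nth (shift (fps_const G) f) i) s -
      fps_nth (\<Sum>j<?L. of_nat (j choose i) * fps_nth f j * fps_const G ^ (j - i)) s \<in> fl T" by simp
  have 2: "fps_nth (\<Sum>j<?L. of_nat (j choose i) * fps_nth f j * fps_const G ^ (j - i)) s =
      (\<Sum>j<?L. of_nat (j choose i) * fps_nth (zrow s f) j * G ^ (j - i))"
    by (simp add: fps_sum_nth fps_const_power flip: fps_of_nat)
  have 3: "fps_nth (shift G (zrow s f)) i -
      (\<Sum>j<?L. of_nat (j choose i) * fps_nth (zrow s f) j * G ^ (j - i)) \<in> fl T"
    by (rule fl_antimono[OF _ shift_Taylor_mod[OF G]]) simp
  show "fps_nth (fps_nth (shift (fps_const G) f) i) s - fps_nth (shift G (zrow s f)) i \<in> fl T"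
    by (rule fl_common[OF 1[unfolded 2] 3])
qed

section \<open>The flexible case\<close>

text \<open>The remaining case: the coefficient of index $c - q$ has a leading monomial $x^{e_0} y^D$ with $D < q$, that
  is, $d < c!$. Write $D = N t$ with $N$ a power of the characteristic exponent and $t \ne 0$ in $K$. Both $G_k$ and $H_k$
  are series in $x$, good for a weight tending to infinity with $k$. The sequence $H_k$ need not converge: a change of $G_k$ can be
  compensated by a change of $H_k$.\<close>

locale flexible = exponents r d c for r :: "nat ^ 'n::finite" and d c :: nat +
  fixes J :: "('k::alg_closed_field, 'n) mps fps fps set" and f0 :: "('k, 'n) mps fps fps"
    and q N t D :: nat and e0 :: "nat ^ 'n" and Gs Hs :: "nat \<Rightarrow> ('k, 'n) mps"
  assumes f0: "f0 \<in> J" "fps_nth f0 c dvd 1"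
    and q: "0 < q" "q \<le> c" "of_nat (c choose q) \<noteq> (0 :: 'k)"
    and N: "frob TYPE('k) N" and D: "D = N * t" "of_nat t \<noteq> (0 :: 'k)" "D < q" "M * D = q * d"
    and e0: "\<And>i. M * e0 $ i = q * r $ i" "mps_coeff (fps_nth (fps_nth f0 (c - q)) D) e0 \<noteq> 0"
    and good_0: "good J 2 0 0"
    and good_k: "\<And>k. good J (Suc k) (fps_const (Gs k)) (Hs k)"
begin

lemma N_pos: "0 < N" using N by (rule frob_pos)

lemma t_pos: "0 < t" using D(2) by (cases t) auto

lemma N_le_D: "N \<le> D" using t_pos by (simp add: D(1))

lemma d_less_M: "d < M"
proof -
  have "M * D < M * q" using D(3) M_pos by simp
  then show ?thesis unfolding D(4) by (simp add: mult.commute)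
qed

lemmas frobA = frob_mps[OF N]

abbreviation \<phi> :: "('k, 'n) mps \<Rightarrow> ('k, 'n) mps" where "\<phi> \<equiv> ramify M"

lemmas \<phi>_hom = filt_hom_ramify[OF M_pos, where 'k = 'k and 'n = 'n]

text \<open>The monomial $x^{kr}$.\<close>

definition \<xi> :: "nat \<Rightarrow> ('k, 'n) mps" where "\<xi> k = mterm 1 (\<chi> i. k * r $ i)"

lemma \<xi>_add: "\<xi> (j + k) = \<xi> j * \<xi> k"
proof -
  have "(\<chi> i. j * r $ i) + (\<chi> i. k * r $ i) = (\<chi> i. (j + k) * r $ i)" by (simp add: vec_eq_iff algebra_simps)
  then show ?thesis by (simp add: \<xi>_def mterm_mult)
qed

lemma \<xi>_0: "\<xi> 0 = 1"
proof -
  have "(\<chi> i. 0 * r $ i) = 0" by (simp add: vec_eq_iff)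
  then show ?thesis by (simp add: \<xi>_def mterm_1)
qed

lemma \<xi>_power: "\<xi> 1 ^ k = \<xi> k"
  by (induction k) (simp_all add: \<xi>_0 flip: \<xi>_add)

lemma \<xi>_fl: "\<xi> k \<in> fl (k * wdot 1 r)"
  unfolding \<xi>_def by (rule mterm_in_fl) (simp add: wdot_mult)

lemma \<xi>_mult_fl: "\<xi> k * x \<in> fl (k * wdot 1 r + n) \<Longrightarrow> x \<in> fl n"
  unfolding \<xi>_def using mterm_mult_fl[of "\<chi> i. k * r $ i" x n] unfolding wdot_mult .

text \<open>The transform $\tilde f(x, z, y) = x^{-cr} f(x^{c!}, x^r z, y)$ as a power series in $y$ over $K[[x]][[z]]$.
  It turns the conditions on $x^r$ into integrality.\<close>

definition ft :: "('k, 'n) mps fps fps \<Rightarrow> nat \<Rightarrow> ('k, 'n) mps fps" where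
  "ft f s = Abs_fps (\<lambda>j. mdiv (\<chi> i. c * r $ i) (\<phi> (fps_nth (fps_nth f j) s) * \<xi> j))"

definition F :: "('k, 'n) mps fps fps \<Rightarrow> ('k, 'n) mps fps fps" where
  "F f = Abs_fps (ft f)"

lemma F_nth [simp]: "fps_nth (F f) s = ft f s" by (simp add: F_def)

lemma ft_nth:
  assumes f: "f \<in> J"
  shows "\<xi> c * fps_nth (ft f s) j = \<phi> (fps_nth (fps_nth f j) s) * \<xi> j"
proof -
  have "(\<chi> i. c * r $ i) $ i \<le> e $ i"
    if nz: "mps_coeff (\<phi> (fps_nth (fps_nth f j) s) * \<xi> j) e \<noteq> 0" for e i
  proof -
    obtain a b where ab: "e = a + b" "mps_coeff (\<phi> (fps_nth (fps_nth f j) s)) a \<noteq> 0" "mps_coeff (\<xi> j) b \<noteq> 0"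
      using mps_mult_support[OF nz] by blast
    have b: "b = (\<chi> i. j * r $ i)" using ab(3) by (simp add: \<xi>_def mps_coeff_mterm split: if_splits)
    obtain a' where a': "a = (\<chi> i. M * a' $ i)" "mps_coeff (fps_nth (fps_nth f j) s) a' \<noteq> 0"
      using ramify_support[OF ab(2)] by blast
    show ?thesis
    proof (cases "j < c")
      case True
      have "adm 2 (c - j) (fps_nth f j)" using goodD(3)[OF good_0 f True] by (simp add: coef_def)
      then have "(c - j) * r $ i \<le> M * a' $ i" using a'(2) by (simp add: adm_iff)
      moreover have "c * r $ i = (c - j) * r $ i + j * r $ i" using True by (simp flip: add_mult_distrib)
      ultimately show ?thesis by (simp add: ab(1) a'(1) b)
    next
      case False
      then have "c * r $ i \<le> j * r $ i" by simp
      then show ?thesis by (simp add: ab(1) b trans_le_add2)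
    qed
  qed
  from mdiv_mult[of "\<phi> (fps_nth (fps_nth f j) s) * \<xi> j", OF this] show ?thesis by (simp add: ft_def \<xi>_def)
qed

text \<open>If $x^r G' = G(x^{c!})$, then the Taylor coefficients of $\tilde f$ at $z = G'$ and those of $f$ at $z = G$
  correspond to each other.\<close>

lemma transform_row:
  assumes f: "f \<in> J" and G: "G \<in> fl (Suc 0)" "G' \<in> fl (Suc 0)" "\<xi> 1 * G' = \<phi> G"
  shows "\<xi> c * fps_nth (shift G' (ft f s)) i = \<xi> i * \<phi> (fps_nth (shift G (zrow s f)) i)"
proof (rule fl_eqI)
  fix T
  let ?L = "T + i"
  let ?A = "\<Sum>j<?L. of_nat (j choose i) * fps_nth (ft f s) j * G' ^ (j - i)"
  let ?B = "\<Sum>j<?L. of_nat (j choose i) * fps_nth (zrow s f) j * G ^ (j - i)"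
  have 1: "\<xi> c * fps_nth (shift G' (ft f s)) i - \<xi> c * ?A \<in> fl T"
    unfolding right_diff_distrib[symmetric]
    by (rule fl_multl, rule fl_antimono[OF _ shift_Taylor_mod[OF G(2)]]) simp
  have "fps_nth (shift G (zrow s f)) i - ?B \<in> fl T"
    by (rule fl_antimono[OF _ shift_Taylor_mod[OF G(1)]]) simp
  then have "\<phi> (fps_nth (shift G (zrow s f)) i - ?B) \<in> fl T" by (rule filt_homD(3)[OF \<phi>_hom])
  then have 2: "\<xi> i * \<phi> (fps_nth (shift G (zrow s f)) i) - \<xi> i * \<phi> ?B \<in> fl T"
    unfolding filt_homD(5)[OF \<phi>_hom] right_diff_distrib[symmetric] by (rule fl_multl)
  have "\<xi> c * (of_nat (j choose i) * fps_nth (ft f s) j * G' ^ (j - i)) =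
      \<xi> i * \<phi> (of_nat (j choose i) * fps_nth (zrow s f) j * G ^ (j - i))" for j
  proof (cases "i \<le> j")
    case True
    have "\<xi> c * (of_nat (j choose i) * fps_nth (ft f s) j * G' ^ (j - i)) =
        of_nat (j choose i) * (\<xi> c * fps_nth (ft f s) j) * G' ^ (j - i)" by (simp only: mult_ac)
    also have "\<dots> = of_nat (j choose i) * \<phi> (fps_nth (fps_nth f j) s) * (\<xi> i * \<xi> (j - i)) * G' ^ (j - i)"
      using True unfolding ft_nth[OF f] \<xi>_add[symmetric] by (simp add: mult_ac)
    also have "\<dots> = \<xi> i * (of_nat (j choose i) * \<phi> (fps_nth (fps_nth f j) s) * (\<xi> 1 * G') ^ (j - i))"
      unfolding power_mult_distrib \<xi>_power by (simp only: mult_ac)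
    also have "\<dots> = \<xi> i * \<phi> (of_nat (j choose i) * fps_nth (zrow s f) j * G ^ (j - i))"
      unfolding G(3) by (simp only: filt_homD(8,10,11)[OF \<phi>_hom] zrow_nth)
    finally show ?thesis .
  next
    case False
    then show ?thesis by (simp add: binomial_eq_0 filt_homD(4)[OF \<phi>_hom])
  qed
  then have "\<xi> c * ?A = \<xi> i * \<phi> ?B"
    unfolding filt_homD(7)[OF \<phi>_hom] sum_distrib_left by (intro sum.cong refl)
  then show "\<xi> c * fps_nth (shift G' (ft f s)) i - \<xi> i * \<phi> (fps_nth (shift G (zrow s f)) i) \<in> fl T"
    using fl_common[OF 1] 2 by simp
qed

text \<open>The coefficient of index $i$ of $\tilde f$ with respect to $z - G$, as a series in $y$.\<close>

definition E :: "('k, 'n) mps fps fps \<Rightarrow> nat \<Rightarrow> ('k, 'n) mps \<Rightarrow> ('k, 'n) mps fps" where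
  "E f i G = fmap (\<lambda>\<psi>. fps_nth (shift G \<psi>) i) (F f)"

lemma transform_coef:
  assumes f: "f \<in> J" and G: "G \<in> fl (Suc 0)" "G' \<in> fl (Suc 0)" "\<xi> 1 * G' = \<phi> G" and H: "H \<in> fl (Suc 0)"
  shows "\<xi> c * fps_nth (shift (\<phi> H) (E f i G')) s = \<xi> i * \<phi> (fps_nth (coef (fps_const G) H f i) s)"
proof -
  have \<phi>H: "\<phi> H \<in> fl (Suc 0)" by (rule filt_homD(3)[OF \<phi>_hom H])
  note hH = filt_hom_shift[OF \<phi>H]
  have "fps_const (\<xi> c) * E f i G' = fps_const (\<xi> i) * fmap \<phi> (fps_nth (shift (fps_const G) f) i)"
    by (rule fps_ext) (simp add: E_def transform_row[OF f G] shift_zrow[OF G(1)])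
  then have "shift (\<phi> H) (fps_const (\<xi> c) * E f i G') =
      shift (\<phi> H) (fps_const (\<xi> i) * fmap \<phi> (fps_nth (shift (fps_const G) f) i))" by simp
  then have "fps_const (\<xi> c) * shift (\<phi> H) (E f i G') =
      fps_const (\<xi> i) * shift (\<phi> H) (fmap \<phi> (fps_nth (shift (fps_const G) f) i))"
    by (simp only: filt_homD(8)[OF hH] shift_const[OF \<phi>H])
  also have "shift (\<phi> H) (fmap \<phi> (fps_nth (shift (fps_const G) f) i)) = fmap \<phi> (coef (fps_const G) H f i)"
    unfolding coef_def fmap_shift[OF \<phi>_hom H] ..
  finally have "fps_nth (fps_const (\<xi> c) * shift (\<phi> H) (E f i G')) s =
      fps_nth (fps_const (\<xi> i) * fmap \<phi> (coef (fps_const G) H f i)) s" by simp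
  then show ?thesis by simp
qed

subsection \<open>The approximate solutions after the transformation\<close>

text \<open>By comparison with the pair $(0, H_k)$, $x^r$ divides $G_k(x^{c!})$.\<close>

definition Gt :: "nat \<Rightarrow> ('k, 'n) mps" where "Gt k = mdiv r (\<phi> (Gs k))"

lemma Gs_Hs: "Gs k \<in> fl (Suc 0)" "Hs k \<in> fl (Suc 0)"
  using goodD(1,2)[OF good_k[of k]] by simp_all

lemma Gs_adm: "adm 1 1 (fps_const (Gs k))"
proof -
  have 1: "good J 1 0 (Hs k)"
    by (rule good_change_h[OF good_antimono[OF good_0, of 1]]) (use Gs_Hs in auto)
  have 2: "good J 1 (fps_const (Gs k)) (Hs k)" using good_antimono[OF good_k[of k], of 1] by simp
  show ?thesis using good_compare[OF 1 2 f0 q] Gs_Hs by simp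
qed

lemma Gs_support:
  assumes "mps_coeff (Gs k) a \<noteq> 0"
  shows "r $ i \<le> M * a $ i" "wdot 1 r + d \<le> M * wdot 1 a"
proof -
  have "mps_coeff (fps_nth (fps_const (Gs k)) 0) a \<noteq> 0" using assms by simp
  then have "(\<forall>i. 1 * r $ i \<le> M * a $ i) \<and> 1 * \<mu> 1 \<le> M * (wdot 1 a + 1 * 0)"
    using Gs_adm[of k] unfolding adm_iff by blast
  then show "r $ i \<le> M * a $ i" "wdot 1 r + d \<le> M * wdot 1 a" by (simp_all add: \<mu>_def)
qed

lemma Gt_mult: "\<xi> 1 * Gt k = \<phi> (Gs k)"
proof -
  have "mterm 1 r * mdiv r (\<phi> (Gs k)) = \<phi> (Gs k)"
    by (rule mdiv_mult) (use ramify_support Gs_support(1) in fastforce)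
  moreover have "(\<chi> i. 1 * r $ i) = r" by (simp add: vec_eq_iff)
  ultimately show ?thesis by (simp add: \<xi>_def Gt_def)
qed

lemma Gt_fl: "Gt k \<in> fl (Suc 0)"
  unfolding fl_mps_iff
proof (intro allI impI)
  fix e assume "mps_coeff (Gt k) e \<noteq> 0"
  then have "mps_coeff (\<phi> (Gs k)) (r + e) \<noteq> 0" by (simp add: Gt_def mdiv_coeff)
  then obtain a where a: "r + e = (\<chi> i. M * a $ i)" "mps_coeff (Gs k) a \<noteq> 0" using ramify_support by blast
  have "wdot 1 (r + e) = M * wdot 1 a" unfolding a(1) by (rule wdot_mult)
  then show "Suc 0 \<le> wdot 1 e" using Gs_support(2)[OF a(2)] d_pos by (simp add: wdot_add)
qed

abbreviation ev :: "nat \<Rightarrow> ('k, 'n) mps fps \<Rightarrow> ('k, 'n) mps" where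
  "ev k \<psi> \<equiv> fps_nth (shift (Gt k) \<psi>) 0"

lemmas ev_hom = filt_hom_eval[OF Gt_fl]

abbreviation Hk :: "nat \<Rightarrow> ('k, 'n) mps" where "Hk k \<equiv> \<phi> (Hs k)"

lemma Hk_fl: "Hk k \<in> fl (Suc 0)" by (rule filt_homD(3)[OF \<phi>_hom Gs_Hs(2)])

text \<open>The coefficient of $(y - H_k)^s$ is small for $s$ in this range because $(G_k, H_k)$ is good for a large weight.\<close>

lemma E_small:
  assumes f: "f \<in> J" and i: "i < c" and s: "M * s < (c - i) * d"
  shows "fps_nth (shift (Hk k) (E f i (Gt k))) s \<in> fl k"
proof -
  let ?V = "fps_nth (coef (fps_const (Gs k)) (Hs k) f i) s"
  have "\<phi> ?V \<in> fl ((c - i) * wdot 1 r + k)"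
    unfolding fl_mps_iff
  proof (intro allI impI)
    fix e assume "mps_coeff (\<phi> ?V) e \<noteq> 0"
    then obtain a where a: "e = (\<chi> i. M * a $ i)" "mps_coeff ?V a \<noteq> 0" using ramify_support by blast
    have "adm k (c - i) (coef (fps_const (Gs k)) (Hs k) f i)"
      by (rule adm_antimono[OF goodD(3)[OF good_k f i]]) simp
    then have "(c - i) * \<mu> k \<le> M * (wdot 1 a + k * s)" using a(2) unfolding adm_iff by blast
    then have le: "(c - i) * wdot 1 r + (c - i) * d * k \<le> M * wdot 1 a + M * s * k"
      by (simp add: \<mu>_def algebra_simps)
    have "Suc (M * s) * k \<le> (c - i) * d * k" using s by (intro mult_le_mono1) simp
    then have "M * s * k + k \<le> (c - i) * d * k" by simp
    with le have "(c - i) * wdot 1 r + k \<le> M * wdot 1 a" by linarith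
    then show "(c - i) * wdot 1 r + k \<le> wdot 1 e" unfolding a(1) wdot_mult .
  qed
  then have "\<xi> i * \<phi> ?V \<in> fl (i * wdot 1 r + ((c - i) * wdot 1 r + k))" by (rule fl_mult[OF \<xi>_fl])
  moreover have "i * wdot 1 r + ((c - i) * wdot 1 r + k) = c * wdot 1 r + k"
    using i by (simp flip: add_mult_distrib add.assoc)
  ultimately have "\<xi> c * fps_nth (shift (Hk k) (E f i (Gt k))) s \<in> fl (c * wdot 1 r + k)"
    unfolding transform_coef[OF f Gs_Hs(1) Gt_fl Gt_mult Gs_Hs(2)] by simp
  then show ?thesis by (rule \<xi>_mult_fl)
qed

subsection \<open>The equation for $H$\<close>

text \<open>The Hasse derivative of $\tilde f_0$ of order $c - q$ in $z$ and $D - N$ in $y$. It is regular of order $N$ in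
  $y$, since its coefficient at $y^N$ is $\binom{D}{N}$ times a unit.\<close>

definition Q :: "('k, 'n) mps fps fps" where
  "Q = hasse (D - N) (fmap (hasse (c - q)) (F f0))"

lemma Q_nth: "fps_nth Q s = of_nat ((s + (D - N)) choose (D - N)) * hasse (c - q) (ft f0 (s + (D - N)))"
  by (simp add: Q_def)

lemma fmap_Q:
  assumes G: "G \<in> fl (Suc 0)"
  shows "fmap (\<lambda>\<psi>. fps_nth (shift G \<psi>) u) Q =
    hasse (D - N) (fps_const (of_nat ((u + (c - q)) choose (c - q))) * E f0 (u + (c - q)) G)"
proof (rule fps_ext)
  fix s
  note h = filt_hom_shift[OF G]
  show "fps_nth (fmap (\<lambda>\<psi>. fps_nth (shift G \<psi>) u) Q) s =
    fps_nth (hasse (D - N) (fps_const (of_nat ((u + (c - q)) choose (c - q))) * E f0 (u + (c - q)) G)) s"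
    by (simp add: Q_nth filt_homD(8,11)[OF h] E_def shift_hasse[OF G] mult_ac)
qed

text \<open>The Taylor coefficients of $Q$ at $(\tilde G_k, H_k)$ of low order are small. For $v = 0$ the range of $u$ includes
  all $u < N$ because $d < c!$.\<close>

lemma Q_small:
  assumes uv: "u * d + M * v < M * N"
  shows "fps_nth (shift (Hk k) (fmap (\<lambda>\<psi>. fps_nth (shift (Gt k) \<psi>) u) Q)) v \<in> fl k"
proof -
  note h = filt_hom_shift[OF Hk_fl[of k]]
  have MN: "M * N \<le> q * d" using N_le_D D(4) by (metis mult_le_mono2)
  then have "u * d < q * d" using uv by linarith
  then have u: "u < q" using d_pos by simp
  let ?i = "u + (c - q)" and ?s = "v + (D - N)"
  have i: "?i < c" "c - ?i = q - u" using u q by auto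
  have "M * ?s < (c - ?i) * d"
  proof -
    have "M * (D - N) + M * N = q * d"
      using N_le_D by (simp add: D(4)[symmetric] flip: distrib_left)
    moreover have "(q - u) * d + u * d = q * d" using u by (simp flip: add_mult_distrib)
    ultimately show ?thesis using uv unfolding i(2) distrib_left by linarith
  qed
  then have "fps_nth (shift (Hk k) (E f0 ?i (Gt k))) ?s \<in> fl k" by (rule E_small[OF f0(1) i(1)])
  moreover have "fps_nth (shift (Hk k) (fmap (\<lambda>\<psi>. fps_nth (shift (Gt k) \<psi>) u) Q)) v =
      of_nat (?s choose (D - N)) * (of_nat (?i choose (c - q)) * fps_nth (shift (Hk k) (E f0 ?i (Gt k))) ?s)"
    unfolding fmap_Q[OF Gt_fl] shift_hasse[OF Hk_fl] filt_homD(8)[OF h] shift_const[OF Hk_fl] by simp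
  ultimately show ?thesis by (simp only: fl_multl)
qed

lemma ft_lead: "mps_coeff (fps_nth (ft f0 s) (c - q)) 0 = mps_coeff (fps_nth (fps_nth f0 (c - q)) s) e0"
proof -
  have "(\<chi> i. c * r $ i) + 0 = (\<chi> i. (c - q) * r $ i) + (\<chi> i. M * e0 $ i)"
    using q(2) by (simp add: vec_eq_iff e0(1) flip: add_mult_distrib)
  then have "mps_coeff (fps_nth (ft f0 s) (c - q)) 0 =
      mps_coeff (\<xi> (c - q) * \<phi> (fps_nth (fps_nth f0 (c - q)) s)) ((\<chi> i. (c - q) * r $ i) + (\<chi> i. M * e0 $ i))"
    by (simp add: ft_def mdiv_coeff mult.commute)
  also have "\<dots> = mps_coeff (\<phi> (fps_nth (fps_nth f0 (c - q)) s)) (\<chi> i. M * e0 $ i)"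
    unfolding \<xi>_def mps_coeff_mterm_mult_add by simp
  finally show ?thesis by (simp add: ramify_coeff_mult[OF M_pos])
qed

lemma Q_const_coeff: "mps_coeff (fps_nth (fps_nth Q s) 0) 0 =
    of_nat ((s + (D - N)) choose (D - N)) * mps_coeff (fps_nth (fps_nth f0 (c - q)) (s + (D - N))) e0"
proof -
  have "fps_nth (fps_nth Q s) 0 =
      mterm (of_nat ((s + (D - N)) choose (D - N))) 0 * fps_nth (ft f0 (s + (D - N))) (c - q)"
    by (simp add: Q_nth of_nat_mps mterm_1)
  moreover have "mps_coeff (mterm b 0 * x) (0 + 0) = b * mps_coeff x 0" for b :: 'k and x :: "('k, 'n) mps"
    by (rule mps_coeff_mterm_mult_add)
  ultimately show ?thesis by (simp add: ft_lead)
qed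

lemma Q_N_unit: "fps_nth Q N dvd 1"
proof -
  have "(of_nat ((N * t + 0) choose (N * 1 + 0)) :: 'k) = of_nat (t choose 1) * of_nat (0 choose 0)"
    by (rule frob_binomial[OF N N_pos N_pos])
  then have "(of_nat (D choose (D - N)) :: 'k) = of_nat t"
    using binomial_symmetric[OF N_le_D] by (simp add: D(1))
  then have "mps_coeff (fps_nth (fps_nth Q N) 0) 0 \<noteq> 0"
    unfolding Q_const_coeff using N_le_D D(2) e0(2) by simp
  then show ?thesis unfolding fps_unit_iff mps_unit_iff .
qed

lemma Q_0_fl: "fps_nth Q 0 \<in> fl (Suc 0)"
proof -
  have "mps_coeff (fps_nth (fps_nth f0 (c - q)) (D - N)) e0 = 0"
  proof (rule ccontr)
    assume nz: "mps_coeff (fps_nth (fps_nth f0 (c - q)) (D - N)) e0 \<noteq> 0"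
    have cq: "c - q < c" "c - (c - q) = q" using q by auto
    have "adm 2 q (fps_nth f0 (c - q))" using goodD(3)[OF good_0 f0(1) cq(1)] by (simp add: coef_def cq(2))
    then have "q * \<mu> 2 \<le> M * (wdot 1 e0 + 2 * (D - N))" using nz unfolding adm_iff by blast
    moreover have "M * wdot 1 e0 = q * wdot 1 r" using e0(1) by (simp add: wdot_def sum_distrib_left)
    moreover have "M * (D - N) + M * N = q * d" using N_le_D by (simp add: D(4)[symmetric] flip: distrib_left)
    moreover have "0 < M * N" using M_pos N_pos by simp
    moreover have "M * (wdot 1 e0 + 2 * (D - N)) = M * wdot 1 e0 + 2 * (M * (D - N))"
      "q * \<mu> 2 = q * wdot 1 r + 2 * (q * d)" by (simp_all add: \<mu>_def algebra_simps)
    ultimately show False by linarith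
  qed
  then show ?thesis unfolding fl_fps_1_iff fl_mps_1_iff Q_const_coeff by simp
qed

text \<open>The residue part of $Q$ modulo $N$ in $y$ that contains $y^N$ is regular of order one in $y^N$. Its root $\alpha(z)$ is
  the only candidate for $y^N$.\<close>

definition \<alpha> :: "('k, 'n) mps fps" where
  "\<alpha> = (SOME a. a \<in> fl (Suc 0) \<and> fps_nth (shift a (sect N 0 Q)) 0 = 0)"

lemma \<alpha>: "\<alpha> \<in> fl (Suc 0)" "fps_nth (shift \<alpha> (sect N 0 Q)) 0 = 0"
proof -
  have "\<exists>a. a \<in> fl (Suc 0) \<and> fps_nth (shift a (sect N 0 Q)) 0 = 0"
    using implicit_function[of "sect N 0 Q"] Q_N_unit Q_0_fl by auto
  from someI_ex[OF this] show "\<alpha> \<in> fl (Suc 0)" "fps_nth (shift \<alpha> (sect N 0 Q)) 0 = 0"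
    by (simp_all add: \<alpha>_def)
qed

lemma HkN_fl: "Hk k ^ N \<in> fl (Suc 0)"
  by (rule fl_antimono[OF _ fl_power[OF Hk_fl]]) (use N_pos in simp)

lemma fmap_sect: "fmap T (sect N \<rho> P) = sect N \<rho> (fmap T P)"
  by (rule fps_ext) simp

lemma residue_small:
  assumes "\<rho> < N"
  shows "fps_nth (shift (Hk k ^ N) (fmap (ev k) (sect N \<rho> Q))) 0 \<in> fl k"
  unfolding fmap_sect
  by (rule residues_small[OF frobA Hk_fl Q_small assms]) (use M_pos in simp)

lemma \<alpha>_close: "Hk k ^ N - ev k \<alpha> \<in> fl k"
proof (rule approximate_root[of "fmap (ev k) (sect N 0 Q)"])
  show "fps_nth (fmap (ev k) (sect N 0 Q)) 1 dvd 1"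
    using filt_homD(12)[OF ev_hom[of k] Q_N_unit] by simp
  show "ev k \<alpha> \<in> fl (Suc 0)" by (rule filt_homD(3)[OF ev_hom \<alpha>(1)])
  show "Hk k ^ N \<in> fl (Suc 0)" by (rule HkN_fl)
  have "fps_nth (shift (ev k \<alpha>) (fmap (ev k) (sect N 0 Q))) 0 = ev k (fps_nth (shift \<alpha> (sect N 0 Q)) 0)"
    unfolding fmap_shift[OF ev_hom \<alpha>(1), symmetric] by simp
  then show "fps_nth (shift (ev k \<alpha>) (fmap (ev k) (sect N 0 Q))) 0 \<in> fl k"
    by (simp add: \<alpha>(2) filt_homD(4)[OF ev_hom])
  show "fps_nth (shift (Hk k ^ N) (fmap (ev k) (sect N 0 Q))) 0 \<in> fl k" by (rule residue_small[OF N_pos])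
qed

text \<open>If $\tilde G_k$ converges along a subsequence, so do $\alpha(\tilde G_k)$ and $H_k^N$, hence $H_k$.\<close>

lemma Cauchy_case:
  assumes \<kappa>: "\<And>l. l \<le> \<kappa> l" "\<And>l l'. l \<le> l' \<Longrightarrow> Gt (\<kappa> l') - Gt (\<kappa> l) \<in> fl l"
  shows "\<exists>g h. \<forall>\<sigma>>0. good J \<sigma> g h"
proof -
  \<comment> \<open>The precision lost by taking an $N$-th root and by replacing $x^{c!}$ by $x$.\<close>
  define B where "B = M * N"
  have B: "0 < B" using M_pos N_pos by (simp add: B_def)
  define \<iota> where "\<iota> l = \<kappa> (B * l)" for l
  have l\<iota>: "l \<le> \<iota> l" "B * l \<le> \<iota> l" for l
  proof -
    show "B * l \<le> \<iota> l" using \<kappa>(1)[of "B * l"] by (simp add: \<iota>_def)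
    moreover have "l \<le> B * l" using B by (cases B) auto
    ultimately show "l \<le> \<iota> l" by linarith
  qed
  show ?thesis
  proof (rule good_limit[OF f0 q])
    show "good J \<sigma> (fps_const (Gs (\<iota> \<sigma>))) (Hs (\<iota> \<sigma>))" for \<sigma>
      by (rule good_antimono[OF good_k]) (use l\<iota>(1)[of \<sigma>] in simp)
    show "Hs (\<iota> \<sigma>') - Hs (\<iota> \<sigma>) \<in> fl \<sigma>" if "\<sigma> \<le> \<sigma>'" for \<sigma> \<sigma>'
    proof -
      let ?n = "B * \<sigma>"
      have n: "?n \<le> \<iota> \<sigma>'" "?n \<le> \<iota> \<sigma>" using l\<iota>(2)[of \<sigma>] l\<iota>(2)[of \<sigma>'] that
        by (meson mult_le_mono2 order_trans)+
      have 1: "Hk (\<iota> \<sigma>') ^ N - ev (\<iota> \<sigma>') \<alpha> \<in> fl ?n" by (rule fl_antimono[OF n(1) \<alpha>_close])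
      have 2: "Hk (\<iota> \<sigma>) ^ N - ev (\<iota> \<sigma>) \<alpha> \<in> fl ?n" by (rule fl_antimono[OF n(2) \<alpha>_close])
      have "Gt (\<iota> \<sigma>') - Gt (\<iota> \<sigma>) \<in> fl ?n" unfolding \<iota>_def by (rule \<kappa>(2)) (use that in simp)
      then have 3: "ev (\<iota> \<sigma>') \<alpha> - ev (\<iota> \<sigma>) \<alpha> \<in> fl ?n" by (rule eval_cong[OF Gt_fl Gt_fl])
      have "Hk (\<iota> \<sigma>') ^ N - Hk (\<iota> \<sigma>) ^ N \<in> fl ?n" using fl_common[OF fl_trans[OF 1 3] 2] .
      then have "(\<phi> (Hs (\<iota> \<sigma>') - Hs (\<iota> \<sigma>))) ^ N \<in> fl (N * (M * \<sigma>))"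
        unfolding filt_homD(5)[OF \<phi>_hom] frob_diff[OF frobA] by (simp add: B_def mult_ac)
      then have "\<phi> (Hs (\<iota> \<sigma>') - Hs (\<iota> \<sigma>)) \<in> fl (M * \<sigma>)" by (rule fl_mps_root[OF _ N_pos])
      then show ?thesis by (rule ramify_fl[OF _ M_pos])
    qed
  qed
qed

end

subsection \<open>Infinitely many separated approximate solutions\<close>

context flexible
begin

text \<open>From here on the pairwise distances of infinitely many points $\tilde G_k$ are bounded from below, so that
  identities between series in $z$ can be checked at these points.\<close>

context
  fixes m :: nat and X :: "nat set"
  assumes X: "infinite X" and sep: "\<And>i j. i \<in> X \<Longrightarrow> j \<in> X \<Longrightarrow> i \<noteq> j \<Longrightarrow> Gt i - Gt j \<notin> fl (Suc m)"
begin

lemma identity: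
  assumes "\<And>B k. k \<in> X \<Longrightarrow> N * B \<le> k \<Longrightarrow> ev k \<Phi> \<in> fl B"
  shows "\<Phi> = 0"
proof (rule identity_principle[OF X Gt_fl sep])
  show "\<exists>k0. \<forall>k\<in>X. k0 \<le> k \<longrightarrow> ev k \<Phi> \<in> fl B" for B
    by (rule exI[of _ "N * B"]) (use assms in blast)
qed

lemma N_times_le: "N * B \<le> k \<Longrightarrow> B \<le> k"
  using N_pos by (cases N) auto

lemma residues_vanish:
  assumes \<rho>: "\<rho> < N"
  shows "fps_nth (shift \<alpha> (sect N \<rho> Q)) 0 = 0"
proof (rule identity)
  fix B k assume k: "N * B \<le> k"
  have "ev k (fps_nth (shift \<alpha> (sect N \<rho> Q)) 0) = fps_nth (shift (ev k \<alpha>) (fmap (ev k) (sect N \<rho> Q))) 0"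
    unfolding fmap_shift[OF ev_hom \<alpha>(1), symmetric] by simp
  moreover have "fps_nth (shift (Hk k ^ N) (fmap (ev k) (sect N \<rho> Q))) 0 -
      fps_nth (shift (ev k \<alpha>) (fmap (ev k) (sect N \<rho> Q))) 0 \<in> fl k"
    by (rule eval_cong[OF HkN_fl filt_homD(3)[OF ev_hom \<alpha>(1)] \<alpha>_close])
  ultimately have "ev k (fps_nth (shift \<alpha> (sect N \<rho> Q)) 0) \<in> fl k"
    using residue_small[OF \<rho>, of k] fl_cong by metis
  then show "ev k (fps_nth (shift \<alpha> (sect N \<rho> Q)) 0) \<in> fl B"
    by (rule fl_antimono[OF N_times_le[OF k]])
qed

text \<open>So $Q$ is divisible by $y^N - \alpha(z)$, with a unit as quotient.\<close>

lemma Q_factor: "\<exists>U. U dvd 1 \<and> Q = (fps_X ^ N - fps_const \<alpha>) * U"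
proof -
  have "\<exists>V. sect N \<rho> Q = (fps_X - fps_const \<alpha>) * V" if "\<rho> < N" for \<rho>
    using fps_linear_division[OF \<alpha>(1), of "sect N \<rho> Q"] residues_vanish[OF that] by simp
  then obtain V where V: "\<And>\<rho>. \<rho> < N \<Longrightarrow> sect N \<rho> Q = (fps_X - fps_const \<alpha>) * V \<rho>" by metis
  define U where "U = Abs_fps (\<lambda>s. fps_nth (V (s mod N)) (s div N))"
  have V_nth: "fps_nth Q (\<rho> + N * n) = (if n = 0 then 0 else fps_nth (V \<rho>) (n - 1)) - \<alpha> * fps_nth (V \<rho>) n"
    if "\<rho> < N" for \<rho> n
  proof -
    have "fps_nth (sect N \<rho> Q) n = fps_nth (fps_X * V \<rho> - fps_const \<alpha> * V \<rho>) n"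
      unfolding V[OF that] left_diff_distrib ..
    then show ?thesis by (simp add: fps_X_mult_nth)
  qed
  have "Q = (fps_X ^ N - fps_const \<alpha>) * U"
  proof (rule fps_ext)
    fix s
    define \<rho> n where "\<rho> = s mod N" and "n = s div N"
    have s: "s = \<rho> + N * n" "\<rho> < N" using N_pos by (simp_all add: \<rho>_def n_def)
    have "fps_nth ((fps_X ^ N - fps_const \<alpha>) * U) s = (if s < N then 0 else fps_nth U (s - N)) - \<alpha> * fps_nth U s"
      by (simp add: left_diff_distrib fps_X_power_mult_nth)
    moreover have "fps_nth U s = fps_nth (V \<rho>) n" by (simp add: U_def \<rho>_def n_def)
    moreover have "s < N \<longleftrightarrow> n = 0" using s N_pos by (cases n) auto
    moreover have "fps_nth U (s - N) = fps_nth (V \<rho>) (n - 1)" if nz: "n \<noteq> 0"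
    proof -
      obtain n' where n': "n = Suc n'" using nz by (cases n) auto
      have "s - N = \<rho> + N * n'" using s(1) by (simp add: n')
      then have "(s - N) mod N = \<rho>" "(s - N) div N = n'" using s(2) N_pos by simp_all
      then show ?thesis by (simp add: U_def n')
    qed
    ultimately show "fps_nth Q s = fps_nth ((fps_X ^ N - fps_const \<alpha>) * U) s"
      using V_nth[OF s(2), of n] by (simp add: s(1)[symmetric])
  qed
  moreover have "U dvd 1"
  proof -
    have "fps_nth Q N = fps_nth (V 0) 0 - \<alpha> * fps_nth (V 0) 1" using V_nth[OF N_pos, of 1] by simp
    then have "fps_nth (V 0) 0 = fps_nth Q N + \<alpha> * fps_nth (V 0) 1" by simp
    moreover have "\<alpha> * fps_nth (V 0) 1 \<in> fl 1" using fl_multr[OF \<alpha>(1)] by simp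
    ultimately have "fps_nth (V 0) 0 dvd 1" using dvd_one_add_fl[OF Q_N_unit] by metis
    then have "fps_nth U 0 dvd 1" by (simp add: U_def)
    then show ?thesis by (simp only: fps_unit_iff)
  qed
  ultimately show ?thesis by blast
qed

text \<open>Put $y = H_k$ in the factorization of $Q$ and expand at $z = \tilde G_k$: up to a unit, the result is
  $H_k^N - \alpha(z)$, and its Taylor coefficients of order less than $N$ are small.\<close>

lemma \<alpha>_derivative_small:
  assumes u: "0 < u" "u < N"
  shows "fps_nth (shift (Gt k) \<alpha>) u \<in> fl k"
proof -
  let ?S = "\<lambda>F. fps_nth (shift (fps_const (Hk k)) (fmap (shift (Gt k)) F)) 0"
  have HC: "fps_const (Hk k) \<in> fl (Suc 0)" using Hk_fl by simp
  have S: "filt_hom ?S"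
    by (rule filt_hom_comp[OF filt_hom_eval[OF HC] filt_hom_fmap[OF filt_hom_shift[OF Gt_fl]]])
  obtain U where U: "U dvd 1" "Q = (fps_X ^ N - fps_const \<alpha>) * U" using Q_factor by blast
  have SX: "?S fps_X = fps_const (Hk k)" by (simp add: fmap_X[OF filt_hom_shift[OF Gt_fl]] shift_X[OF HC])
  have S\<alpha>: "?S (fps_const \<alpha>) = shift (Gt k) \<alpha>"
    by (simp add: fmap_const[OF filt_homD(1)[OF filt_hom_shift[OF Gt_fl]]] shift_const[OF HC])
  obtain W where W: "1 = ?S U * W" using filt_homD(12)[OF S U(1)] by (rule dvdE)
  have "?S Q = (fps_const (Hk k) ^ N - shift (Gt k) \<alpha>) * ?S U"
    unfolding U(2) filt_homD(8)[OF S] filt_homD(5)[OF S] filt_homD(10)[OF S] SX S\<alpha> ..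
  then have "?S Q * W = (fps_const (Hk k) ^ N - shift (Gt k) \<alpha>) * (?S U * W)" by (simp only: mult.assoc)
  then have eq: "?S Q * W = fps_const (Hk k ^ N) - shift (Gt k) \<alpha>"
    unfolding W[symmetric] by (simp add: fps_const_power)
  have "fps_nth (?S Q) v \<in> fl k" if v: "v < N" for v
  proof -
    have "zrow v (fmap (shift (Gt k)) Q) = fmap (\<lambda>\<psi>. fps_nth (shift (Gt k) \<psi>) v) Q"
      by (rule fps_ext) simp
    moreover have "v * d + M * 0 < M * N"
    proof -
      have "v * d \<le> v * M" using d_less_M by simp
      also have "\<dots> < N * M" using v M_pos by simp
      finally show ?thesis by (simp add: mult.commute)
    qed
    ultimately show ?thesis using Q_small[of v 0 k] unfolding shift_zrow[OF Hk_fl] by simp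
  qed
  then have "fps_nth (?S Q * W) u \<in> fl k"
    unfolding fps_mult_nth using u(2) by (intro fl_sum fl_multr) auto
  then have "- fps_nth (shift (Gt k) \<alpha>) u \<in> fl k" unfolding eq using u(1) by simp
  then show ?thesis using fl_uminus by fastforce
qed

text \<open>The Hasse derivatives of $\alpha$ of order $0 < u < N$ vanish by the identity principle, so $\alpha$ is a series
  in $z^N$.\<close>

lemma \<alpha>_support_N:
  assumes "\<not> N dvd n"
  shows "fps_nth \<alpha> n = 0"
proof -
  define u where "u = n mod N"
  have u: "0 < u" "u < N" "u \<le> n" using assms N_pos by (auto simp: u_def dvd_eq_mod_eq_0)
  have "hasse u \<alpha> = 0"
  proof (rule identity)
    fix B k assume k: "N * B \<le> k"
    have "ev k (hasse u \<alpha>) = fps_nth (shift (Gt k) \<alpha>) u" by (simp add: shift_hasse[OF Gt_fl])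
    then show "ev k (hasse u \<alpha>) \<in> fl B"
      using fl_antimono[OF N_times_le[OF k] \<alpha>_derivative_small[OF u(1,2)]] by simp
  qed
  then have "fps_nth (hasse u \<alpha>) (n - u) = 0" by simp
  then have 0: "of_nat (n choose u) * fps_nth \<alpha> n = 0" using u(3) by simp
  have "(of_nat ((N * (n div N) + u) choose (N * 0 + u)) :: ('k, 'n) mps) =
      of_nat (n div N choose 0) * of_nat (u choose u)"
    by (rule frob_binomial[OF frobA u(2) u(2)])
  moreover have "N * (n div N) + u = n" by (simp add: u_def)
  ultimately have "(of_nat (n choose u) :: ('k, 'n) mps) = 1" by simp
  then show ?thesis using 0 by simp
qed

text \<open>The exponents of $\tilde G_k$ are congruent to $-r$ modulo $c!$, and those of $H_k^N$ are divisible by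
  $c! N$. This restricts the exponents that $\alpha$ can have.\<close>

lemma Gt_power_support:
  assumes "mps_coeff (Gt k ^ j) b \<noteq> 0"
  shows "M dvd b $ i + j * r $ i"
  using assms
proof (induction j arbitrary: b)
  case 0
  then show ?case by (simp add: mps_coeff_one split: if_splits)
next
  case (Suc j)
  obtain x y where xy: "b = x + y" "mps_coeff (Gt k) x \<noteq> 0" "mps_coeff (Gt k ^ j) y \<noteq> 0"
    using mps_mult_support[of "Gt k" "Gt k ^ j" b] Suc.prems by auto
  have "mps_coeff (\<phi> (Gs k)) (r + x) \<noteq> 0" using xy(2) by (simp add: Gt_def mdiv_coeff)
  then obtain a where "r + x = (\<chi> i. M * a $ i)" using ramify_support by blast
  then have "(r + x) $ i = M * a $ i" by simp
  then have "M dvd x $ i + r $ i" by (simp add: add.commute)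
  moreover have "M dvd y $ i + j * r $ i" by (rule Suc.IH[OF xy(3)])
  ultimately have "M dvd (x $ i + r $ i) + (y $ i + j * r $ i)" by (rule dvd_add)
  then show ?case by (simp add: xy(1) algebra_simps)
qed

text \<open>For $N \mid n$ this is $a \equiv n r$ modulo $N c!$, the condition for $x^a \tilde G_k^n$ to be a series in the
  $x_i^{N c!}$. The factor $c! - 1$ stands for $-1$.\<close>

definition compatible :: "nat \<Rightarrow> nat ^ 'n \<Rightarrow> bool" where
  "compatible n a \<longleftrightarrow> (\<forall>i. N * M dvd a $ i + n * (M - 1) * r $ i)"

definition \<alpha>' :: "('k, 'n) mps fps" where
  "\<alpha>' = Abs_fps (\<lambda>n. Abs_mps (\<lambda>a. if compatible n a then mps_coeff (fps_nth \<alpha> n) a else 0))"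

lemma \<alpha>'_nth: "mps_coeff (fps_nth \<alpha>' n) a = (if compatible n a then mps_coeff (fps_nth \<alpha> n) a else 0)"
  by (simp add: \<alpha>'_def Abs_mps_inverse)

text \<open>The projection to the series in the $x_i^{N c!}$.\<close>

definition pr :: "('k, 'n) mps \<Rightarrow> ('k, 'n) mps" where
  "pr f = Abs_mps (\<lambda>e. if \<forall>i. N * M dvd e $ i then mps_coeff f e else 0)"

lemma pr_coeff: "mps_coeff (pr f) e = (if \<forall>i. N * M dvd e $ i then mps_coeff f e else 0)"
  by (simp add: pr_def Abs_mps_inverse)

lemma filt_map_pr: "filt_map pr"
  unfolding filt_map_def
proof (intro conjI allI ballI)
  show "pr (a + b) = pr a + pr b" for a b by (rule mps_eqI) (simp add: pr_coeff)
  show "pr a \<in> fl n" if "a \<in> fl n" for n a using that by (simp add: fl_mps_iff pr_coeff)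
qed

lemma pr_HkN: "pr (Hk k ^ N) = Hk k ^ N"
proof (rule mps_eqI)
  fix e
  have "N * M dvd e $ i" if nz: "mps_coeff (Hk k ^ N) e \<noteq> 0" for i
  proof -
    have "mps_coeff (\<phi> (Hs k ^ N)) e \<noteq> 0" using nz by (simp add: filt_homD(10)[OF \<phi>_hom])
    then obtain a where a: "e = (\<chi> i. M * a $ i)" "mps_coeff (Hs k ^ N) a \<noteq> 0" using ramify_support by blast
    then show ?thesis using mps_frob_power(2)[OF N a(2), of i] by (simp add: mult.commute)
  qed
  then show "mps_coeff (pr (Hk k ^ N)) e = mps_coeff (Hk k ^ N) e" by (auto simp: pr_coeff)
qed

lemma pr_term: "pr (fps_nth \<alpha> n * Gt k ^ n) = fps_nth \<alpha>' n * Gt k ^ n"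
proof (cases "N dvd n")
  case False
  then have "fps_nth \<alpha> n = 0" by (rule \<alpha>_support_N)
  moreover have "fps_nth \<alpha>' n = 0" by (rule mps_eqI) (simp add: \<alpha>'_nth calculation)
  ultimately show ?thesis by (simp add: filt_mapD(3)[OF filt_map_pr])
next
  case True
  then obtain j where n: "n = N * j" by blast
  have G: "N * M dvd b $ i + n * r $ i" if nz: "mps_coeff (Gt k ^ n) b \<noteq> 0" for b i
  proof -
    have nz': "mps_coeff ((Gt k ^ j) ^ N) b \<noteq> 0" using nz by (simp add: n mult.commute flip: power_mult)
    have b: "b = (\<chi> i. N * (\<chi> i. b $ i div N) $ i)"
      using mps_frob_power(2)[OF N nz'] by (simp add: vec_eq_iff)
    have "mps_coeff ((Gt k ^ j) ^ N) (\<chi> i. N * (\<chi> i. b $ i div N) $ i) \<noteq> 0" using nz' b by simp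
    then have "mps_coeff (Gt k ^ j) (\<chi> i. b $ i div N) ^ N \<noteq> 0" unfolding mps_frob_power(1)[OF N] .
    then have "mps_coeff (Gt k ^ j) (\<chi> i. b $ i div N) \<noteq> 0" using N_pos by (auto simp: zero_power)
    from Gt_power_support[OF this, of i] have "M dvd b $ i div N + j * r $ i" by simp
    then have "N * M dvd N * (b $ i div N + j * r $ i)" by (rule mult_dvd_mono[OF dvd_refl])
    moreover have "N * (b $ i div N) = b $ i" using mps_frob_power(2)[OF N nz', of i] by simp
    ultimately show ?thesis by (simp add: n distrib_left mult.assoc)
  qed
  have compat: "(\<forall>i. N * M dvd (a + b) $ i) \<longleftrightarrow> compatible n a" if nz: "mps_coeff (Gt k ^ n) b \<noteq> 0" for a b
  proof -
    have "N * M dvd a $ i + n * (M - 1) * r $ i \<longleftrightarrow> N * M dvd (a + b) $ i" for i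
    proof -
      have "M = Suc (M - 1)" using M_pos by simp
      then have "n * (M - 1) * r $ i + n * r $ i = n * M * r $ i"
        by (metis add.commute add_mult_distrib mult_Suc_right)
      then have "(a $ i + n * (M - 1) * r $ i) + (b $ i + n * r $ i) = (a + b) $ i + n * M * r $ i" by simp
      moreover have "N * M dvd n * M * r $ i" by (simp add: n mult.assoc mult.left_commute[of j])
      ultimately show ?thesis using G[OF nz, of i] by (metis dvd_add_left_iff)
    qed
    then show ?thesis unfolding compatible_def by blast
  qed
  show ?thesis
  proof (rule mps_eqI)
    fix e
    have "mps_coeff (pr (fps_nth \<alpha> n * Gt k ^ n)) e = (\<Sum>(a, b) | a + b = e.
        (if \<forall>i. N * M dvd e $ i then mps_coeff (fps_nth \<alpha> n) a * mps_coeff (Gt k ^ n) b else 0))"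
      unfolding pr_coeff mps_coeff_mult case_prod_unfold
      by (cases "\<forall>i. N * M dvd e $ i") (simp_all only: if_True if_False sum.neutral_const simp_thms)
    also have "\<dots> = (\<Sum>(a, b) | a + b = e. mps_coeff (fps_nth \<alpha>' n) a * mps_coeff (Gt k ^ n) b)"
    proof (rule sum.cong[OF refl], clarify)
      fix a b
      show "(if \<forall>i. N * M dvd (a + b) $ i then mps_coeff (fps_nth \<alpha> n) a * mps_coeff (Gt k ^ n) b else 0) =
          mps_coeff (fps_nth \<alpha>' n) a * mps_coeff (Gt k ^ n) b"
        using compat[of b a] by (cases "mps_coeff (Gt k ^ n) b = 0") (auto simp: \<alpha>'_nth)
    qed
    finally show "mps_coeff (pr (fps_nth \<alpha> n * Gt k ^ n)) e = mps_coeff (fps_nth \<alpha>' n * Gt k ^ n) e"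
      by (simp add: mps_coeff_mult)
  qed
qed

text \<open>Projecting the approximate equation $H_k^N \approx \alpha(\tilde G_k)$ shows that $\alpha'$ solves it as well.\<close>

lemma \<alpha>_compatible: "\<alpha> = \<alpha>'"
proof -
  have approx: "ev k \<psi> - (\<Sum>n<k. fps_nth \<psi> n * Gt k ^ n) \<in> fl k" for k \<psi>
    using shift_Taylor_mod[OF Gt_fl[of k], of \<psi> 0 k] by simp
  have "\<alpha> - \<alpha>' = 0"
  proof (rule identity)
    fix B k assume k: "N * B \<le> k"
    have "(\<Sum>n<k. fps_nth \<alpha>' n * Gt k ^ n) = pr (\<Sum>n<k. fps_nth \<alpha> n * Gt k ^ n)"
      unfolding filt_mapD(6)[OF filt_map_pr] pr_term ..
    moreover have "pr (ev k \<alpha>) - pr (\<Sum>n<k. fps_nth \<alpha> n * Gt k ^ n) \<in> fl k"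
      unfolding filt_mapD(4)[OF filt_map_pr, symmetric] by (rule filt_mapD(2)[OF filt_map_pr approx])
    ultimately have 1: "ev k \<alpha>' - pr (ev k \<alpha>) \<in> fl k" using fl_common[OF approx[of k \<alpha>']] by simp
    have "pr (Hk k ^ N) - pr (ev k \<alpha>) \<in> fl k"
      unfolding filt_mapD(4)[OF filt_map_pr, symmetric] by (rule filt_mapD(2)[OF filt_map_pr \<alpha>_close])
    then have "Hk k ^ N - ev k \<alpha>' \<in> fl k" unfolding pr_HkN by (rule fl_common[OF _ 1])
    then have "ev k \<alpha> - ev k \<alpha>' \<in> fl k" by (rule fl_trans[OF iffD1[OF fl_commute \<alpha>_close]])
    then have "ev k (\<alpha> - \<alpha>') \<in> fl k" by (simp only: filt_homD(5)[OF ev_hom])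
    then show "ev k (\<alpha> - \<alpha>') \<in> fl B" by (rule fl_antimono[OF N_times_le[OF k]])
  qed
  then show ?thesis by simp
qed

definition rt :: "'k \<Rightarrow> 'k" where "rt a = (SOME b. b ^ N = a)"

lemma rt: "rt a ^ N = a"
  using someI_ex[OF nth_root_exists[OF N_pos, of a]] by (simp add: rt_def)

lemma rt_0 [simp]: "rt 0 = 0"
  using rt[of 0] by simp

definition \<eta> :: "('k, 'n) mps fps" where
  "\<eta> = Abs_fps (\<lambda>j. Abs_mps (\<lambda>e. rt (mps_coeff (fps_nth \<alpha> (N * j)) (\<chi> i. N * e $ i))))"

lemma \<eta>_nth: "mps_coeff (fps_nth \<eta> j) e = rt (mps_coeff (fps_nth \<alpha> (N * j)) (\<chi> i. N * e $ i))"
  by (simp add: \<eta>_def Abs_mps_inverse)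

lemma \<alpha>_support:
  assumes "mps_coeff (fps_nth \<alpha> n) a \<noteq> 0"
  shows "N dvd n" "compatible n a" "N dvd a $ i"
proof -
  show n: "N dvd n" using assms \<alpha>_support_N[of n] by (metis mps_coeff_zero)
  have "mps_coeff (fps_nth \<alpha>' n) a \<noteq> 0" using assms \<alpha>_compatible by metis
  then show c: "compatible n a" by (auto simp: \<alpha>'_nth split: if_splits)
  have "N * M dvd a $ i + n * (M - 1) * r $ i" using c by (simp add: compatible_def)
  then have "N dvd a $ i + n * (M - 1) * r $ i" by (rule dvd_mult_left)
  then show "N dvd a $ i" using n by (simp add: dvd_add_left_iff)
qed

text \<open>All exponents of $\alpha$ are divisible by $N$ and $K$ is algebraically closed, so a root can be taken monomial by
  monomial.\<close>

lemma \<eta>_power: "\<eta> ^ N = \<alpha>"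
proof (rule fps_ext, rule mps_eqI)
  fix n a
  show "mps_coeff (fps_nth (\<eta> ^ N) n) a = mps_coeff (fps_nth \<alpha> n) a"
  proof (cases "N dvd n \<and> (\<forall>i. N dvd a $ i)")
    case True
    then have "N * (n div N) = n" "(\<chi> i. N * (a $ i div N)) = a" by (auto simp: vec_eq_iff)
    then show ?thesis using True by (simp add: mps_fps_frob_power[OF N] \<eta>_nth rt)
  next
    case False
    then have "mps_coeff (fps_nth \<alpha> n) a = 0" using \<alpha>_support by blast
    then show ?thesis unfolding mps_fps_frob_power[OF N] if_not_P[OF False] by simp
  qed
qed

lemma \<eta>_fl: "\<eta> \<in> fl (Suc 0)"
proof -
  have "mps_coeff (fps_nth \<alpha> 0) 0 = 0" using \<alpha>(1) by (simp add: fl_fps_1_iff fl_mps_1_iff)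
  moreover have "(\<chi> i. N * (0 :: nat ^ 'n) $ i) = 0" by (simp add: vec_eq_iff)
  ultimately show ?thesis by (simp add: fl_fps_1_iff fl_mps_1_iff \<eta>_nth)
qed

text \<open>Compatible exponents at $z = 0$ are divisible by $N c!$.\<close>

lemma \<eta>_0: "\<exists>h. h \<in> fl (Suc 0) \<and> fps_nth \<eta> 0 = \<phi> h"
proof -
  define h where "h = Abs_mps (\<lambda>e. mps_coeff (fps_nth \<eta> 0) (\<chi> i. M * e $ i))"
  have h: "mps_coeff h e = mps_coeff (fps_nth \<eta> 0) (\<chi> i. M * e $ i)" for e
    by (simp add: h_def Abs_mps_inverse)
  have "fps_nth \<eta> 0 = \<phi> h"
  proof (rule mps_eqI)
    fix e
    show "mps_coeff (fps_nth \<eta> 0) e = mps_coeff (\<phi> h) e"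
    proof (cases "\<forall>i. M dvd e $ i")
      case True
      then have "(\<chi> i. M * (e $ i div M)) = e" by (simp add: vec_eq_iff)
      then show ?thesis using True by (simp add: ramify_coeff h)
    next
      case False
      have "mps_coeff (fps_nth \<eta> 0) e = 0"
      proof (rule ccontr)
        assume "mps_coeff (fps_nth \<eta> 0) e \<noteq> 0"
        then have "mps_coeff (fps_nth \<alpha> 0) (\<chi> i. N * e $ i) \<noteq> 0" unfolding \<eta>_nth by auto
        from \<alpha>_support(2)[OF this] have "\<forall>i. N * M dvd N * e $ i" by (simp add: compatible_def)
        then show False using False N_pos by simp
      qed
      then show ?thesis unfolding ramify_coeff if_not_P[OF False] .
    qed
  qed
  moreover have "h \<in> fl (Suc 0)"
  proof -
    have "(\<chi> i. M * (0 :: nat ^ 'n) $ i) = 0" by (simp add: vec_eq_iff)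
    then show ?thesis using \<eta>_fl by (simp add: fl_fps_1_iff fl_mps_1_iff h)
  qed
  ultimately show ?thesis by blast
qed

lemma \<eta>_close:
  assumes "N * B \<le> k"
  shows "ev k \<eta> - Hk k \<in> fl B"
proof -
  have "(ev k \<eta> - Hk k) ^ N = ev k \<alpha> - Hk k ^ N"
    unfolding frob_diff[OF frobA] filt_homD(10)[OF ev_hom, symmetric] \<eta>_power ..
  also have "\<dots> \<in> fl (N * B)" by (rule fl_antimono[OF assms iffD1[OF fl_commute \<alpha>_close]])
  finally show ?thesis by (rule fl_mps_root[OF _ N_pos])
qed

text \<open>The equations satisfied approximately by $(\tilde G_k, H_k)$ hold identically along the curve $y = \eta(z)$.\<close>

lemma E_\<eta>_vanish:
  assumes f: "f \<in> J" and i: "i < c" and s: "M * s < (c - i) * d"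
  shows "fps_nth (shift \<eta> (fmap (hasse i) (F f))) s = 0"
proof (rule identity)
  fix B k assume k: "N * B \<le> k"
  have "fmap (ev k) (fmap (hasse i) (F f)) = E f i (Gt k)"
    by (rule fps_ext) (simp add: E_def shift_hasse[OF Gt_fl])
  then have "ev k (fps_nth (shift \<eta> (fmap (hasse i) (F f))) s) = fps_nth (shift (ev k \<eta>) (E f i (Gt k))) s"
    using arg_cong[OF fmap_shift[OF ev_hom \<eta>_fl, of k "fmap (hasse i) (F f)"], of "\<lambda>F. fps_nth F s"] by simp
  moreover have "fps_nth (shift (ev k \<eta>) (E f i (Gt k))) s - fps_nth (shift (Hk k) (E f i (Gt k))) s \<in> fl B"
    by (rule eval_cong[OF filt_homD(3)[OF ev_hom \<eta>_fl] Hk_fl \<eta>_close[OF k]])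
  moreover have "fps_nth (shift (Hk k) (E f i (Gt k))) s \<in> fl B"
    by (rule fl_antimono[OF N_times_le[OF k] E_small[OF f i s]])
  ultimately show "ev k (fps_nth (shift \<eta> (fmap (hasse i) (F f))) s) \<in> fl B" using fl_cong by metis
qed

text \<open>At the point $z = 0$ of this curve, the equations say that $(0, h)$ with $h(x^{c!}) = \eta(0)$ is good for
  all weights.\<close>

lemma separated_case: "\<exists>g h. \<forall>\<sigma>>0. good J \<sigma> g h"
proof -
  obtain h where h: "h \<in> fl (Suc 0)" "fps_nth \<eta> 0 = \<phi> h" using \<eta>_0 by blast
  have vanish: "fps_nth (coef 0 h f i) s = 0" if f: "f \<in> J" and i: "i < c" and s: "M * s < (c - i) * d" for f i s
  proof -
    have z: "(0 :: ('k, 'n) mps) \<in> fl (Suc 0)" by simp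
    note ev0 = filt_hom_eval[OF z]
    have "fmap (\<lambda>\<psi>. fps_nth (shift 0 \<psi>) 0) (fmap (hasse i) (F f)) = E f i 0"
      by (rule fps_ext) (simp add: E_def)
    then have "fps_nth (shift (fps_nth (shift 0 \<eta>) 0) (E f i 0)) s =
        fps_nth (shift 0 (fps_nth (shift \<eta> (fmap (hasse i) (F f))) s)) 0"
      using arg_cong[OF fmap_shift[OF ev0 \<eta>_fl, of "fmap (hasse i) (F f)"], of "\<lambda>F. fps_nth F s"] by simp
    then have "fps_nth (shift (\<phi> h) (E f i 0)) s = 0" by (simp add: E_\<eta>_vanish[OF f i s] h(2))
    moreover have "\<xi> 1 * 0 = \<phi> 0" by (simp add: filt_homD(4)[OF \<phi>_hom])
    from transform_coef[OF f z z this h(1), of i s]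
    have "\<xi> c * fps_nth (shift (\<phi> h) (E f i 0)) s = \<xi> i * \<phi> (fps_nth (coef 0 h f i) s)" by simp
    ultimately have "\<xi> i * \<phi> (fps_nth (coef 0 h f i) s) = \<xi> i * 0" by simp
    then have "\<phi> (fps_nth (coef 0 h f i) s) = 0" unfolding \<xi>_def by (rule mterm_cancel)
    then show ?thesis by (rule ramify_eq_0[OF M_pos])
  qed
  have g1: "good J 1 0 h"
    by (rule good_change_h[OF good_antimono[OF good_0, of 1]]) (use h in auto)
  have "good J \<sigma> 0 h" for \<sigma>
    unfolding good_def
  proof (intro conjI ballI allI impI)
    fix f i assume f: "f \<in> J" and i: "i < c"
    show "adm \<sigma> (c - i) (coef 0 h f i)"
      unfolding adm_iff
    proof (intro allI impI)
      fix s e assume nz: "mps_coeff (fps_nth (coef 0 h f i) s) e \<noteq> 0"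
      have r: "(c - i) * r $ j \<le> M * e $ j" for j
        using goodD(3)[OF g1 f i] nz unfolding adm_iff by blast
      have r': "(c - i) * wdot 1 r \<le> M * wdot 1 e"
        unfolding wdot_def sum_distrib_left using r by (intro sum_mono) simp
      have "(c - i) * d \<le> M * s" using vanish[OF f i, of s] nz by (cases "M * s < (c - i) * d") auto
      then have "(c - i) * d * \<sigma> \<le> M * s * \<sigma>" by (rule mult_le_mono1)
      moreover have "(c - i) * \<mu> \<sigma> = (c - i) * wdot 1 r + (c - i) * d * \<sigma>"
        "M * (wdot 1 e + \<sigma> * s) = M * wdot 1 e + M * s * \<sigma>" by (simp_all add: \<mu>_def algebra_simps)
      ultimately have "(c - i) * \<mu> \<sigma> \<le> M * (wdot 1 e + \<sigma> * s)" using r' by linarith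
      then show "(\<forall>j. (c - i) * r $ j \<le> M * e $ j) \<and> (c - i) * \<mu> \<sigma> \<le> M * (wdot 1 e + \<sigma> * s)" using r by blast
    qed
  qed (use h in auto)
  then show ?thesis by blast
qed

end

lemma flexible_limit: "\<exists>g h. \<forall>\<sigma>>0. good J \<sigma> g h"
proof (rule Cauchy_or_separated[of Gt])
  fix \<kappa> assume "\<And>l. l \<le> \<kappa> l" "\<And>l l'. l \<le> l' \<Longrightarrow> Gt (\<kappa> l') - Gt (\<kappa> l) \<in> fl l"
  then show ?thesis by (rule Cauchy_case)
next
  fix m X assume "infinite X" "\<And>i j. i \<in> X \<Longrightarrow> j \<in> X \<Longrightarrow> i \<noteq> j \<Longrightarrow> Gt i - Gt j \<notin> fl (Suc m)"
  then show ?thesis by (rule separated_case)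
qed

end

subsection \<open>Reduction to the flexible case\<close>

context exponents
begin

text \<open>The series $f$ in the parameters that belong to the pair $(g_b, h_b)$. In these, a pair $(g,h)$ becomes
  $(g - g_b, h - h_b)$, where $g - g_b$ is expressed in $y - h_b$.\<close>

definition tr :: "('k::comm_ring_1, 'n) mps fps \<Rightarrow> ('k, 'n) mps \<Rightarrow> ('k, 'n) mps fps fps \<Rightarrow> ('k, 'n) mps fps fps" where
  "tr gb hb f = fmap (shift hb) (shift gb f)"

lemma coef_tr:
  assumes gb: "gb \<in> fl (Suc 0)" and hb: "hb \<in> fl (Suc 0)" and g: "g \<in> fl (Suc 0)" and h: "h \<in> fl (Suc 0)"
  shows "coef (shift hb (g - gb)) (h - hb) (tr gb hb f) i = coef g h f i"
proof -
  note T = filt_hom_shift[OF hb]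
  have d: "g - gb \<in> fl (Suc 0)" "h - hb \<in> fl (Suc 0)" using assms by (simp_all add: fl_diff)
  have "shift (shift hb (g - gb)) (tr gb hb f) = fmap (shift hb) (shift (g - gb) (shift gb f))"
    unfolding tr_def fmap_shift[OF T d(1)] ..
  also have "shift (g - gb) (shift gb f) = shift g f" by (simp add: shift_shift[OF d(1) gb])
  finally show ?thesis by (simp add: coef_def shift_shift[OF d(2) hb])
qed

lemma good_tr:
  assumes "gb \<in> fl (Suc 0)" "hb \<in> fl (Suc 0)" "g \<in> fl (Suc 0)" "h \<in> fl (Suc 0)"
  shows "good (tr gb hb ` J) \<sigma> (shift hb (g - gb)) (h - hb) \<longleftrightarrow> good J \<sigma> g h"
proof -
  have "shift hb (g - gb) \<in> fl (Suc 0)" "h - hb \<in> fl (Suc 0)"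
    using assms by (simp_all add: fl_diff filt_homD(3)[OF filt_hom_shift])
  then show ?thesis using assms by (simp add: good_def coef_tr)
qed

end

lemma frob_decomposition:
  assumes "0 < n"
  shows "\<exists>N t. n = N * t \<and> frob TYPE('k::idom) N \<and> of_nat t \<noteq> (0 :: 'k)"
proof (cases "CHAR('k) = 0")
  case True
  then have "of_nat n \<noteq> (0 :: 'k)" using assms by (simp add: of_nat_eq_0_iff_char_dvd)
  then show ?thesis using frob_1 by (intro exI[of _ "Suc 0"] exI[of _ n]) auto
next
  case False
  then have "prime CHAR('k)" by (intro prime_CHAR_semidom) simp
  then have "\<not> is_unit CHAR('k)" by auto
  then obtain t where t: "n = CHAR('k) ^ multiplicity CHAR('k) n * t" "\<not> CHAR('k) dvd t"
    using multiplicity_decompose'[of n "CHAR('k)"] assms by auto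
  then show ?thesis using frob_CHAR_power[OF False] by (metis of_nat_eq_0_iff_char_dvd)
qed

context clean_element
begin

text \<open>For $d < c!$ every monomial that contains $y - h$ and has the required divisibility by $x$ is admissible in $g$ at
  all weights, and may be removed.\<close>

lemma good_in_x:
  assumes dM: "d < M" and g: "good J \<sigma> g h" "0 < \<sigma>"
  shows "\<exists>G. good J \<sigma> (fps_const G) h"
proof
  let ?G = "fps_nth (shift h g) 0"
  note h = goodD(2)[OF g(1)]
  note hh = filt_hom_shift[OF h]
  have g1: "good J 1 g h" using good_antimono[OF g(1), of 1] g(2) by simp
  have sg: "shift h g \<in> fl (Suc 0)" by (rule filt_homD(3)[OF hh goodD(1)[OF g(1)]])
  have G: "fps_const ?G \<in> fl (Suc 0)" using fl_fpsD[OF sg, of 0] by simp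
  have a1: "adm 1 1 (shift h g)" using compare(1)[OF good_0_h[OF h] g1] by simp
  have "good J \<sigma> (g + (fps_const ?G - g)) h"
  proof (rule good_change_g[OF g(1)])
    show "fps_const ?G - g \<in> fl (Suc 0)" by (intro fl_diff G goodD(1)[OF g(1)])
    show "adm \<sigma> 1 (shift h (fps_const ?G - g))"
      unfolding adm_iff
    proof (intro allI impI)
      fix s e assume nz: "mps_coeff (fps_nth (shift h (fps_const ?G - g)) s) e \<noteq> 0"
      have "shift h (fps_const ?G - g) = fps_const ?G - shift h g"
        unfolding filt_homD(5)[OF hh] shift_const[OF h] ..
      then have s: "s \<noteq> 0" "mps_coeff (fps_nth (shift h g) s) e \<noteq> 0" using nz by (auto split: if_splits)
      then have r: "\<And>i. r $ i \<le> M * e $ i" using a1 unfolding adm_iff by auto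
      have r': "wdot 1 r \<le> M * wdot 1 e"
        unfolding wdot_def sum_distrib_left using r by (intro sum_mono) simp
      have "d \<le> M * s" using dM s(1) by (cases s) auto
      then have "d * \<sigma> \<le> M * s * \<sigma>" by (rule mult_le_mono1)
      moreover have "M * (wdot 1 e + \<sigma> * s) = M * wdot 1 e + M * s * \<sigma>" by (simp add: algebra_simps)
      ultimately have "\<mu> \<sigma> \<le> M * (wdot 1 e + \<sigma> * s)" using r' unfolding \<mu>_def by linarith
      then show "(\<forall>i. 1 * r $ i \<le> M * e $ i) \<and> 1 * \<mu> \<sigma> \<le> M * (wdot 1 e + \<sigma> * s)" using r by simp
    qed
  qed
  then show "good J \<sigma> (fps_const ?G) h" by simp
qed

text \<open>A pair that is good for the weight two is moved to the origin. At the weight one, the coefficient of index $c - q$ then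
  has a leading monomial $x^e y^D$, because it is not a $q$-th power, and $d < c!$ means $D < q$.\<close>

lemma flexible_exists:
  assumes nm: "\<not> middle" and np: "not_power" and dM: "d < M"
    and good: "\<And>\<sigma>. 0 < \<sigma> \<Longrightarrow> \<exists>g h. good J \<sigma> g h"
  shows "\<exists>g h. \<forall>\<sigma>>0. good J \<sigma> g h"
proof -
  have "\<exists>G h. good J (Suc k) (fps_const G) h" for k
    using good[of "Suc k"] good_in_x[OF dM] by blast
  then obtain Gs Hs where GH: "\<And>k. good J (Suc k) (fps_const (Gs k)) (Hs k)" by metis
  define gb hb where "gb = fps_const (Gs 1)" and "hb = Hs 1"
  have base: "good J 2 gb hb" using GH[of 1] by (simp add: gb_def hb_def numeral_2_eq_2)
  note b1 = goodD(1,2)[OF base]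
  note T = filt_hom_shift[OF b1(2)]
  have cq: "c - q < c" "c - (c - q) = q" using q_pos q_le c_pos by auto
  let ?P = "coef gb hb f (c - q)"
  have admP: "adm 2 q ?P" using goodD(3)[OF base f(1) cq(1)] by (simp add: cq(2))
  obtain b e D where b: "b \<noteq> 0 \<longrightarrow> (\<forall>i. M * e $ i = q * r $ i) \<and> M * D = q * d"
    "\<And>\<sigma>'. 0 < \<sigma>' \<Longrightarrow> \<sigma>' < 2 \<Longrightarrow> strict \<sigma>' q (?P - pmono b e D)" using adm_lead[OF admP] by blast
  have st: "strict 1 q (?P - pmono b e D)" using b(2)[of 1] by simp
  have "b \<noteq> 0"
  proof
    assume "b = 0"
    then have "strict 1 q (?P - 0 ^ q)" using st q_pos by (simp add: zero_power)
    then show False using not_power_good[OF nm np base] by simp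
  qed
  then have eD: "\<forall>i. M * e $ i = q * r $ i" "M * D = q * d" using b(1) by auto
  have "mps_coeff (fps_nth (?P - pmono b e D) D) e = 0"
  proof (rule ccontr)
    assume "mps_coeff (fps_nth (?P - pmono b e D) D) e \<noteq> 0"
    then have "Suc (q * \<mu> 1) \<le> M * (wdot 1 e + 1 * D)" by (rule ord_geD[OF st])
    moreover have "M * wdot 1 e = q * wdot 1 r" using eD(1) by (simp add: wdot_def sum_distrib_left)
    ultimately show False using eD(2) by (simp add: \<mu>_def algebra_simps)
  qed
  then have lead: "mps_coeff (fps_nth ?P D) e \<noteq> 0"
    using \<open>b \<noteq> 0\<close> unfolding fps_sub_nth mps_coeff_diff pmono_nth by simp
  have Dpos: "0 < D" using eD(2) q_pos d_pos by (cases D) auto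
  have "M * D < M * q" unfolding eD(2) using dM q_pos by (simp add: mult.commute)
  then have Dq: "D < q" by simp
  obtain N t where Nt: "D = N * t" "frob TYPE('k) N" "of_nat t \<noteq> (0 :: 'k)"
    using frob_decomposition[OF Dpos] by blast
  have good_tr_k: "good (tr gb hb ` J) (Suc k) (fps_const (Gs k - Gs 1)) (Hs k - hb)" for k
  proof -
    have "shift hb (fps_const (Gs k) - gb) = fps_const (Gs k - Gs 1)"
      unfolding gb_def filt_homD(5)[OF T] shift_const[OF b1(2)] by simp
    then show ?thesis using GH[of k] good_tr[OF b1 goodD(1,2)[OF GH[of k]], of J "Suc k"] by simp
  qed
  have good_tr_0: "good (tr gb hb ` J) 2 0 0"
    using base good_tr[OF b1 b1, of J 2] by (simp add: filt_homD(4)[OF T])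
  interpret fx: flexible r d c "tr gb hb ` J" "tr gb hb f" q N t D e "\<lambda>k. Gs k - Gs 1" "\<lambda>k. Hs k - hb"
  proof
    show "tr gb hb f \<in> tr gb hb ` J" using f(1) by blast
    show "fps_nth (tr gb hb f) c dvd 1" using coef_unit(1)[OF b1 f(2)] by (simp add: tr_def coef_def)
    show "mps_coeff (fps_nth (fps_nth (tr gb hb f) (c - q)) D) e \<noteq> 0"
      using lead by (simp add: tr_def coef_def)
  qed (use q_pos q_le q(3) Nt Dq eD good_tr_0 good_tr_k in auto)
  obtain g h where gh: "\<forall>\<sigma>>0. good (tr gb hb ` J) \<sigma> g h" using fx.flexible_limit by blast
  then have gh1: "g \<in> fl (Suc 0)" "h \<in> fl (Suc 0)" using goodD(1,2) by blast+
  define g' h' where "g' = shift (- hb) g + gb" and "h' = h + hb"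
  have g'1: "g' \<in> fl (Suc 0)" "h' \<in> fl (Suc 0)"
    unfolding g'_def h'_def
    by (intro fl_add gh1 b1 filt_homD(3)[OF filt_hom_shift[OF fl_uminus[OF b1(2)]]])+
  have "shift hb (g' - gb) = g" "h' - hb = h" by (simp_all add: g'_def h'_def shift_inverse(2)[OF b1(2)])
  then have "\<forall>\<sigma>>0. good J \<sigma> g' h'" using gh good_tr[OF b1 g'1, of J] by simp
  then show ?thesis by blast
qed

lemma good_limit_exists:
  assumes clean: "middle \<or> high \<or> not_power" and good: "\<And>\<sigma>. 0 < \<sigma> \<Longrightarrow> \<exists>g h. good J \<sigma> g h"
  shows "\<exists>g h. \<forall>\<sigma>>0. good J \<sigma> g h"
proof (cases rigid)
  case True
  then show ?thesis using rigid_limit good by blast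
next
  case False
  then have "\<not> middle" "not_power" "d < M" using clean by (auto simp: rigid_def)
  then show ?thesis using flexible_exists good by blast
qed

end

section \<open>Clean elements\<close>

lemma hom_part_coeff: "mps_coeff (fps_nth (hom_part k F) s) e =
    (if wdot 1 e + s = k then mps_coeff (fps_nth F s) e else 0)"
  by (simp add: hom_part_def Abs_mps_inverse wdot_def)

lemma initial_form_eq:
  assumes "F \<in> fl k" "F \<notin> fl (Suc k)"
  shows "initial_form F = hom_part k F" "hom_part k F \<noteq> 0"
proof -
  have low: "k \<le> wdot 1 e + 1 * s" if "mps_coeff (fps_nth F s) e \<noteq> 0" for s e
    using assms(1) that unfolding wge_fl_iff[symmetric] by (rule wgeD)
  obtain s e where se: "mps_coeff (fps_nth F s) e \<noteq> 0" "wdot 1 e + s \<le> k"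
    using assms(2) unfolding wge_fl_iff[symmetric] wge_def by (auto simp: not_le)
  then have "wdot 1 e + s = k" using low[OF se(1)] by simp
  then have "mps_coeff (fps_nth (hom_part k F) s) e \<noteq> 0" using se(1) by (simp add: hom_part_coeff)
  then show nz: "hom_part k F \<noteq> 0" by auto
  have "hom_part j F = 0" if "j < k" for j
  proof (rule fps_mps_eqI)
    fix s e show "mps_coeff (fps_nth (hom_part j F) s) e = mps_coeff (fps_nth 0 s) e"
      using low[of s e] that by (cases "mps_coeff (fps_nth F s) e = 0") (auto simp: hom_part_coeff)
  qed
  then have "(LEAST k. hom_part k F \<noteq> 0) = k"
    using nz by (intro Least_equality) (auto simp: not_less[symmetric])
  moreover have "F \<noteq> 0" using assms(2) by auto
  ultimately show "initial_form F = hom_part k F" by (simp add: initial_form_def)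
qed

lemma hom_part_frob_power:
  fixes F :: "('k::comm_ring_1, 'n::finite) mps fps"
  assumes q: "frob TYPE('k) q"
  shows "hom_part (q * k) (F ^ q) = hom_part k F ^ q"
proof (rule fps_mps_eqI)
  fix s e
  have qpos: "0 < q" by (rule frob_pos[OF q])
  show "mps_coeff (fps_nth (hom_part (q * k) (F ^ q)) s) e = mps_coeff (fps_nth (hom_part k F ^ q) s) e"
  proof (cases "q dvd s \<and> (\<forall>i. q dvd e $ i)")
    case True
    then have "e = (\<chi> i. q * (\<chi> i. e $ i div q) $ i)" by (simp add: vec_eq_iff)
    then have "wdot 1 e = q * wdot 1 (\<chi> i. e $ i div q)" by (metis wdot_mult)
    moreover have "s = q * (s div q)" using True by simp
    ultimately have "wdot 1 e + s = q * (wdot 1 (\<chi> i. e $ i div q) + s div q)" by (simp add: distrib_left)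
    then have "wdot 1 e + s = q * k \<longleftrightarrow> wdot 1 (\<chi> i. e $ i div q) + s div q = k" using qpos by simp
    then show ?thesis
      using True qpos by (simp add: hom_part_coeff mps_fps_frob_power[OF q] zero_power)
  next
    case False
    then show ?thesis using qpos by (auto simp: hom_part_coeff mps_fps_frob_power[OF q] zero_power)
  qed
qed

lemma ideal_ord_0: "ideal_ord {0 :: 'a::comm_ring_1} = \<infinity>"
proof -
  have "(0 :: 'a) \<in> ideal_power max_ideal n" for n
    by (cases n) (simp_all add: ideal_mult_def ideal.span_zero)
  then have set: "{enat n |n. {0 :: 'a} \<subseteq> ideal_power max_ideal n} = range enat" by auto
  have "infinite (range enat)" by (simp add: range_inj_infinite inj_def)
  then show ?thesis unfolding ideal_ord_def set by (simp add: Sup_enat_def)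
qed

context exponents
begin

lemma ord_ge_elt_ord:
  fixes F :: "('k::field, 'n) mps fps"
  shows "ord_ge 1 n F \<longleftrightarrow> enat n \<le> enat M * elt_ord F"
proof (cases "elt_ord F")
  case (enat k)
  have F: "F \<in> fl j \<longleftrightarrow> j \<le> k" for j
    using le_ideal_ord_iff_fps[of j "{F}"] by (simp add: enat)
  have low: "k \<le> wdot 1 e + s" if "mps_coeff (fps_nth F s) e \<noteq> 0" for s e
  proof -
    have "wge 1 1 k F" using F by (simp only: wge_fl_iff)
    from wgeD[OF this that] show ?thesis by simp
  qed
  have "\<not> wge 1 1 (Suc k) F" using F unfolding wge_fl_iff by simp
  then obtain s e where se: "mps_coeff (fps_nth F s) e \<noteq> 0" "wdot 1 e + s \<le> k"
    unfolding wge_def by (auto simp: not_le)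
  have "ord_ge 1 n F \<longleftrightarrow> n \<le> M * k"
  proof
    assume "ord_ge 1 n F"
    from ord_geD[OF this se(1)] show "n \<le> M * k" using se(2) by (metis mult_le_mono2 mult_1 order_trans)
  next
    assume n: "n \<le> M * k"
    show "ord_ge 1 n F"
    proof (rule ord_geI)
      fix s e assume "mps_coeff (fps_nth F s) e \<noteq> 0"
      then have "M * k \<le> M * (wdot 1 e + 1 * s)" using low by simp
      then show "n \<le> M * (wdot 1 e + 1 * s)" using n by (rule order_trans[rotated])
    qed
  qed
  then show ?thesis by (simp add: enat)
next
  case infinity
  have "F \<in> fl j" for j using le_ideal_ord_iff_fps[of j "{F}"] by (simp add: infinity)
  then have "F = 0" by (rule fl_separated)
  then show ?thesis using M_pos by (simp add: ideal_ord_0)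
qed

text \<open>The three conditions translate as follows. With $m = \mathrm{ord}\,J_{-1} = |r| + d$, the orders of $f_i$ in the first two are
  compared with the lowest admissible weight. In the third, if $f_{c-q}$ and $\Gamma^q$ agreed in the lowest weight, the
  initial form of $f_{c-q}$ would be a $q$-th power, and the initial form of $f_c$ is a constant that has a $q$-th root.\<close>

lemma clean_element_of_ord_clean:
  fixes J :: "('k::alg_closed_field, 'n) mps fps fps set"
  assumes fac: "factorization r d (coeff_ideal c fps_X J) I" and clean: "ord_clean c J f"
  obtains q \<kappa> where "clean_element r d c J f q \<kappa>"
    "clean_element.middle r d c f q \<or> clean_element.high r d c f q \<or> clean_element.not_power r d c f q"
proof -
  define q where "q = char_power TYPE('k) c"
  have fac': "factorization r d (J1 c J 0) I" using fac by (simp add: J1_def)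
  have f: "f \<in> J" "z_regular c f" using clean by (simp_all add: ord_clean_def)
  have q: "frob TYPE('k) q \<and> (\<exists>t. c = q * t \<and> of_nat t \<noteq> (0 :: 'k))"
  proof (cases "CHAR('k) = 0")
    case True
    then have "of_nat c \<noteq> (0 :: 'k)" using c_pos by (simp add: of_nat_eq_0_iff_char_dvd)
    then show ?thesis using True frob_1 by (auto simp: q_def char_power_def)
  next
    case False
    then have "prime CHAR('k)" by (intro prime_CHAR_semidom) simp
    then have "\<not> is_unit CHAR('k)" by auto
    then obtain t where "c = CHAR('k) ^ multiplicity CHAR('k) c * t" "\<not> CHAR('k) dvd t"
      using multiplicity_decompose'[of c "CHAR('k)"] c_pos by auto
    then show ?thesis
      using False frob_CHAR_power[OF False] by (auto simp: q_def char_power_def of_nat_eq_0_iff_char_dvd)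
  qed
  then obtain t where t: "c = q * t" "of_nat t \<noteq> (0 :: 'k)" and qf: "frob TYPE('k) q" by blast
  have q_pos: "0 < q" by (rule frob_pos[OF qf])
  have "(of_nat ((q * t + 0) choose (q * 1 + 0)) :: 'k) = of_nat (t choose 1) * of_nat (0 choose 0)"
    by (rule frob_binomial[OF qf q_pos q_pos])
  then have bin: "(of_nat (c choose q) :: 'k) \<noteq> 0" using t by simp
  let ?a = "mps_coeff (fps_nth (fps_nth f c) 0) 0"
  obtain u where u: "u dvd 1" "restrict_z f = fps_X ^ c * u" using f(2) by (auto simp: z_regular_def)
  have "?a = fps_nth (restrict_z f) c" by (simp add: restrict_z_def)
  also have "\<dots> = fps_nth u 0" unfolding u(2) by (simp add: fps_X_power_mult_nth)
  finally have a: "?a \<noteq> 0"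
  proof -
    assume eq: "?a = fps_nth u 0"
    obtain v where "1 = u * v" using u(1) by (rule dvdE)
    then have "fps_nth u 0 * fps_nth v 0 = 1" by (metis fps_mult_nth_0 fps_one_nth)
    then show ?thesis using eq by auto
  qed
  have fc: "fps_nth f c dvd 1" using a by (simp only: fps_unit_iff mps_unit_iff not_False_eq_True)
  obtain \<kappa> :: 'k where \<kappa>: "\<kappa> ^ q = of_nat (c choose q) * ?a"
    using nth_root_exists[OF q_pos] by blast
  have "\<kappa> \<noteq> 0" using \<kappa> bin a q_pos by (auto simp: zero_power)
  have clean_el: "clean_element r d c J f q \<kappa>"
  proof unfold_locales
    show "good J 1 0 0" by (rule good_1_of_factorization[OF fac']) auto
    show "\<exists>f\<in>J. \<exists>i<c. \<not> strict 1 (c - i) (fps_nth f i)"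
      using factorization_not_strict[OF fac', of 0] by (simp add: coef_def)
  qed (use f(1) fc qf t(1) bin \<kappa> \<open>\<kappa> \<noteq> 0\<close> in auto)
  then interpret ce: clean_element r d c J f q \<kappa> .
  have ord: "ideal_ord (coeff_ideal c fps_X J) = enat (\<mu> 1)" by (rule ideal_ord_J1[OF fac])
  have st: "strict 1 l F \<longleftrightarrow> enat (l * \<mu> 1) < enat M * elt_ord F" for l and F :: "('k, 'n) mps fps"
    unfolding ord_ge_elt_ord by (rule Suc_ile_eq)
  have M: "fact c = M" by (simp add: M_def)
  let ?P = "fps_nth f (c - q)"
  from clean consider
    (1) i where "c - q < i" "i < c" "enat M * elt_ord (fps_nth f i) = enat (c - i) * enat (\<mu> 1)"
    | (2) "enat q * enat (\<mu> 1) < enat M * elt_ord ?P"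
    | (3) "\<nexists>G. initial_form ?P = initial_form (fps_nth f c) * G ^ q"
    unfolding ord_clean_def Let_def ord q_def[symmetric] M by blast
  then have "ce.middle \<or> ce.high \<or> ce.not_power"
  proof cases
    case 1
    then have "\<not> strict 1 (c - i) (fps_nth f i)" unfolding st by simp
    then show ?thesis using 1 ce.middle_def by blast
  next
    case 2
    then have "strict 1 q ?P" unfolding st by simp
    then show ?thesis using ce.high_def by blast
  next
    case 3
    have "ce.not_power" if nh: "\<not> ce.high"
      unfolding ce.not_power_def
    proof (intro allI notI)
      fix \<Gamma> assume \<Gamma>: "strict 1 q (?P - \<Gamma> ^ q)"
      have cq: "c - q < c" "c - (c - q) = q" using q_pos ce.q_le c_pos by auto
      have P: "ord_ge 1 (q * \<mu> 1) ?P"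
        using goodD(4)[OF ce.good_0 f(1) cq(1)] unfolding cq(2) by (simp add: coef_def)
      have "\<not> strict 1 q ?P" using nh by (simp add: ce.high_def)
      then obtain s e where se: "mps_coeff (fps_nth ?P s) e \<noteq> 0" "M * (wdot 1 e + 1 * s) \<le> q * \<mu> 1"
        using ord_geI[of ?P "Suc (q * \<mu> 1)" 1] by (metis not_less_eq_eq)
      define k where "k = wdot 1 e + s"
      have k: "M * k = q * \<mu> 1" using ord_geD[OF P se(1)] se(2) by (simp add: k_def)
      have Pk: "?P \<in> fl k"
        unfolding wge_fl_iff[symmetric] wge_def
      proof (intro allI impI)
        fix s e assume "mps_coeff (fps_nth ?P s) e \<noteq> 0"
        from ord_geD[OF P this] have "M * k \<le> M * (wdot 1 e + 1 * s)" unfolding k .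
        then show "k \<le> wdot 1 e + 1 * s" using M_pos by simp
      qed
      have Pk': "?P \<notin> fl (Suc k)"
        unfolding wge_fl_iff[symmetric] using wgeD[OF _ se(1), of 1 1 "Suc k"] by (auto simp: k_def)
      have hp: "hom_part k ?P = hom_part k (\<Gamma> ^ q)"
      proof (rule fps_mps_eqI)
        fix s e show "mps_coeff (fps_nth (hom_part k ?P) s) e = mps_coeff (fps_nth (hom_part k (\<Gamma> ^ q)) s) e"
        proof (cases "wdot 1 e + s = k")
          case True
          have "mps_coeff (fps_nth (?P - \<Gamma> ^ q) s) e = 0"
          proof (rule ccontr)
            assume "mps_coeff (fps_nth (?P - \<Gamma> ^ q) s) e \<noteq> 0"
            from ord_geD[OF \<Gamma> this] show False using True k by simp
          qed
          then show ?thesis by (simp add: hom_part_coeff)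
        qed (simp add: hom_part_coeff)
      qed
      note inP = initial_form_eq[OF Pk Pk']
      obtain k' where k': "k = q * k'"
      proof -
        have "\<exists>s e. mps_coeff (fps_nth (hom_part k (\<Gamma> ^ q)) s) e \<noteq> 0"
          using inP(2) unfolding hp by (metis fps_mps_eqI fps_zero_nth mps_coeff_zero)
        then obtain s e where nz: "mps_coeff (fps_nth (hom_part k (\<Gamma> ^ q)) s) e \<noteq> 0" by blast
        then have dv: "wdot 1 e + s = k" "q dvd s" "\<forall>i. q dvd e $ i"
          by (auto simp: hom_part_coeff mps_fps_frob_power[OF qf] split: if_splits)
        have "q dvd wdot 1 e" unfolding wdot_def using dv(3) by (intro dvd_sum dvd_mult) auto
        then have "q dvd k" using dv(1,2) by auto
        then show thesis using that by blast
      qed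
      have in_P: "initial_form ?P = hom_part k' \<Gamma> ^ q"
        unfolding inP(1) hp unfolding k' by (rule hom_part_frob_power[OF qf])
      have "fps_nth f c \<notin> fl (Suc 0)" using a by (simp add: fl_fps_1_iff fl_mps_1_iff)
      from initial_form_eq(1)[OF _ this] have "initial_form (fps_nth f c) = hom_part 0 (fps_nth f c)" by simp
      also have "\<dots> = fps_const (mterm ?a 0)"
      proof (rule fps_mps_eqI)
        fix s e
        have "wdot 1 e = 0 \<longleftrightarrow> e = 0" for e :: "nat ^ 'n" by (simp add: wdot_def vec_eq_iff)
        then show "mps_coeff (fps_nth (hom_part 0 (fps_nth f c)) s) e =
            mps_coeff (fps_nth (fps_const (mterm ?a 0)) s) e"
          by (auto simp: hom_part_coeff mps_coeff_mterm)
      qed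
      finally have in_c: "initial_form (fps_nth f c) = fps_const (mterm ?a 0)" .
      obtain b where b: "b ^ q = 1 / ?a" using nth_root_exists[OF q_pos] by blast
      have "fps_const (mterm ?a 0) * (fps_const (mterm b 0) * hom_part k' \<Gamma>) ^ q =
          fps_const (mterm (?a * b ^ q) 0) * hom_part k' \<Gamma> ^ q"
        by (simp add: power_mult_distrib fps_const_power mterm_power mterm_mult mult.assoc[symmetric])
      also have "\<dots> = initial_form ?P"
        unfolding in_P using a by (simp add: b mterm_1)
      finally have "initial_form ?P = initial_form (fps_nth f c) * (fps_const (mterm b 0) * hom_part k' \<Gamma>) ^ q"
        unfolding in_c ..
      then show False using 3 by blast
    qed
    then show ?thesis by blast
  qed
  then show thesis by (rule that[OF clean_el])
qed

end

section \<open>The maximum\<close>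

context clean_element
begin

text \<open>If the values of $s$ are unbounded, good pairs exist for all weights, and a pair that is good for all weights has the value
  $\infty$. Otherwise there are only finitely many values.\<close>

lemma maximum_exists:
  assumes clean: "middle \<or> high \<or> not_power" and zero: "(0, 0) \<in> coord_changes r c d J"
  shows "\<exists>gh \<in> coord_changes r c d J. \<forall>gh' \<in> coord_changes r c d J.
    ideal_ord (J2 r c d J (fst gh') (snd gh')) \<le> ideal_ord (J2 r c d J (fst gh) (snd gh))"
proof -
  let ?s = "\<lambda>gh. ideal_ord (J2 r c d J (fst gh) (snd gh))"
  show ?thesis
  proof (cases "\<forall>\<sigma>>0. \<exists>gh\<in>coord_changes r c d J. enat (fact d * \<sigma>) \<le> ?s gh")
    case True
    have ex: "\<exists>g h. good J \<sigma> g h" if \<sigma>: "0 < \<sigma>" for \<sigma>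
    proof -
      obtain gh where gh: "gh \<in> coord_changes r c d J" "enat (fact d * \<sigma>) \<le> ?s gh"
        using True \<sigma> by blast
      have "(fst gh, snd gh) \<in> coord_changes r c d J" using gh(1) by simp
      from good_of_J2_ord[OF this gh(2)] show ?thesis by blast
    qed
    from good_limit_exists[OF clean ex] obtain g h where gh: "\<forall>\<sigma>>0. good J \<sigma> g h" by blast
    then have "good J 1 g h" by simp
    have "\<exists>f\<in>J. \<exists>i<c. \<not> strict 1 (c - i) (coef g h f i)"
      by (rule not_strict_good[OF clean \<open>good J 1 g h\<close>]) simp
    then have "(g, h) \<in> coord_changes r c d J" "?s (g, h) = \<infinity>"
      using good_all_imp_J2_zero[OF gh[rule_format]] by simp_all
    then show ?thesis by (intro bexI[of _ "(g, h)"]) simp_all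
  next
    case False
    then obtain \<sigma> where "\<forall>gh\<in>coord_changes r c d J. \<not> enat (fact d * \<sigma>) \<le> ?s gh" by blast
    then have \<sigma>: "?s gh < enat (fact d * \<sigma>)" if "gh \<in> coord_changes r c d J" for gh
      using that unfolding not_le by blast
    have "?s ` coord_changes r c d J \<subseteq> enat ` {..<fact d * \<sigma>}"
    proof (rule image_subsetI)
      fix gh assume "gh \<in> coord_changes r c d J"
      from \<sigma>[OF this] show "?s gh \<in> enat ` {..<fact d * \<sigma>}" by (cases "?s gh") simp_all
    qed
    then have fin: "finite (?s ` coord_changes r c d J)" by (rule finite_subset) simp
    moreover have "?s ` coord_changes r c d J \<noteq> {}" using zero by blast
    ultimately have "Max (?s ` coord_changes r c d J) \<in> ?s ` coord_changes r c d J" by (rule Max_in)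
    then obtain gh where gh: "gh \<in> coord_changes r c d J" "?s gh = Max (?s ` coord_changes r c d J)" by auto
    have "?s gh' \<le> ?s gh" if "gh' \<in> coord_changes r c d J" for gh'
      unfolding gh(2) using fin that by (intro Max_ge) auto
    then show ?thesis using gh(1) by (intro bexI[of _ gh] ballI)
  qed
qed

end

theorem proposition5p3p5:
  fixes J :: "('k::alg_closed_field, 'n::finite) mps fps fps set"
    and I :: "('k, 'n) mps fps set"
    and r :: "nat ^ 'n" and c d :: nat
  assumes "c > 0"
    and "is_ideal J"
    and "ideal_ord J = enat c"
    and "factorization r d (coeff_ideal c fps_X J) I"
    and "\<exists>f. ord_clean c J f"
  shows "\<exists>(g_max, h_max) \<in> coord_changes r c d J. \<forall>(g, h) \<in> coord_changes r c d J.
           ideal_ord (J2 r c d J g_max h_max) \<ge> ideal_ord (J2 r c d J g h)"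
proof -
  have "factorization r d (J1 c J 0) I" using assms(4) by (simp add: J1_def)
  then have zero: "(0, 0) \<in> coord_changes r c d J"
    by (auto simp: coord_changes_def ideal_ord_0)
  have attained: ?thesis if "gh \<in> coord_changes r c d J" "ideal_ord (J2 r c d J (fst gh) (snd gh)) = \<infinity>" for gh
    using that by (intro bexI[of _ gh]) (simp_all add: case_prod_unfold)
  show ?thesis
  proof (cases "d = 0")
    case True
    \<comment> \<open>By convention $\mathrm{coeff}^0 = 0$, so every change of coordinates has the value $\infty$.\<close>
    then have "J2 r c d J 0 0 = {0}" by (simp add: J2_def coeff_ideal_def)
    then show ?thesis using attained[OF zero] by (simp add: ideal_ord_0)
  next
    case False
    interpret exponents r d c using False assms(1) by unfold_locales auto
    obtain f where f: "ord_clean c J f" using assms(5) by blast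
    obtain q \<kappa> where ce: "clean_element r d c J f q \<kappa>"
      and clean: "clean_element.middle r d c f q \<or> clean_element.high r d c f q \<or> clean_element.not_power r d c f q"
      using clean_element_of_ord_clean[OF assms(4) f] .
    show ?thesis
      using clean_element.maximum_exists[OF ce clean zero] by (simp add: case_prod_unfold)
  qed
qed

end
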